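(* Let $X$ be a compact $1$-dimensional geodesic space, and assume $X$ is not contractible (so that $Conv(X)\neq\emptyset$). Then $X$ deformation retracts onto its $\pi_1$-hull $Conv(X)$. In particular, the inclusion $Conv(X)\hookrightarrow X$ induces an isomorphism $\pi_1(Conv(X))\cong\pi_1(X)$.
   Context: A path in a metric space $(X,d)$ is a continuous map $\gamma:[a,b]\to X$; a loop is a path with $\gamma(a)=\gamma(b)$. The length of a path is $l(\gamma)=\sup\sum_{i=1}^n d(\gamma(x_{i-1}),\gamma(x_i))$ over all finite $a=x_0<\dots<x_n=b$; $\gamma$ is rectifiable if $l(\gamma)<\infty$. A geodesic space is a metric space $(X,d)$ in which $d(p,q)$ is the infimum of the lengths of paths from $p$ to $q$ and this infimum is attained, for all $p,q$. Dimension means Lebesgue covering dimension. A geodesic loop is a rectifiable loop of minimal length in its free homotopy class. The $\pi_1$-hull $Conv(X)\subseteq X$ is the union of the images of all non-constant geodesic loops in $X$. *)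

theory Defs
  imports "HOL-Analysis.Analysis" "HOL-Algebra.Group"
begin

section \<open>Lebesgue covering dimension\<close>

text \<open>The order of a cover is measured pointwise; the finiteness conjunct is needed because the
  cardinality of an infinite set is 0.\<close>

definition covering_dim_le :: "'a topology \<Rightarrow> nat \<Rightarrow> bool" where
  "covering_dim_le X n \<longleftrightarrow>
     (\<forall>\<U>. (\<forall>U\<in>\<U>. openin X U) \<and> \<Union>\<U> = topspace X \<longrightarrow>
        (\<exists>\<V>. (\<forall>V\<in>\<V>. openin X V) \<and> \<Union>\<V> = topspace X \<and> (\<forall>V\<in>\<V>. \<exists>U\<in>\<U>. V \<subseteq> U) \<and>
             (\<forall>x\<in>topspace X. finite {V \<in> \<V>. x \<in> V} \<and> card {V \<in> \<V>. x \<in> V} \<le> n + 1)))"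

text \<open>The empty space has dimension -1, hence no dimension in the natural numbers.\<close>

definition has_covering_dim :: "'a topology \<Rightarrow> nat \<Rightarrow> bool" where
  "has_covering_dim X n \<longleftrightarrow>
     topspace X \<noteq> {} \<and> covering_dim_le X n \<and> (\<forall>m<n. \<not> covering_dim_le X m)"


section \<open>Length of paths, geodesic spaces, geodesic loops\<close>

text \<open>A metric space is a subset of a type of class \<^class>\<open>metric_space\<close> with the restricted metric;
  paths are parametrised by the unit interval, as everywhere in the library.\<close>

definition partitions01 :: "(nat \<times> (nat \<Rightarrow> real)) set" where
  "partitions01 = {(n, x). x 0 = 0 \<and> x n = 1 \<and> (\<forall>i<n. x i < x (Suc i))}"

definition path_length :: "(real \<Rightarrow> 'a::metric_space) \<Rightarrow> ennreal" where
  "path_length \<gamma> =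
     (SUP (n, x) \<in> partitions01. \<Sum>i<n. ennreal (dist (\<gamma> (x i)) (\<gamma> (x (Suc i)))))"

definition rectifiable :: "(real \<Rightarrow> 'a::metric_space) \<Rightarrow> bool" where
  "rectifiable \<gamma> \<longleftrightarrow> path_length \<gamma> < \<infinity>"

definition paths_between :: "'a::topological_space set \<Rightarrow> 'a \<Rightarrow> 'a \<Rightarrow> (real \<Rightarrow> 'a) set" where
  "paths_between X p q =
     {\<gamma>. path \<gamma> \<and> path_image \<gamma> \<subseteq> X \<and> pathstart \<gamma> = p \<and> pathfinish \<gamma> = q}"

definition geodesic_space :: "'a::metric_space set \<Rightarrow> bool" where
  "geodesic_space X \<longleftrightarrow>
     (\<forall>p\<in>X. \<forall>q\<in>X.
        ennreal (dist p q) = (INF \<gamma> \<in> paths_between X p q. path_length \<gamma>) \<and>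
        (\<exists>\<gamma> \<in> paths_between X p q. path_length \<gamma> = ennreal (dist p q)))"

definition geodesic_loop :: "'a::metric_space set \<Rightarrow> (real \<Rightarrow> 'a) \<Rightarrow> bool" where
  "geodesic_loop X \<gamma> \<longleftrightarrow>
     path \<gamma> \<and> path_image \<gamma> \<subseteq> X \<and> pathfinish \<gamma> = pathstart \<gamma> \<and> rectifiable \<gamma> \<and>
     (\<forall>\<eta>. homotopic_loops X \<gamma> \<eta> \<longrightarrow> path_length \<gamma> \<le> path_length \<eta>)"

definition pi1_hull :: "'a::metric_space set \<Rightarrow> 'a set" where
  "pi1_hull X = \<Union> {path_image \<gamma> | \<gamma>. geodesic_loop X \<gamma> \<and> \<not> \<gamma> constant_on {0..1}}"


section \<open>Deformation retracts\<close>

text \<open>The homotopy from the identity to the retraction keeps the points of \<open>A\<close> fixed at all times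
  (what some authors call a strong deformation retraction).\<close>

definition deformation_retracts_onto :: "'a::topological_space set \<Rightarrow> 'a set \<Rightarrow> bool" where
  "deformation_retracts_onto X A \<longleftrightarrow>
     (\<exists>r. retraction X A r \<and> homotopic_with_canon (\<lambda>h. \<forall>a\<in>A. h a = a) X X id r)"


section \<open>The fundamental group\<close>

definition path_class :: "'a::topological_space set \<Rightarrow> (real \<Rightarrow> 'a) \<Rightarrow> (real \<Rightarrow> 'a) set" where
  "path_class S p = {q. homotopic_paths S p q}"

text \<open>Operations on classes are unions over all representatives; on elements of the carrier they are
  single classes again (see \<open>mult_path_class\<close> and \<open>pi1_map_path_class\<close>).\<close>

definition pi1 :: "'a::topological_space set \<Rightarrow> 'a \<Rightarrow> (real \<Rightarrow> 'a) set monoid" where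
  "pi1 S a =
     \<lparr> carrier = path_class S ` paths_between S a a,
       mult = (\<lambda>A B. \<Union>p\<in>A. \<Union>q\<in>B. path_class S (p +++ q)),
       one = path_class S (\<lambda>_. a) \<rparr>"

definition pi1_map ::
  "'b::topological_space set \<Rightarrow> ('a::topological_space \<Rightarrow> 'b) \<Rightarrow> (real \<Rightarrow> 'a) set \<Rightarrow> (real \<Rightarrow> 'b) set"
  where "pi1_map T f A = (\<Union>p\<in>A. path_class T (f \<circ> p))"

lemma path_class_eq:
  assumes "homotopic_paths S p q"
  shows "path_class S p = path_class S q"
proof -
  have "homotopic_paths S p r \<longleftrightarrow> homotopic_paths S q r" for r
    using homotopic_paths_trans [OF assms] homotopic_paths_trans [OF homotopic_paths_sym [OF assms]]
    by iprover
  then show ?thesis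
    by (simp add: path_class_def)
qed

lemma mult_path_class:
  assumes "p \<in> paths_between S a a" "q \<in> paths_between S a a"
  shows "path_class S p \<otimes>\<^bsub>pi1 S a\<^esub> path_class S q = path_class S (p +++ q)"
proof -
  have *: "path_class S (p' +++ q') = path_class S (p +++ q)"
    if "p' \<in> path_class S p" "q' \<in> path_class S q" for p' q'
  proof (rule path_class_eq, rule homotopic_paths_sym, rule homotopic_paths_join)
    show "homotopic_paths S p p'" "homotopic_paths S q q'"
      using that by (simp_all add: path_class_def)
    show "pathfinish p = pathstart q"
      using assms by (simp add: paths_between_def)
  qed
  have "p \<in> path_class S p" "q \<in> path_class S q"
    using assms by (auto simp: path_class_def paths_between_def)
  then have "(\<Union>p'\<in>path_class S p. \<Union>q'\<in>path_class S q. path_class S (p' +++ q')) = path_class S (p +++ q)"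
    by (intro equalityI UN_least equalityD1 [OF *] SUP_upper2 [where i = p] SUP_upper2 [where i = q]
        order_refl)
  then show ?thesis
    by (simp add: pi1_def)
qed

lemma pi1_map_path_class:
  assumes "p \<in> paths_between S a a" "continuous_on S f" "f \<in> S \<rightarrow> T"
  shows "pi1_map T f (path_class S p) = path_class T (f \<circ> p)"
proof -
  have *: "path_class T (f \<circ> p') = path_class T (f \<circ> p)" if "p' \<in> path_class S p" for p'
  proof (rule path_class_eq, rule homotopic_paths_sym, rule homotopic_paths_continuous_image)
    show "homotopic_paths S p p'"
      using that by (simp add: path_class_def)
  qed (use assms in auto)
  have "p \<in> path_class S p"
    using assms by (auto simp: path_class_def paths_between_def)
  then show ?thesis
    unfolding pi1_map_def
    by (intro equalityI UN_least equalityD1 [OF *] SUP_upper2 [where i = p] order_refl)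
qed

text \<open>The unit and inverse laws of the library are stated for real normed vector spaces only; they are
  transported from the unit interval along the path itself.\<close>

lemma homotopic_paths_along:
  fixes p :: "real \<Rightarrow> 'a::topological_space"
  assumes "path p" "path_image p \<subseteq> S" "homotopic_paths {0..1} g h"
  shows "homotopic_paths S (p \<circ> g) (p \<circ> h)"
  using assms(3)
  by (rule homotopic_paths_continuous_image) (use assms(1,2) in \<open>auto simp: path_def path_image_def\<close>)

lemma homotopic_paths_const_right:
  assumes "path p" "path_image p \<subseteq> S"
  shows "homotopic_paths S (p +++ (\<lambda>_. pathfinish p)) p"
proof -
  have "homotopic_paths {0..1} (linepath 0 1 +++ linepath (1::real) 1) (linepath 0 1)"
    by (rule homotopic_paths_rid') (auto simp: closed_segment_eq_real_ivl)
  moreover have "p \<circ> (linepath 0 1 +++ linepath 1 1) = p +++ (\<lambda>_. pathfinish p)"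
    by (rule ext) (simp add: joinpaths_def linepath_def pathfinish_def)
  moreover have "p \<circ> (linepath 0 1) = p"
    by (rule ext) (simp add: linepath_def pathfinish_def)
  ultimately show ?thesis
    using homotopic_paths_along [OF assms] by metis
qed

lemma homotopic_paths_const_left:
  assumes "path p" "path_image p \<subseteq> S"
  shows "homotopic_paths S ((\<lambda>_. pathstart p) +++ p) p"
proof -
  have "homotopic_paths {0..1} (linepath 0 (0::real) +++ linepath 0 1) (linepath 0 1)"
    by (rule homotopic_paths_lid') (auto simp: closed_segment_eq_real_ivl)
  moreover have "p \<circ> (linepath 0 0 +++ linepath 0 1) = (\<lambda>_. pathstart p) +++ p"
    by (rule ext) (simp add: joinpaths_def linepath_def pathstart_def)
  moreover have "p \<circ> (linepath 0 1) = p"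
    by (rule ext) (simp add: linepath_def pathfinish_def)
  ultimately show ?thesis
    using homotopic_paths_along [OF assms] by metis
qed

lemma homotopic_paths_reverse_left:
  assumes "path p" "path_image p \<subseteq> S"
  shows "homotopic_paths S (reversepath p +++ p) (\<lambda>_. pathfinish p)"
proof -
  have "homotopic_paths {0..1} (reversepath (linepath 0 (1::real)) +++ linepath 0 1)
          (linepath (pathfinish (linepath 0 (1::real))) (pathfinish (linepath 0 (1::real))))"
    by (rule homotopic_paths_linv) (auto simp: closed_segment_eq_real_ivl)
  moreover have "p \<circ> (reversepath (linepath 0 1) +++ linepath 0 1) = reversepath p +++ p"
    by (rule ext) (simp add: joinpaths_def linepath_def reversepath_def)
  moreover have "p \<circ> (linepath (pathfinish (linepath 0 1)) (pathfinish (linepath 0 1))) = (\<lambda>_. pathfinish p)"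
    by (rule ext) (simp add: linepath_def pathfinish_def)
  ultimately show ?thesis
    using homotopic_paths_along [OF assms] by metis
qed

lemma paths_between_join:
  "p \<in> paths_between S a b \<Longrightarrow> q \<in> paths_between S b c \<Longrightarrow> p +++ q \<in> paths_between S a c"
  by (simp add: paths_between_def subset_path_image_join)

lemma paths_between_reverse: "p \<in> paths_between S a b \<Longrightarrow> reversepath p \<in> paths_between S b a"
  by (simp add: paths_between_def)

lemma paths_between_const: "a \<in> S \<Longrightarrow> (\<lambda>_. a) \<in> paths_between S a a"
  by (auto simp: paths_between_def path_def path_image_def pathstart_def pathfinish_def)

lemma carrier_pi1: "carrier (pi1 S a) = path_class S ` paths_between S a a"
  and one_pi1: "\<one>\<^bsub>pi1 S a\<^esub> = path_class S (\<lambda>_. a)"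
  by (simp_all add: pi1_def)

lemma group_pi1:
  assumes "a \<in> S"
  shows "group (pi1 S a)"
proof (rule groupI)
  fix A B assume "A \<in> carrier (pi1 S a)" "B \<in> carrier (pi1 S a)"
  then show "A \<otimes>\<^bsub>pi1 S a\<^esub> B \<in> carrier (pi1 S a)"
    by (auto simp: carrier_pi1 mult_path_class intro!: imageI paths_between_join)
next
  show "\<one>\<^bsub>pi1 S a\<^esub> \<in> carrier (pi1 S a)"
    using assms by (simp add: carrier_pi1 one_pi1 paths_between_const)
next
  fix A B C
  assume "A \<in> carrier (pi1 S a)" "B \<in> carrier (pi1 S a)" "C \<in> carrier (pi1 S a)"
  then obtain p q r where *: "p \<in> paths_between S a a" "A = path_class S p"
    "q \<in> paths_between S a a" "B = path_class S q" "r \<in> paths_between S a a" "C = path_class S r"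
    by (auto simp: carrier_pi1)
  have "homotopic_paths S (p +++ (q +++ r)) ((p +++ q) +++ r)"
    by (rule homotopic_paths_assoc) (use * in \<open>simp_all add: paths_between_def\<close>)
  then have "path_class S ((p +++ q) +++ r) = path_class S (p +++ (q +++ r))"
    by (rule path_class_eq [symmetric])
  then show "A \<otimes>\<^bsub>pi1 S a\<^esub> B \<otimes>\<^bsub>pi1 S a\<^esub> C = A \<otimes>\<^bsub>pi1 S a\<^esub> (B \<otimes>\<^bsub>pi1 S a\<^esub> C)"
    using * by (simp add: mult_path_class paths_between_join)
next
  fix A assume "A \<in> carrier (pi1 S a)"
  then obtain p where p: "p \<in> paths_between S a a" "A = path_class S p"
    by (auto simp: carrier_pi1)
  then have "homotopic_paths S ((\<lambda>_. a) +++ p) p"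
    using homotopic_paths_const_left [of p S] by (simp add: paths_between_def)
  then show "\<one>\<^bsub>pi1 S a\<^esub> \<otimes>\<^bsub>pi1 S a\<^esub> A = A"
    using p assms
    by (simp add: one_pi1 mult_path_class paths_between_const
        path_class_eq [of S "(\<lambda>_. a) +++ p" p])
  have "homotopic_paths S (reversepath p +++ p) (\<lambda>_. a)"
    using homotopic_paths_reverse_left [of p S] p by (simp add: paths_between_def)
  then have "path_class S (reversepath p) \<otimes>\<^bsub>pi1 S a\<^esub> A = \<one>\<^bsub>pi1 S a\<^esub>"
    using p by (simp add: one_pi1 mult_path_class paths_between_reverse
        path_class_eq [of S "reversepath p +++ p" "\<lambda>_. a"])
  moreover have "path_class S (reversepath p) \<in> carrier (pi1 S a)"
    using p by (simp add: carrier_pi1 paths_between_reverse)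
  ultimately show "\<exists>B\<in>carrier (pi1 S a). B \<otimes>\<^bsub>pi1 S a\<^esub> A = \<one>\<^bsub>pi1 S a\<^esub>"
    by blast
qed

end

theory Submission
  imports Defs "HOL-Complex_Analysis.Complex_Analysis"
begin

text \<open>Call an open set \<open>W\<close> a branch with root \<open>w\<close> if it is clopen in \<open>X - {w}\<close> and \<open>W \<union> {w}\<close> contains no
  rectifiable simple loop, and call the complement of all branches the core. A simple loop avoids
  every branch, so two geodesics from a point to the core cannot diverge inside a branch: they would
  have to meet again at its root. Hence every point has a unique geodesic to the core, and sliding
  along these geodesics is a strong deformation retraction that strictly shortens every nonconstant
  loop leaving the core; geodesic loops therefore stay in the core.

  Conversely, a map from a closed subset of \<open>X\<close> to the circle is close to the restriction of a map
  from \<open>X\<close> to a punctured plane, because \<open>X\<close> has dimension 1. Winding numbers of such maps detect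
  simple loops, and minimising length subject to nonvanishing winding numbers yields geodesic loops.
  If a point \<open>x\<close> lies on a simple loop, or separates two of them, or is a limit of simple loops of
  lengths tending to 0, the detecting maps can be chosen so that the minimiser passes through \<open>x\<close>.
  In the remaining case \<open>x\<close> lies in a branch.\<close>

text \<open>\<open>X\<close> may be as wild as a Hawaiian earring: there need be no universal cover,
  so a limit of loops from one homotopy class cannot simply be assumed to stay in that class. This
  is why homotopy classes give way to winding numbers. A map to the punctured plane can be kept
  within distance 1 of the constant 1 outside a prescribed open set \<open>U\<close>, and then every
  loop with nonzero winding number has to enter \<open>U\<close>. Passing through \<open>x\<close>
  is enforced in three ways: by detectors on smaller and smaller balls about \<open>x\<close>; by
  one detector on each side of \<open>x\<close>, since a connected set meeting both sides contains
  \<open>x\<close>; or by detectors on annuli shrinking to \<open>x\<close>. In the last case no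
  single loop is at hand that meets all conditions, so they are imposed finitely many at a time, by
  loops with one common length bound, and combined by compactness. The dimension enters through the
  perturbation that moves extended maps off the origin. Noncontractibility enters through the
  existence of one simple loop: without any, sliding along geodesics to a base point would contract
  \<open>X\<close>.\<close>

section \<open>Length\<close>

text \<open>A path has length at most \<open>l\<close> iff its increments are dominated by those of a monotone
  function of total increase at most \<open>l\<close>. In this form length bounds pass to subpaths and joins
  without refining partitions.\<close>

definition len_le :: "(real \<Rightarrow> 'a::metric_space) \<Rightarrow> real \<Rightarrow> bool" where
  "len_le \<gamma> l \<longleftrightarrow>
     (\<exists>s. s 0 = 0 \<and> s 1 \<le> l \<and> (\<forall>a b. 0 \<le> a \<longrightarrow> a \<le> b \<longrightarrow> b \<le> 1 \<longrightarrow> dist (\<gamma> a) (\<gamma> b) \<le> s b - s a))"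

lemma len_leE:
  assumes "len_le \<gamma> l"
  obtains s :: "real \<Rightarrow> real" where "s 0 = 0" "s 1 \<le> l"
    "\<And>a b. 0 \<le> a \<Longrightarrow> a \<le> b \<Longrightarrow> b \<le> 1 \<Longrightarrow> dist (\<gamma> a) (\<gamma> b) \<le> s b - s a"
    "\<And>a b. 0 \<le> a \<Longrightarrow> a \<le> b \<Longrightarrow> b \<le> 1 \<Longrightarrow> s a \<le> s b"
proof -
  from assms obtain s where s: "s 0 = 0" "s 1 \<le> l"
    "\<And>a b. 0 \<le> a \<Longrightarrow> a \<le> b \<Longrightarrow> b \<le> 1 \<Longrightarrow> dist (\<gamma> a) (\<gamma> b) \<le> s b - s a"
    unfolding len_le_def by blast
  show ?thesis
  proof (rule that[OF s])
    fix a b :: real assume "0 \<le> a" "a \<le> b" "b \<le> 1"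
    from s(3)[OF this] show "s a \<le> s b" using zero_le_dist[of "\<gamma> a" "\<gamma> b"] by linarith
  qed
qed

lemma len_leI:
  assumes "s 0 = 0" "s 1 \<le> l"
    "\<And>a b. 0 \<le> a \<Longrightarrow> a \<le> b \<Longrightarrow> b \<le> 1 \<Longrightarrow> dist (\<gamma> a) (\<gamma> b) \<le> s b - s a"
  shows "len_le \<gamma> l"
  unfolding len_le_def using assms by blast

lemma len_le_mono: "len_le \<gamma> l \<Longrightarrow> l \<le> l' \<Longrightarrow> len_le \<gamma> l'"
  unfolding len_le_def by (meson order_trans)

lemma len_le_nonneg: "len_le \<gamma> l \<Longrightarrow> 0 \<le> l"
proof (erule len_leE)
  fix s :: "real \<Rightarrow> real"
  assume s: "s 0 = 0" "s 1 \<le> l" and mono: "\<And>a b. 0 \<le> a \<Longrightarrow> a \<le> b \<Longrightarrow> b \<le> 1 \<Longrightarrow> s a \<le> s b"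
  have "s 0 \<le> s 1" by (rule mono) auto
  with s show ?thesis by simp
qed

lemma len_le_dist:
  assumes "len_le \<gamma> l" "a \<in> {0..1}" "b \<in> {0..1}"
  shows "dist (\<gamma> a) (\<gamma> b) \<le> l"
proof -
  from assms(1) obtain s :: "real \<Rightarrow> real" where s: "s 0 = 0" "s 1 \<le> l"
    "\<And>a b. 0 \<le> a \<Longrightarrow> a \<le> b \<Longrightarrow> b \<le> 1 \<Longrightarrow> dist (\<gamma> a) (\<gamma> b) \<le> s b - s a"
    "\<And>a b. 0 \<le> a \<Longrightarrow> a \<le> b \<Longrightarrow> b \<le> 1 \<Longrightarrow> s a \<le> s b"
    by (rule len_leE) blast
  have *: "dist (\<gamma> a) (\<gamma> b) \<le> l" if "0 \<le> a" "a \<le> b" "b \<le> 1" for a b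
    using s(3)[OF that] s(4)[of 0 a] s(4)[of b 1] s(1,2) that by linarith
  show ?thesis
    using *[of a b] *[of b a] assms by (cases "a \<le> b") (auto simp: dist_commute)
qed

lemma len_le_imp_path_length:
  assumes "len_le \<gamma> l"
  shows "path_length \<gamma> \<le> ennreal l"
  unfolding path_length_def
proof (rule SUP_least, clarify)
  fix n x assume nx: "(n, x) \<in> partitions01"
  from assms obtain s :: "real \<Rightarrow> real" where s: "s 0 = 0" "s 1 \<le> l"
    "\<And>a b. 0 \<le> a \<Longrightarrow> a \<le> b \<Longrightarrow> b \<le> 1 \<Longrightarrow> dist (\<gamma> a) (\<gamma> b) \<le> s b - s a"
    by (rule len_leE) blast
  have x: "x 0 = 0" "x n = 1" "\<And>i. i < n \<Longrightarrow> x i < x (Suc i)"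
    using nx by (auto simp: partitions01_def)
  have mono: "x i \<le> x j" if "i \<le> j" "j \<le> n" for i j
    using that
  proof (induction j)
    case (Suc j) then show ?case using x(3)[of j] by (cases "i = Suc j") auto
  qed simp
  have "(\<Sum>i<n. dist (\<gamma> (x i)) (\<gamma> (x (Suc i)))) \<le> (\<Sum>i<n. s (x (Suc i)) - s (x i))"
    by (rule sum_mono, rule s(3)) (use mono[of 0] mono[of _ n] x in \<open>auto intro: less_imp_le\<close>)
  also have "\<dots> = s (x n) - s (x 0)"
    by (rule sum_lessThan_telescope)
  also have "\<dots> \<le> l" using s x by simp
  finally show "(\<Sum>i<n. ennreal (dist (\<gamma> (x i)) (\<gamma> (x (Suc i))))) \<le> ennreal l"
    by (simp add: sum_ennreal ennreal_leI)
qed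

text \<open>The dominating function is the variation up to time \<open>t\<close>: the supremum
  \<open>s t\<close> of the sums over partitions of [0, t]. Appending \<open>b\<close> to a
  partition ending at \<open>a\<close> adds exactly \<open>dist (\<gamma> a) (\<gamma> b)\<close>,
  which gives the domination.\<close>

lemma path_length_imp_len_le:
  assumes "path_length \<gamma> \<le> ennreal l" "0 \<le> l"
  shows "len_le \<gamma> l"
proof -
  define P :: "real \<Rightarrow> (nat \<times> (nat \<Rightarrow> real)) set"
    where "P = (\<lambda>t. {(n, x). x 0 = 0 \<and> x n = t \<and> (\<forall>i<n. x i < x (Suc i))})"
  define S where "S = (\<lambda>(n::nat, x::nat \<Rightarrow> real). \<Sum>i<n. dist (\<gamma> (x i)) (\<gamma> (x (Suc i))))"
  have bound1: "S q \<le> l" if "q \<in> P 1" for q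
  proof -
    obtain n x where q: "q = (n, x)" by force
    have "(\<Sum>i<n. ennreal (dist (\<gamma> (x i)) (\<gamma> (x (Suc i))))) \<le> path_length \<gamma>"
      unfolding path_length_def using that q by (intro SUP_upper2[of "(n,x)"]) (auto simp: partitions01_def P_def)
    also note assms(1)
    finally show ?thesis using assms(2) by (simp add: S_def q sum_ennreal)
  qed
  have ext: "\<exists>q'\<in>P b. S q' = S q + dist (\<gamma> a) (\<gamma> b)" if "q \<in> P a" "a < b" for q a b
  proof -
    obtain n x where q: "q = (n, x)" by force
    have "(Suc n, x(Suc n := b)) \<in> P b" using that q by (auto simp: P_def less_Suc_eq)
    moreover have "S (Suc n, x(Suc n := b)) = S q + dist (\<gamma> a) (\<gamma> b)"
      using that q by (auto simp: S_def P_def)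
    ultimately show ?thesis by blast
  qed
  \<comment> \<open>For \<open>t < 1\<close> the point 1 is appended, which cannot decrease the
    sum.\<close>
  have bound: "S q \<le> l" if q: "q \<in> P t" "t \<le> 1" for q t
  proof (cases "t = 1")
    case False
    then have "t < 1" using q(2) by simp
    from ext[OF q(1) this] obtain q' where "q' \<in> P 1" "S q' = S q + dist (\<gamma> t) (\<gamma> 1)"
      by blast
    then show ?thesis using bound1[of q'] zero_le_dist[of "\<gamma> t" "\<gamma> 1"] by linarith
  next
    case True then show ?thesis using q bound1 by simp
  qed
  have P0: "(0, \<lambda>_. 0) \<in> P 0" by (simp add: P_def)
  \<comment> \<open>Only partitions without intervals end at 0, which normalises
    \<open>s 0 = 0\<close>.\<close>
  have P0': "S q = 0" if "q \<in> P 0" for q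
  proof -
    obtain n x where q: "q = (n, x)" by force
    have x: "x 0 = 0" "x n = 0" "\<And>i. i < n \<Longrightarrow> x i < x (Suc i)" using that q by (auto simp: P_def)
    have "0 < x i" if "0 < i" "i \<le> n" for i
      using that
    proof (induction i)
      case (Suc i) then show ?case using x(1) x(3)[of i] by (cases "i = 0") auto
    qed simp
    then have "n = 0" using x(2) by (metis less_irrefl neq0_conv order_refl)
    then show ?thesis by (simp add: S_def q)
  qed
  have ne: "P t \<noteq> {}" if "0 \<le> t" for t
    using ext[OF P0, of t] P0 that by (cases "t = 0") auto
  have bdd: "bdd_above (S ` P t)" if "t \<le> 1" for t
    by (rule bdd_aboveI2[of _ _ l]) (rule bound[OF _ that])
  define s where "s = (\<lambda>t. Sup (S ` P t))"
  show ?thesis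
  proof (rule len_leI[of s])
    have "S ` P 0 = {0}" using P0' P0 by force
    then show "s 0 = 0" by (simp add: s_def)
    show "s 1 \<le> l" unfolding s_def using ne[of 1] bound1 by (intro cSUP_least) auto
    fix a b :: real assume ab: "0 \<le> a" "a \<le> b" "b \<le> 1"
    show "dist (\<gamma> a) (\<gamma> b) \<le> s b - s a"
    proof (cases "a = b")
      case False
      have "s a \<le> s b - dist (\<gamma> a) (\<gamma> b)"
        unfolding s_def
      proof (rule cSUP_least)
        show "P a \<noteq> {}" using ne ab by simp
        fix q assume q: "q \<in> P a"
        have "a < b" using False ab by simp
        from ext[OF q this] obtain q' where "q' \<in> P b" "S q' = S q + dist (\<gamma> a) (\<gamma> b)"
          by blast
        moreover have "S q' \<le> Sup (S ` P b)"
          using \<open>q' \<in> P b\<close> bdd ab by (intro cSUP_upper) auto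
        ultimately show "S q \<le> Sup (S ` P b) - dist (\<gamma> a) (\<gamma> b)" by linarith
      qed
      then show ?thesis by linarith
    qed simp
  qed
qed

lemma rectifiable_iff_len_le: "rectifiable \<gamma> \<longleftrightarrow> (\<exists>l. len_le \<gamma> l)"
proof
  assume "rectifiable \<gamma>"
  then have "path_length \<gamma> = ennreal (enn2real (path_length \<gamma>))"
    by (simp add: rectifiable_def)
  then have "len_le \<gamma> (enn2real (path_length \<gamma>))"
    by (intro path_length_imp_len_le) auto
  then show "\<exists>l. len_le \<gamma> l" by blast
next
  assume "\<exists>l. len_le \<gamma> l"
  then obtain l where "path_length \<gamma> \<le> ennreal l" using len_le_imp_path_length by blast
  then show "rectifiable \<gamma>"
    unfolding rectifiable_def by (metis ennreal_less_top infinity_ennreal_def le_less_trans)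
qed

lemma len_le_const: "0 \<le> l \<Longrightarrow> len_le (\<lambda>_. x) l"
  by (rule len_leI[of "\<lambda>_. 0"]) auto

lemma len_le_lipschitz:
  assumes "\<And>a b. a \<in> {0..1} \<Longrightarrow> b \<in> {0..1} \<Longrightarrow> dist (\<gamma> a) (\<gamma> b) \<le> L * \<bar>a - b\<bar>"
  shows "len_le \<gamma> L"
proof (rule len_leI[of "\<lambda>t. L * t"])
  fix a b :: real assume ab: "0 \<le> a" "a \<le> b" "b \<le> 1"
  then have "dist (\<gamma> a) (\<gamma> b) \<le> L * \<bar>a - b\<bar>" by (intro assms) auto
  also have "\<dots> = L * b - L * a" using ab by (simp add: abs_if algebra_simps)
  finally show "dist (\<gamma> a) (\<gamma> b) \<le> L * b - L * a" .
qed auto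

lemma len_le_join:
  assumes "len_le p a" "len_le q b" "pathfinish p = pathstart q"
  shows "len_le (p +++ q) (a + b)"
proof -
  from assms(1) obtain s :: "real \<Rightarrow> real" where s: "s 0 = 0" "s 1 \<le> a"
    "\<And>a b. 0 \<le> a \<Longrightarrow> a \<le> b \<Longrightarrow> b \<le> 1 \<Longrightarrow> dist (p a) (p b) \<le> s b - s a"
    by (rule len_leE) blast
  from assms(2) obtain r :: "real \<Rightarrow> real" where r: "r 0 = 0" "r 1 \<le> b"
    "\<And>a b. 0 \<le> a \<Longrightarrow> a \<le> b \<Longrightarrow> b \<le> 1 \<Longrightarrow> dist (q a) (q b) \<le> r b - r a"
    by (rule len_leE) blast
  show ?thesis
  proof (rule len_leI[of "\<lambda>t. if t \<le> 1/2 then s (2 * t) else s 1 + r (2 * t - 1)"])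
    fix u v :: real assume uv: "0 \<le> u" "u \<le> v" "v \<le> 1"
    consider "v \<le> 1/2" | "u > 1/2" | "u \<le> 1/2" "v > 1/2" by linarith
    then show "dist ((p +++ q) u) ((p +++ q) v) \<le>
       (if v \<le> 1/2 then s (2 * v) else s 1 + r (2 * v - 1)) - (if u \<le> 1/2 then s (2 * u) else s 1 + r (2 * u - 1))"
    proof cases
      case 1 then show ?thesis using uv s(3)[of "2 * u" "2 * v"] by (simp add: joinpaths_def)
    next
      case 2 then show ?thesis using uv r(3)[of "2 * u - 1" "2 * v - 1"] by (simp add: joinpaths_def)
    next
      case 3
      have "p 1 = q 0" using assms(3) by (simp add: pathfinish_def pathstart_def)
      then have "dist (p (2 * u)) (q (2 * v - 1)) \<le> dist (p (2 * u)) (p 1) + dist (q 0) (q (2 * v - 1))"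
        using dist_triangle by metis
      also have "\<dots> \<le> (s 1 - s (2 * u)) + (r (2 * v - 1) - r 0)"
        using 3 uv by (intro add_mono s(3) r(3)) auto
      finally show ?thesis using 3 r(1) by (simp add: joinpaths_def)
    qed
  qed (use s(1,2) r(1,2) in auto)
qed

text \<open>The library's \<^const>\<open>subpath\<close> is restricted to real normed vector spaces.\<close>

definition subarc :: "real \<Rightarrow> real \<Rightarrow> (real \<Rightarrow> 'a) \<Rightarrow> real \<Rightarrow> 'a" where
  "subarc u v g = (\<lambda>x. g ((v - u) * x + u))"

lemma subarc_eq: "subarc u v g = g \<circ> linepath u v"
  by (rule ext) (simp add: subarc_def linepath_def algebra_simps)

lemma pathstart_subarc [simp]: "pathstart (subarc u v g) = g u"
  and pathfinish_subarc [simp]: "pathfinish (subarc u v g) = g v"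
  by (simp_all add: subarc_def pathstart_def pathfinish_def)

lemma path_image_subarc: "path_image (subarc u v g) = g ` closed_segment u v"
  unfolding subarc_eq path_image_compose by simp

lemma closed_segment_01: "u \<in> {0..1} \<Longrightarrow> v \<in> {0..1} \<Longrightarrow> closed_segment u v \<subseteq> {0..1::real}"
  by (auto simp: closed_segment_eq_real_ivl split: if_splits)

lemma path_image_subarc_subset:
  "u \<in> {0..1} \<Longrightarrow> v \<in> {0..1} \<Longrightarrow> path_image (subarc u v g) \<subseteq> path_image g"
  unfolding path_image_subarc unfolding path_image_def by (intro image_mono closed_segment_01)

lemma path_subarc: "path g \<Longrightarrow> u \<in> {0..1} \<Longrightarrow> v \<in> {0..1} \<Longrightarrow> path (subarc u v g)"
  unfolding subarc_eq path_def
  by (rule continuous_on_compose)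
     (simp_all add: linepath_image_01 closed_segment_01 continuous_on_subset continuous_on_linepath)

lemma arc_subarc:
  assumes "path g" "u \<in> {0..1}" "v \<in> {0..1}" "u \<noteq> v" "inj_on g (closed_segment u v)"
  shows "arc (subarc u v g)"
proof -
  have "inj_on (linepath u v) {0..1}" using assms(4) by (rule inj_on_linepath)
  then have "inj_on (g \<circ> linepath u v) {0..1}"
    using assms(5) by (intro comp_inj_on) (simp_all add: linepath_image_01)
  then show ?thesis
    using assms path_subarc[OF assms(1-3)] by (simp add: arc_def subarc_eq)
qed

text \<open>Both orders of \<open>u\<close> and \<open>v\<close> are covered, so that reversal
  becomes the case \<open>u = 1\<close>, \<open>v = 0\<close>.\<close>

lemma len_le_subarc:
  assumes "len_le p l" "u \<in> {0..1}" "v \<in> {0..1}"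
  shows "len_le (subarc u v p) l"
proof -
  from assms(1) obtain s :: "real \<Rightarrow> real" where s: "s 0 = 0" "s 1 \<le> l"
    "\<And>a b. 0 \<le> a \<Longrightarrow> a \<le> b \<Longrightarrow> b \<le> 1 \<Longrightarrow> dist (p a) (p b) \<le> s b - s a"
    "\<And>a b. 0 \<le> a \<Longrightarrow> a \<le> b \<Longrightarrow> b \<le> 1 \<Longrightarrow> s a \<le> s b"
    by (rule len_leE) blast
  have aff: "(v - u) * t + u \<in> {0..1}" if "t \<in> {0..1}" for t
  proof -
    have eq: "(v - u) * t + u = (1 - t) * u + t * v" by (simp add: algebra_simps)
    have "(1 - t) * u + t * v \<le> (1 - t) * 1 + t * 1"
      using that assms by (intro add_mono mult_left_mono) auto
    moreover have "0 \<le> (1 - t) * u + t * v" using that assms by simp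
    ultimately show ?thesis unfolding eq by simp
  qed
  show ?thesis
  proof (cases "u \<le> v")
    case True
    show ?thesis
    proof (rule len_leI[of "\<lambda>t. s ((v - u) * t + u) - s u"])
      show "s ((v - u) * 1 + u) - s u \<le> l" using s(2) s(1) s(4)[of v 1] s(4)[of 0 u] assms by auto
      fix a b :: real assume ab: "0 \<le> a" "a \<le> b" "b \<le> 1"
      have "(v - u) * a \<le> (v - u) * b" using ab True by (simp add: mult_left_mono)
      then show "dist (subarc u v p a) (subarc u v p b) \<le> s ((v - u) * b + u) - s u - (s ((v - u) * a + u) - s u)"
        using s(3)[of "(v - u) * a + u" "(v - u) * b + u"] aff[of a] aff[of b] ab by (simp add: subarc_def)
    qed simp
  next
    case False
    show ?thesis
    proof (rule len_leI[of "\<lambda>t. s u - s ((v - u) * t + u)"])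
      show "s u - s ((v - u) * 1 + u) \<le> l" using s(2) s(1) s(4)[of u 1] s(4)[of 0 v] assms by auto
      fix a b :: real assume ab: "0 \<le> a" "a \<le> b" "b \<le> 1"
      have "(v - u) * b \<le> (v - u) * a" using ab False by (simp add: mult_left_mono_neg)
      then show "dist (subarc u v p a) (subarc u v p b) \<le> s u - s ((v - u) * b + u) - (s u - s ((v - u) * a + u))"
        using s(3)[of "(v - u) * b + u" "(v - u) * a + u"] aff[of a] aff[of b] ab by (simp add: subarc_def dist_commute)
    qed simp
  qed
qed

lemma len_le_reversepath: "len_le p l \<Longrightarrow> len_le (reversepath p) l"
  using len_le_subarc[of p l 1 0] by (simp add: subarc_def reversepath_def)

text \<open>The reparametrisation is a generalised inverse of the dominating function, made strictly
  increasing by the slope \<open>\<delta>\<close>. Where that function jumps the inverse is constant, so its continuity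
  is not needed.\<close>

lemma len_le_reparametrize:
  assumes "len_le \<gamma> l" "path \<gamma>" "0 < \<delta>"
  obtains \<tau> :: "real \<Rightarrow> real" where "continuous_on {0..1} \<tau>" "\<tau> \<in> {0..1} \<rightarrow> {0..1}" "\<tau> 0 = 0" "\<tau> 1 = 1"
    "\<And>a b. a \<in> {0..1} \<Longrightarrow> b \<in> {0..1} \<Longrightarrow> dist (\<gamma> (\<tau> a)) (\<gamma> (\<tau> b)) \<le> (l + \<delta>) * \<bar>a - b\<bar>"
proof -
  from assms(1) obtain s :: "real \<Rightarrow> real" where s: "s 0 = 0" "s 1 \<le> l"
    "\<And>a b. 0 \<le> a \<Longrightarrow> a \<le> b \<Longrightarrow> b \<le> 1 \<Longrightarrow> dist (\<gamma> a) (\<gamma> b) \<le> s b - s a"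
    "\<And>a b. 0 \<le> a \<Longrightarrow> a \<le> b \<Longrightarrow> b \<le> 1 \<Longrightarrow> s a \<le> s b"
    by (rule len_leE) blast
  define \<Lambda> where "\<Lambda> = l + \<delta>"
  have \<Lambda>: "\<Lambda> > 0" using len_le_nonneg[OF assms(1)] assms(3) by (simp add: \<Lambda>_def)
  define r where "r = (\<lambda>t. s t + \<delta> * t)"
  have r0: "r 0 = 0" and r1: "r 1 \<le> \<Lambda>" using s by (auto simp: r_def \<Lambda>_def)
  have rd: "dist (\<gamma> a) (\<gamma> b) \<le> r b - r a" and rt: "\<delta> * (b - a) \<le> r b - r a"
    if "0 \<le> a" "a \<le> b" "b \<le> 1" for a b
  proof -
    have "\<delta> * a \<le> \<delta> * b" using that assms(3) by simp
    then show "dist (\<gamma> a) (\<gamma> b) \<le> r b - r a" using s(3)[OF that] by (simp add: r_def)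
    show "\<delta> * (b - a) \<le> r b - r a" using s(4)[OF that] by (simp add: r_def algebra_simps)
  qed
  define A where "A = (\<lambda>u. {t\<in>{0..1}. r t \<le> u * \<Lambda>})"
  define \<tau> where "\<tau> = (\<lambda>u. Sup (A u))"
  have A0: "0 \<in> A u" if "0 \<le> u" for u using that r0 \<Lambda> by (simp add: A_def)
  have Abdd: "bdd_above (A u)" for u by (auto simp: A_def intro: bdd_aboveI[of _ 1])
  have \<tau>01: "\<tau> u \<in> {0..1}" if "0 \<le> u" for u
    unfolding \<tau>_def using A0[OF that] Abdd[of u]
    by (auto intro: cSup_upper intro!: cSup_least simp: A_def)
  \<comment> \<open>\<open>r\<close> may jump at \<open>\<tau> u\<close>, so its values are compared
    with \<open>u * \<Lambda>\<close> only strictly above and strictly below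
    \<open>\<tau> u\<close>.\<close>
  have above: "u * \<Lambda> < r a" if "\<tau> u < a" "a \<le> 1" "0 \<le> u" for u a
  proof (rule ccontr)
    assume "\<not> u * \<Lambda> < r a"
    then have "a \<in> A u" using that \<tau>01[OF that(3)] by (auto simp: A_def)
    then have "a \<le> \<tau> u" unfolding \<tau>_def using Abdd by (rule cSup_upper)
    with that show False by simp
  qed
  have below: "r b \<le> u * \<Lambda>" if *: "b < \<tau> u" "0 \<le> b" "0 \<le> u" for u b
  proof -
    obtain t where "t \<in> A u" "b < t"
      using * less_cSup_iff[of "A u" b] A0[OF *(3)] Abdd[of u] unfolding \<tau>_def by blast
    moreover from \<open>t \<in> A u\<close> have "t \<le> 1" by (simp add: A_def)
    then have "r b \<le> r t"
      using \<open>t \<in> A u\<close> \<open>b < t\<close> * rd[of b t] zero_le_dist[of "\<gamma> b" "\<gamma> t"] by linarith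
    ultimately show ?thesis by (simp add: A_def)
  qed
  have mono: "\<tau> u \<le> \<tau> v" if "0 \<le> u" "u \<le> v" for u v
  proof -
    have "u * \<Lambda> \<le> v * \<Lambda>" using that \<Lambda> by simp
    then have "A u \<subseteq> A v" by (auto simp: A_def)
    then show ?thesis unfolding \<tau>_def using A0[OF that(1)] Abdd by (intro cSup_subset_mono) auto
  qed
  have contg: "continuous_on {0..1} \<gamma>" using assms(2) by (simp add: path_def)
  have main: "dist (\<gamma> (\<tau> u)) (\<gamma> (\<tau> v)) \<le> \<Lambda> * (v - u) \<and> \<delta> * (\<tau> v - \<tau> u) \<le> \<Lambda> * (v - u)"
    if uv: "0 \<le> u" "u \<le> v" for u v
  proof (cases "\<tau> u = \<tau> v")
    case True then show ?thesis using \<Lambda> uv by simp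
  next
    case False
    then have lt: "\<tau> u < \<tau> v" using mono[OF uv] by simp
    \<comment> \<open>The ends \<open>\<tau> u\<close> and \<open>\<tau> v\<close> are approached
      from inside, where \<open>above\<close> and \<open>below\<close> apply; continuity of
      \<open>\<gamma>\<close> does the rest. The 3 keeps each offset at most a third of the gap, so
      that \<open>a n \<le> b n\<close>.\<close>
    define a where "a = (\<lambda>n::nat. \<tau> u + (\<tau> v - \<tau> u) / (real n + 3))"
    define b where "b = (\<lambda>n::nat. \<tau> v - (\<tau> v - \<tau> u) / (real n + 3))"
    have lim0: "(\<lambda>n::nat. (\<tau> v - \<tau> u) / (real n + 3)) \<longlonglongrightarrow> 0"
      by real_asymp
    have la: "a \<longlonglongrightarrow> \<tau> u" unfolding a_def using tendsto_add[OF tendsto_const lim0] by simp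
    have lb: "b \<longlonglongrightarrow> \<tau> v" unfolding b_def using tendsto_diff[OF tendsto_const lim0] by simp
    have ab: "\<tau> u < a n" "a n \<le> b n" "b n < \<tau> v" for n
    proof -
      have "0 < (\<tau> v - \<tau> u) / (real n + 3)" using lt by simp
      then show "\<tau> u < a n" "b n < \<tau> v" by (auto simp: a_def b_def)
      have "(\<tau> v - \<tau> u) / (real n + 3) \<le> (\<tau> v - \<tau> u) / 2" using lt by (intro divide_left_mono) auto
      moreover have "B + x \<le> A - x" if "x \<le> (A - B) / 2" for x A B :: real using that by simp
      ultimately show "a n \<le> b n" unfolding a_def b_def by blast
    qed
    have in01: "a n \<in> {0..1}" "b n \<in> {0..1}" for n
      using ab[of n] \<tau>01[of u] \<tau>01[of v] uv by auto
    have rr: "r (b n) - r (a n) \<le> \<Lambda> * (v - u)" for n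
      using above[of u "a n"] below[of "b n" v] ab[of n] in01[of n] uv by (auto simp: algebra_simps)
    have d: "dist (\<gamma> (a n)) (\<gamma> (b n)) \<le> \<Lambda> * (v - u)" for n
      using rd[of "a n" "b n"] rr[of n] in01[of n] ab[of n] by auto
    have e: "\<delta> * (b n - a n) \<le> \<Lambda> * (v - u)" for n
      using rt[of "a n" "b n"] rr[of n] in01[of n] ab[of n] by auto
    have "(\<lambda>n. \<gamma> (a n)) \<longlonglongrightarrow> \<gamma> (\<tau> u)" "(\<lambda>n. \<gamma> (b n)) \<longlonglongrightarrow> \<gamma> (\<tau> v)"
      using continuous_on_tendsto_compose[OF contg la] continuous_on_tendsto_compose[OF contg lb] in01 \<tau>01 uv
      by auto
    then have "(\<lambda>n. dist (\<gamma> (a n)) (\<gamma> (b n))) \<longlonglongrightarrow> dist (\<gamma> (\<tau> u)) (\<gamma> (\<tau> v))"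
      by (intro tendsto_intros)
    moreover have "(\<lambda>n. \<delta> * (b n - a n)) \<longlonglongrightarrow> \<delta> * (\<tau> v - \<tau> u)"
      by (intro tendsto_intros la lb)
    ultimately show ?thesis
      using d e by (auto intro: LIMSEQ_le_const2)
  qed
  have lip: "\<bar>\<tau> u - \<tau> v\<bar> \<le> \<Lambda> / \<delta> * \<bar>u - v\<bar>" if "u \<in> {0..1}" "v \<in> {0..1}" for u v
  proof (cases "u \<le> v")
    case True
    then show ?thesis using main[of u v] mono[of u v] that assms(3) by (auto simp: field_simps abs_if)
  next
    case False
    then show ?thesis using main[of v u] mono[of v u] that assms(3) by (auto simp: field_simps abs_if)
  qed
  have cont: "continuous_on {0..1} \<tau>"
  proof (rule lipschitz_on_continuous_on)
    show "(\<Lambda> / \<delta>)-lipschitz_on {0..1} \<tau>"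
      using lip \<Lambda> assms(3) by (auto simp: lipschitz_on_def dist_real_def)
  qed
  show ?thesis
  proof (rule that[OF cont])
    show "\<tau> \<in> {0..1} \<rightarrow> {0..1}" using \<tau>01 by auto
    show "\<tau> 0 = 0"
    proof (rule ccontr)
      assume "\<tau> 0 \<noteq> 0"
      then have pos: "0 < \<tau> 0" using \<tau>01[of 0] by auto
      have "r (\<tau> 0 / 2) \<le> 0" using below[of "\<tau> 0 / 2" 0] pos by simp
      moreover have "\<delta> * (\<tau> 0 / 2) \<le> r (\<tau> 0 / 2)" using rt[of 0 "\<tau> 0 / 2"] r0 pos \<tau>01[of 0] by auto
      moreover have "0 < \<delta> * (\<tau> 0 / 2)" using pos assms(3) by simp
      ultimately show False by linarith
    qed
    have "1 \<in> A 1" using r1 by (simp add: A_def)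
    then have "1 \<le> \<tau> 1" unfolding \<tau>_def using Abdd by (rule cSup_upper)
    then show "\<tau> 1 = 1" using \<tau>01[of 1] by auto
    fix a b :: real assume "a \<in> {0..1}" "b \<in> {0..1}"
    then show "dist (\<gamma> (\<tau> a)) (\<gamma> (\<tau> b)) \<le> (l + \<delta>) * \<bar>a - b\<bar>"
      using main[of a b] main[of b a]
      by (cases "a \<le> b") (auto simp: \<Lambda>_def abs_if dist_commute)
  qed
qed

section \<open>Maps of one-dimensional spaces to the punctured plane\<close>

lemma closed_diff_openin:
  fixes X :: "'a::metric_space set"
  assumes "compact X" "openin (top_of_set X) U"
  shows "closed (X - U)"
proof -
  have "closedin (top_of_set X) (X - U)"
    using assms(2) by (simp add: closedin_def openin_imp_subset double_diff)
  then have "compact (X - U)" by (rule closedin_compact[OF assms(1)])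
  then show ?thesis by (rule compact_imp_closed)
qed

lemma compact_openin_complement_infdist:
  fixes X :: "'a::metric_space set"
  assumes "compact X" "openin (top_of_set X) V" "X - V \<noteq> {}" "x \<in> X"
  shows "infdist x (X - V) = 0 \<longleftrightarrow> x \<notin> V"
  using in_closed_iff_infdist_zero[OF closed_diff_openin[OF assms(1,2)] assms(3), of x] assms(4) by blast

text \<open>The image of the nerve of a cover of order at most 2 is a finite union of segments, so it
  misses points arbitrarily close to the origin.\<close>

lemma covering_dim_le_1_avoid_0:
  fixes X :: "'a::metric_space set" and f :: "'a \<Rightarrow> complex"
  assumes "compact X" "covering_dim_le (top_of_set X) 1" "continuous_on X f" "0 < \<epsilon>"
  obtains g where "continuous_on X g" "0 \<notin> g ` X" "\<And>x. x \<in> X \<Longrightarrow> dist (g x) (f x) < \<epsilon>"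
proof -
  \<comment> \<open>\<open>f\<close> stays within \<open>\<epsilon>/4\<close> of one value on each
    member; half of \<open>\<epsilon>\<close> is reserved for the final translation.\<close>
  define \<U> where "\<U> = (\<lambda>x. X \<inter> f -` ball (f x) (\<epsilon>/4)) ` X"
  have "\<forall>U\<in>\<U>. openin (top_of_set X) U"
    using assms(3) by (auto simp: \<U>_def continuous_openin_preimage_gen)
  moreover have "\<Union>\<U> = X" using assms(4) by (auto simp: \<U>_def)
  ultimately obtain \<V> where V: "\<forall>V\<in>\<V>. openin (top_of_set X) V" "\<Union>\<V> = X" "\<forall>V\<in>\<V>. \<exists>U\<in>\<U>. V \<subseteq> U"
    "\<forall>x\<in>X. finite {V \<in> \<V>. x \<in> V} \<and> card {V \<in> \<V>. x \<in> V} \<le> 2"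
    using assms(2)[unfolded covering_dim_le_def topspace_euclidean_subtopology, rule_format, of \<U>]
    unfolding one_add_one by auto
  obtain D where D: "D \<subseteq> \<V>" "finite D" "X \<subseteq> \<Union>D"
    using assms(1) V(1,2) unfolding compact_eq_openin_cover by (metis order_refl)
  have opD: "openin (top_of_set X) V" if "V \<in> D" for V using D V(1) that by blast
  obtain c where c: "\<And>V x. V \<in> D \<Longrightarrow> x \<in> V \<Longrightarrow> dist (c V) (f x) < \<epsilon>/4"
  proof -
    have "\<forall>V\<in>D. \<exists>z. \<forall>x\<in>V. dist z (f x) < \<epsilon>/4"
    proof
      fix V assume "V \<in> D"
      then obtain x where "x \<in> X" "V \<subseteq> X \<inter> f -` ball (f x) (\<epsilon>/4)"
        using D V(3) unfolding \<U>_def by blast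
      then show "\<exists>z. \<forall>x\<in>V. dist z (f x) < \<epsilon>/4" by (intro exI[of _ "f x"]) auto
    qed
    then show ?thesis using that by metis
  qed
  \<comment> \<open>\<open>infdist\<close> to the empty set is 0, so a member equal to all of
    \<open>X\<close> gets the weight 1 instead.\<close>
  define w where "w = (\<lambda>V x. if X - V = {} then 1 else infdist x (X - V))"
  have w0: "0 \<le> w V x" for V x by (simp add: w_def infdist_nonneg)
  have w_iff: "w V x = 0 \<longleftrightarrow> x \<notin> V" if "V \<in> D" "x \<in> X" for V x
  proof (cases "X - V = {}")
    case False
    then show ?thesis
      using compact_openin_complement_infdist[OF assms(1) opD[OF that(1)] False that(2)] by (simp add: w_def)
  next
    case True then show ?thesis using that(2) by (auto simp: w_def)
  qed
  have w_cont: "continuous_on X (w V)" for V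
    unfolding w_def by (cases "X - V = {}") (auto intro!: continuous_intros)
  define W where "W = (\<lambda>x. \<Sum>V\<in>D. w V x)"
  have Wpos: "0 < W x" if x: "x \<in> X" for x
  proof -
    obtain V where V: "V \<in> D" "x \<in> V" using D x by blast
    have "0 < w V x" using w_iff[OF V(1) x] w0[of V x] V(2) by linarith
    then show ?thesis unfolding W_def using D(2) V(1) w0 by (meson sum_pos2)
  qed
  define \<phi> where "\<phi> = (\<lambda>V x. w V x / W x)"
  have \<phi>0: "0 \<le> \<phi> V x" if "x \<in> X" for V x
    using w0[of V x] Wpos[OF that] by (simp add: \<phi>_def)
  have \<phi>1: "(\<Sum>V\<in>D. \<phi> V x) = 1" if "x \<in> X" for x
    using Wpos[OF that] by (simp add: \<phi>_def W_def flip: sum_divide_distrib)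
  have \<phi>z: "\<phi> V x = 0" if "V \<in> D" "x \<in> X" "x \<notin> V" for V x
    using w_iff[OF that(1,2)] that(3) by (simp add: \<phi>_def)
  \<comment> \<open>The barycentric map to the nerve, with the vertex \<open>V\<close> placed at
    \<open>c V\<close>. At each point at most two vertices carry positive weight, so the values lie
    on segments.\<close>
  define h where "h = (\<lambda>x. \<Sum>V\<in>D. \<phi> V x *\<^sub>R c V)"
  have h_cont: "continuous_on X h"
    unfolding h_def \<phi>_def W_def
  proof (intro continuous_intros w_cont ballI)
    fix x assume "x \<in> X" then show "(\<Sum>V\<in>D. w V x) \<noteq> 0" using Wpos[of x] by (simp add: W_def)
  qed
  have sum_act: "(\<Sum>V\<in>{V\<in>D. x \<in> V}. \<phi> V x) = 1"
    and h_act: "h x = (\<Sum>V\<in>{V\<in>D. x \<in> V}. \<phi> V x *\<^sub>R c V)" if "x \<in> X" for x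
  proof -
    have "(\<Sum>V\<in>D. \<phi> V x) = (\<Sum>V\<in>{V\<in>D. x \<in> V}. \<phi> V x)"
      by (rule sum.mono_neutral_right) (use D(2) \<phi>z that in auto)
    then show "(\<Sum>V\<in>{V\<in>D. x \<in> V}. \<phi> V x) = 1" using \<phi>1[OF that] by simp
    show "h x = (\<Sum>V\<in>{V\<in>D. x \<in> V}. \<phi> V x *\<^sub>R c V)"
      unfolding h_def by (rule sum.mono_neutral_right) (use D(2) \<phi>z that in auto)
  qed
  have h_close: "dist (h x) (f x) < \<epsilon>/2" if "x \<in> X" for x
  proof -
    have "h x \<in> cball (f x) (\<epsilon>/4)"
      unfolding h_act[OF that]
    proof (rule convex_sum)
      fix V assume "V \<in> {V\<in>D. x \<in> V}"
      then show "c V \<in> cball (f x) (\<epsilon>/4)" using c[of V x] by (simp add: dist_commute less_imp_le)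
    qed (use D(2) \<phi>0 that sum_act in auto)
    then show ?thesis using assms(4) by (simp add: dist_commute)
  qed
  define N where "N = (\<Union>A\<in>{A. A \<subseteq> D \<and> card A \<le> 2}. convex hull (c ` A))"
  have hN: "h x \<in> N" if "x \<in> X" for x
  proof -
    let ?A = "{V\<in>D. x \<in> V}"
    have "card ?A \<le> card {V \<in> \<V>. x \<in> V}"
      using V(4) that D(1) by (intro card_mono) auto
    also have "\<dots> \<le> 2" using V(4) that by blast
    finally have "?A \<in> {A. A \<subseteq> D \<and> card A \<le> 2}" by auto
    moreover have "h x \<in> convex hull (c ` ?A)"
      unfolding h_act[OF that]
      by (rule convex_sum) (use D(2) \<phi>0 that sum_act in \<open>auto intro: hull_inc\<close>)
    ultimately show ?thesis unfolding N_def by blast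
  qed
  have "negligible N"
    unfolding N_def
  proof (rule negligible_Union)
    show "finite ((\<lambda>A. convex hull (c ` A)) ` {A. A \<subseteq> D \<and> card A \<le> 2})"
      using D(2) by simp
    fix T assume "T \<in> (\<lambda>A. convex hull (c ` A)) ` {A. A \<subseteq> D \<and> card A \<le> 2}"
    then obtain A where A: "A \<subseteq> D" "card A \<le> 2" "T = convex hull (c ` A)" by blast
    have fA: "finite A" using A(1) D(2) by (rule finite_subset)
    then have "card (c ` A) \<le> DIM(complex)" using A(2) card_image_le[OF fA, of c] by simp
    then have "interior T = {}" unfolding A(3) using fA by (intro empty_interior_convex_hull) auto
    then show "negligible T" unfolding A(3) by (simp add: negligible_convex_interior)
  qed
  \<comment> \<open>Translating by a small \<open>p\<close> outside \<open>N\<close> moves the image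
    of \<open>h\<close> off the origin.\<close>
  then have "\<not> ball 0 (\<epsilon>/2) \<subseteq> N"
    using open_not_negligible[of "ball (0::complex) (\<epsilon>/2)"] negligible_subset assms(4) by auto
  then obtain p where "p \<in> ball 0 (\<epsilon>/2)" and pN: "p \<notin> N" by blast
  then have p: "norm p < \<epsilon>/2" "p \<notin> N" by simp_all
  show ?thesis
  proof (rule that[of "\<lambda>x. h x - p"])
    show "continuous_on X (\<lambda>x. h x - p)" by (intro continuous_intros h_cont)
    show "0 \<notin> (\<lambda>x. h x - p) ` X" using hN p(2) by auto
    fix x assume "x \<in> X"
    have "h x - p - f x = (h x - f x) - p" by simp
    then have "dist (h x - p) (f x) \<le> dist (h x) (f x) + norm p"
      unfolding dist_norm by (simp only: norm_triangle_ineq4)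
    also have "\<dots> < \<epsilon>" using h_close[OF \<open>x \<in> X\<close>] p(1) by linarith
    finally show "dist (h x - p) (f x) < \<epsilon>" .
  qed
qed

lemma Tietze_compact_complex:
  fixes X :: "'a::metric_space set" and f :: "'a \<Rightarrow> complex"
  assumes "compact X" "closedin (top_of_set X) A" "continuous_on A f" "\<And>x. x \<in> A \<Longrightarrow> norm (f x) \<le> 1"
  obtains g where "continuous_on X g" "\<And>x. x \<in> A \<Longrightarrow> g x = f x"
proof -
  have AX: "A \<subseteq> X" using assms(2) closedin_imp_subset by blast
  have nX: "normal_space (top_of_set X)"
    by (intro metrizable_imp_normal_space metrizable_space_subtopology metrizable_space_euclidean)
  have sub: "subtopology (top_of_set X) A = top_of_set A"
    using AX by (simp add: subtopology_subtopology inf.absorb2)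
  have ext: "\<exists>u. continuous_on X u \<and> (\<forall>x\<in>A. u x = v x)"
    if "continuous_on A v" "\<And>x. x \<in> A \<Longrightarrow> \<bar>v x\<bar> \<le> 1" for v :: "'a \<Rightarrow> real"
  proof -
    have "continuous_map (subtopology (top_of_set X) A) euclideanreal v"
      using that(1) by (simp add: sub)
    moreover have "v ` A \<subseteq> {-1..1}" using that(2) by (force simp: abs_le_iff)
    ultimately obtain u where "continuous_map (top_of_set X) euclideanreal u" "\<And>x. x \<in> A \<Longrightarrow> u x = v x"
      by (rule Tietze_extension_closed_real_interval[OF nX assms(2), of v "-1" 1]) auto
    then show ?thesis by auto
  qed
  obtain u1 where u1: "continuous_on X u1" "\<forall>x\<in>A. u1 x = Re (f x)"
    using ext[of "\<lambda>x. Re (f x)"] assms(3,4) abs_Re_le_cmod order_trans by (metis continuous_on_Re)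
  obtain u2 where u2: "continuous_on X u2" "\<forall>x\<in>A. u2 x = Im (f x)"
    using ext[of "\<lambda>x. Im (f x)"] assms(3,4) abs_Im_le_cmod order_trans by (metis continuous_on_Im)
  show ?thesis
  proof (rule that[of "\<lambda>x. Complex (u1 x) (u2 x)"])
    show "continuous_on X (\<lambda>x. Complex (u1 x) (u2 x))"
      unfolding Complex_eq by (intro continuous_intros u1(1) u2(1))
  qed (use u1 u2 in auto)
qed

text \<open>A substitute for maps to the circle: the perturbation off the origin yields nonvanishing
  values, but not values of norm 1.\<close>

definition punctured_map :: "'a::topological_space set \<Rightarrow> ('a \<Rightarrow> complex) \<Rightarrow> bool" where
  "punctured_map X F \<longleftrightarrow> continuous_on X F \<and> 0 \<notin> F ` X"

lemma punctured_map_path: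
  assumes "punctured_map X F" "path \<eta>" "path_image \<eta> \<subseteq> X"
  shows "path (F \<circ> \<eta>)" "0 \<notin> path_image (F \<circ> \<eta>)"
  using assms
  by (auto simp: punctured_map_def path_image_compose intro: path_continuous_image continuous_on_subset)

section \<open>Winding numbers of loops under maps to the punctured plane\<close>

abbreviation wind :: "('a \<Rightarrow> complex) \<Rightarrow> (real \<Rightarrow> 'a) \<Rightarrow> complex" where
  "wind F \<eta> \<equiv> winding_number (F \<circ> \<eta>) 0"

lemma winding_number_join_compose:
  assumes "punctured_map X F" "path p" "path_image p \<subseteq> X" "path q" "path_image q \<subseteq> X"
    "pathfinish p = pathstart q"
  shows "wind F (p +++ q) = wind F p + wind F q"
  unfolding path_compose_join
  using assms punctured_map_path[OF assms(1)]
  by (intro winding_number_join) (simp_all add: pathfinish_compose pathstart_compose)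

lemma winding_number_reversepath_compose:
  assumes "punctured_map X F" "path p" "path_image p \<subseteq> X"
  shows "wind F (reversepath p) = - wind F p"
  unfolding path_compose_reversepath
  using punctured_map_path[OF assms] by (intro winding_number_reversepath) simp_all

lemma winding_number_homotopic_loops_compose:
  assumes "punctured_map X F" "homotopic_loops X p q"
  shows "wind F p = wind F q"
proof (rule winding_number_homotopic_loops, rule homotopic_loops_continuous_image)
  show "homotopic_loops X p q" by fact
qed (use assms(1) in \<open>auto simp: punctured_map_def\<close>)

text \<open>The disc of radius 1 about 1 does not contain the origin, so a loop inside it cannot
  wind around the origin. This makes a detector blind to loops outside its open set.\<close>

lemma winding_number_near_1:
  assumes "punctured_map X F" "path \<eta>" "path_image \<eta> \<subseteq> X" "pathfinish \<eta> = pathstart \<eta>"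
    "\<And>x. x \<in> path_image \<eta> \<Longrightarrow> dist (F x) 1 < 1"
  shows "wind F \<eta> = 0"
proof -
  have "wind F \<eta> = winding_number (\<lambda>_. 1) 0"
  proof (rule winding_number_nearby_loops_eq)
    fix t :: real assume "t \<in> {0..1}"
    then have "dist (F (\<eta> t)) 1 < 1" by (intro assms(5)) (auto simp: path_image_def)
    then show "norm ((F \<circ> \<eta>) t - 1) < norm ((1::complex) - 0)" by (simp add: dist_norm)
  qed (use punctured_map_path[OF assms(1-3)] assms(4) in
      \<open>auto simp: pathfinish_def pathstart_def path_def\<close>)
  then show ?thesis by (simp add: winding_number_zero_const)
qed

text \<open>The model map turns once around the circle along the arc and equals 1 on
  \<open>R\<close>. It is continuous because the two closed sets meet at most in the ends of the
  arc. It extends to \<open>X\<close> by Tietze, and the extension is pushed off the origin by less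
  than 1, the modulus of the model, so the winding of the model survives.\<close>

lemma arc_detector:
  fixes X :: "'a::metric_space set"
  assumes "compact X" "covering_dim_le (top_of_set X) 1" "arc \<alpha>" "path_image \<alpha> \<subseteq> X"
    "closed R" "R \<subseteq> X" "path_image \<alpha> \<inter> R \<subseteq> {pathstart \<alpha>, pathfinish \<alpha>}"
  obtains F where "punctured_map X F" "\<And>x. x \<in> R \<Longrightarrow> dist (F x) 1 < 1"
    "\<And>t. t \<in> {0..1} \<Longrightarrow> dist (F (\<alpha> t)) (exp (2 * of_real pi * \<i> * of_real t)) < 1"
proof -
  let ?J = "path_image \<alpha>"
  define e where "e = (\<lambda>t::real. exp (2 * of_real pi * \<i> * of_real t) :: complex)"
  obtain h where h: "homeomorphism {0..1} ?J \<alpha> h" using homeomorphism_arc[OF assms(3)] .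
  have conth: "continuous_on ?J h" and ha: "\<And>t. t \<in> {0..1} \<Longrightarrow> h (\<alpha> t) = t"
    using h by (auto simp: homeomorphism_def)
  have aJ: "\<alpha> t \<in> ?J" if "t \<in> {0..1}" for t using that by (auto simp: path_image_def)
  define f where "f = (\<lambda>x. if x \<in> ?J then e (h x) else 1)"
  have e01: "e 0 = 1" "e 1 = 1" by (simp_all add: e_def exp_two_pi_i')
  have fR: "f x = 1" if "x \<in> R" for x
  proof (cases "x \<in> ?J")
    case True
    then have "x = \<alpha> 0 \<or> x = \<alpha> 1" using assms(7) that by (auto simp: pathstart_def pathfinish_def)
    then show ?thesis using True ha[of 0] ha[of 1] e01 by (auto simp: f_def)
  qed (simp add: f_def)
  have cJ: "closed ?J" using assms(3) by (simp add: closed_arc_image)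
  have cf: "continuous_on (?J \<union> R) f"
  proof (rule continuous_on_closed_Un[OF cJ assms(5)])
    have "continuous_on ?J (\<lambda>x. e (h x))" unfolding e_def by (intro continuous_intros conth)
    then show "continuous_on ?J f" by (rule continuous_on_eq) (simp add: f_def)
    show "continuous_on R f" using fR by (metis continuous_on_cong continuous_on_const)
  qed
  have nf: "norm (f x) \<le> 1" for x by (simp add: f_def e_def norm_exp_eq_Re)
  have "closedin (top_of_set X) (?J \<union> R)"
    using cJ assms(4-6) by (intro closed_subset) auto
  then obtain g0 where g0: "continuous_on X g0" "\<And>x. x \<in> ?J \<union> R \<Longrightarrow> g0 x = f x"
    using Tietze_compact_complex[OF assms(1) _ cf nf] by blast
  obtain F where F: "continuous_on X F" "0 \<notin> F ` X" "\<And>x. x \<in> X \<Longrightarrow> dist (F x) (g0 x) < 1"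
    using covering_dim_le_1_avoid_0[OF assms(1,2) g0(1), of 1] by auto
  show ?thesis
  proof (rule that)
    show "punctured_map X F" using F by (simp add: punctured_map_def)
    show "dist (F x) 1 < 1" if "x \<in> R" for x
      using F(3)[of x] g0(2)[of x] fR[OF that] that assms(6) by auto
    fix t :: real assume t: "t \<in> {0..1}"
    have "g0 (\<alpha> t) = e t" using g0(2)[of "\<alpha> t"] aJ[OF t] ha[OF t] by (simp add: f_def)
    then show "dist (F (\<alpha> t)) (exp (2 * of_real pi * \<i> * of_real t)) < 1"
      using F(3)[of "\<alpha> t"] aJ[OF t] assms(4) by (auto simp: e_def)
  qed
qed

text \<open>The whole turn takes place on a subarc of \<open>\<gamma>\<close> inside
  \<open>U\<close>; the set \<open>R\<close> of \<open>arc_detector\<close> collects the complement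
  of \<open>U\<close> and the rest of the loop.\<close>

lemma simple_loop_detector:
  fixes X :: "'a::metric_space set"
  assumes "compact X" "covering_dim_le (top_of_set X) 1"
    "simple_path \<gamma>" "pathfinish \<gamma> = pathstart \<gamma>" "path_image \<gamma> \<subseteq> X"
    "openin (top_of_set X) U" "U \<inter> path_image \<gamma> \<noteq> {}"
  obtains F where "punctured_map X F" "\<And>x. x \<in> X - U \<Longrightarrow> dist (F x) 1 < 1"
    "wind F \<gamma> = 1"
proof -
  have pg: "path \<gamma>" using assms(3) by (rule simple_path_imp_path)
  have cg: "continuous_on {0..1} \<gamma>" using pg by (simp add: path_def)
  have gX: "\<gamma> t \<in> X" if "t \<in> {0..1}" for t using that assms(5) by (auto simp: path_image_def)
  have inj: "s = t \<or> s = 0 \<and> t = 1 \<or> s = 1 \<and> t = 0" if "\<gamma> s = \<gamma> t" "s \<in> {0..1}" "t \<in> {0..1}" for s t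
    using assms(3) that by (auto simp: simple_path_def loop_free_def)
  obtain t0 where t0: "t0 \<in> {0..1}" "\<gamma> t0 \<in> U" using assms(7) unfolding path_image_def by blast
  have "openin (top_of_set {0..1}) ({0..1} \<inter> \<gamma> -` U)"
    by (rule continuous_openin_preimage[OF cg _ assms(6)]) (use gX in auto)
  then have "\<exists>d>0. \<forall>t\<in>{0..1}. dist t t0 < d \<longrightarrow> \<gamma> t \<in> U"
    using t0 unfolding openin_euclidean_subtopology_iff by blast
  then obtain d where d: "d > 0" "\<And>t. t \<in> {0..1} \<Longrightarrow> dist t t0 < d \<Longrightarrow> \<gamma> t \<in> U"
    by blast
  \<comment> \<open>The bound 1/4 keeps the parameter interval shorter than 1, so that
    \<open>\<gamma>\<close> is injective on it even if it touches the base point.\<close>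
  define r where "r = min (d/2) (1/4)"
  have r: "0 < r" "r < d" "r \<le> 1/4" using d(1) by (auto simp: r_def)
  obtain a b where ab: "0 \<le> a" "a < b" "b \<le> 1" "b - a < 1" "\<And>t. a \<le> t \<Longrightarrow> t \<le> b \<Longrightarrow> dist t t0 < d"
  proof (cases "t0 \<le> 1/2")
    case True
    show ?thesis by (rule that[of t0 "t0 + r"]) (use True t0 r in \<open>auto simp: dist_real_def\<close>)
  next
    case False
    show ?thesis by (rule that[of "t0 - r" t0]) (use False t0 r in \<open>auto simp: dist_real_def\<close>)
  qed
  define \<alpha> where "\<alpha> = subarc a b \<gamma>"
  define R where "R = (X - U) \<union> \<gamma> ` ({0..a} \<union> {b..1})"
  have seg: "closed_segment a b = {a..b}" using ab(2) by (simp add: closed_segment_eq_real_ivl)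
  have imJ: "path_image \<alpha> = \<gamma> ` {a..b}" by (simp add: \<alpha>_def path_image_subarc seg)
  have "arc \<alpha>"
    unfolding \<alpha>_def
  proof (rule arc_subarc[OF pg])
    show "inj_on \<gamma> (closed_segment a b)"
      unfolding seg
    proof (rule inj_onI)
      fix s t assume "s \<in> {a..b}" "t \<in> {a..b}" "\<gamma> s = \<gamma> t"
      then show "s = t" using inj[of s t] ab(1,3,4) by auto
    qed
  qed (use ab in auto)
  moreover have "path_image \<alpha> \<subseteq> X" unfolding imJ using gX ab by auto
  moreover have "closed R"
  proof -
    have "closed (X - U)" by (rule closed_diff_openin[OF assms(1,6)])
    moreover have "compact (\<gamma> ` ({0..a} \<union> {b..1}))"
      by (rule compact_continuous_image) (use ab in \<open>auto intro!: continuous_on_subset[OF cg] compact_Un\<close>)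
    ultimately show ?thesis unfolding R_def by (simp add: closed_Un compact_imp_closed)
  qed
  moreover have "R \<subseteq> X" unfolding R_def using gX ab by auto
  moreover have "path_image \<alpha> \<inter> R \<subseteq> {pathstart \<alpha>, pathfinish \<alpha>}"
  proof
    fix x assume x: "x \<in> path_image \<alpha> \<inter> R"
    then obtain s where s: "s \<in> {a..b}" "x = \<gamma> s" unfolding imJ by blast
    have "\<gamma> s \<in> U" by (intro d(2) ab(5)) (use ab(1,3) s(1) in auto)
    with x s(2) have "\<gamma> s \<in> \<gamma> ` ({0..a} \<union> {b..1})" by (simp add: R_def)
    then obtain t where t: "t \<in> {0..a} \<union> {b..1}" "\<gamma> s = \<gamma> t" by blast
    have "s \<in> {0..1}" "t \<in> {0..1}" using s(1) t(1) ab(1-3) by auto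
    then have "s = t \<or> s = 0 \<and> t = 1 \<or> s = 1 \<and> t = 0" by (rule inj[OF t(2)])
    then have "s = a \<or> s = b" using s(1) t(1) ab(1,3) by auto
    then show "x \<in> {pathstart \<alpha>, pathfinish \<alpha>}" using s(2) by (auto simp: \<alpha>_def)
  qed
  ultimately obtain F where F: "punctured_map X F" "\<And>x. x \<in> R \<Longrightarrow> dist (F x) 1 < 1"
    "\<And>t. t \<in> {0..1} \<Longrightarrow> dist (F (\<alpha> t)) (exp (2 * of_real pi * \<i> * of_real t)) < 1"
    using arc_detector[OF assms(1,2)] by blast
  \<comment> \<open>A continuous logarithm of the model loop: it rises from 0 to
    \<open>2 * pi * \<i>\<close> over [a, b] and rests outside.\<close>
  define q where "q = (\<lambda>t. 2 * of_real pi * \<i> * of_real (max 0 (min 1 ((t - a) / (b - a)))) :: complex)"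
  have pq: "path q" unfolding q_def path_def using ab(2) by (intro continuous_intros) auto
  have q0: "q 0 = 0" and q1: "q 1 = 2 * of_real pi * \<i>"
    using ab by (auto simp: q_def max_def min_def field_simps)
  have "wind F \<gamma> = wind exp q"
  proof (rule winding_number_nearby_loops_eq)
    show "path (exp \<circ> q)" using pq by (intro path_continuous_image continuous_intros)
    show "path (F \<circ> \<gamma>)" using punctured_map_path[OF F(1) pg assms(5)] by simp
    show "pathfinish (exp \<circ> q) = pathstart (exp \<circ> q)"
      by (simp add: pathfinish_def pathstart_def q0 q1)
    show "pathfinish (F \<circ> \<gamma>) = pathstart (F \<circ> \<gamma>)"
      using assms(4) by (simp add: pathfinish_def pathstart_def)
    fix t :: real assume t: "t \<in> {0..1}"
    have n1: "norm ((exp \<circ> q) t - 0) = 1" by (simp add: q_def norm_exp_eq_Re)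
    consider "t \<le> a" | "b \<le> t" | "a \<le> t" "t \<le> b" by linarith
    then have "dist (F (\<gamma> t)) (exp (q t)) < 1"
    proof cases
      case 1
      then have "exp (q t) = 1" using ab(2) by (auto simp: q_def max_def min_def field_simps)
      then show ?thesis using F(2)[of "\<gamma> t"] t 1 by (auto simp: R_def)
    next
      case 2
      then have "exp (q t) = 1" using ab(2) exp_two_pi_i' by (auto simp: q_def max_def min_def field_simps)
      then show ?thesis using F(2)[of "\<gamma> t"] t 2 by (auto simp: R_def)
    next
      case 3
      define u where "u = (t - a) / (b - a)"
      have u: "u \<in> {0..1}" using 3 ab(2) by (auto simp: u_def)
      have "\<alpha> u = \<gamma> t" using ab(2) by (simp add: \<alpha>_def subarc_def u_def)
      moreover have "q t = 2 * of_real pi * \<i> * of_real u" using u by (simp add: q_def flip: u_def)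
      ultimately show ?thesis using F(3)[OF u] by simp
    qed
    then show "norm ((F \<circ> \<gamma>) t - (exp \<circ> q) t) < norm ((exp \<circ> q) t - 0)"
      unfolding n1 by (simp add: dist_norm)
  qed
  also have "\<dots> = 1"
    unfolding winding_number_compose_exp[OF pq] by (simp add: pathfinish_def pathstart_def q0 q1)
  finally show ?thesis
    using that[OF F(1)] F(2) by (auto simp: R_def)
qed

section \<open>Shortest loops\<close>

text \<open>The functions are defined on all reals with values in \<open>X\<close>, so that they
  form a subset of a power of \<open>X\<close>, which is compact by Tychonoff.\<close>

definition lipschitz_loops :: "'a::metric_space set \<Rightarrow> real \<Rightarrow> (real \<Rightarrow> 'a) set" where
  "lipschitz_loops X L =
     {f. (\<forall>t. f t \<in> X) \<and> f 0 = f 1 \<and> (\<forall>a\<in>{0..1}. \<forall>b\<in>{0..1}. dist (f a) (f b) \<le> L * \<bar>a - b\<bar>)}"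

lemma lipschitz_loops_mono: "L \<le> L' \<Longrightarrow> lipschitz_loops X L \<subseteq> lipschitz_loops X L'"
  unfolding lipschitz_loops_def
  by (auto intro: order_trans[OF _ mult_right_mono[of L L']])

lemma lipschitz_loopsD:
  assumes "f \<in> lipschitz_loops X L"
  shows "path f" "path_image f \<subseteq> X" "pathfinish f = pathstart f" "len_le f L" "0 \<le> L"
proof -
  have d: "dist (f a) (f b) \<le> L * \<bar>a - b\<bar>" if "a \<in> {0..1}" "b \<in> {0..1}" for a b
    using assms that by (simp add: lipschitz_loops_def)
  have "0 \<le> dist (f 0) (f 1)" by simp
  also have "\<dots> \<le> L * \<bar>0 - 1\<bar>" by (rule d) auto
  finally show "0 \<le> L" by simp
  then have "L-lipschitz_on {0..1} f" using d by (simp add: lipschitz_on_def dist_real_def)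
  then show "path f" unfolding path_def by (rule lipschitz_on_continuous_on)
  show "len_le f L" using d by (rule len_le_lipschitz)
qed (use assms in \<open>auto simp: lipschitz_loops_def path_image_def pathfinish_def pathstart_def\<close>)

text \<open>The extra speed \<open>\<delta>\<close> comes from \<open>len_le_reparametrize\<close>.
  Clamping the parameter keeps the values outside [0, 1] in \<open>X\<close>.\<close>

lemma homotopic_lipschitz_loop:
  assumes "path \<eta>" "path_image \<eta> \<subseteq> X" "pathfinish \<eta> = pathstart \<eta>" "len_le \<eta> l" "0 < \<delta>"
  obtains f where "f \<in> lipschitz_loops X (l + \<delta>)" "homotopic_loops X \<eta> f"
proof -
  obtain \<tau> :: "real \<Rightarrow> real" where \<tau>: "continuous_on {0..1} \<tau>" "\<tau> \<in> {0..1} \<rightarrow> {0..1}" "\<tau> 0 = 0" "\<tau> 1 = 1"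
    "\<And>a b. a \<in> {0..1} \<Longrightarrow> b \<in> {0..1} \<Longrightarrow> dist (\<eta> (\<tau> a)) (\<eta> (\<tau> b)) \<le> (l + \<delta>) * \<bar>a - b\<bar>"
    using len_le_reparametrize[OF assms(4,1,5)] by blast
  define f where "f = (\<lambda>t. \<eta> (\<tau> (max 0 (min 1 t))))"
  have f_eq: "f t = \<eta> (\<tau> t)" if "t \<in> {0..1}" for t using that by (simp add: f_def)
  have "f t \<in> X" for t
  proof -
    have "max 0 (min 1 t) \<in> {0..1}" by simp
    then have "\<tau> (max 0 (min 1 t)) \<in> {0..1}" using \<tau>(2) by blast
    then show ?thesis using assms(2) unfolding f_def path_image_def by blast
  qed
  moreover have "f 0 = f 1" using assms(3) \<tau>(3,4) by (simp add: f_eq pathfinish_def pathstart_def)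
  ultimately have "f \<in> lipschitz_loops X (l + \<delta>)"
    using \<tau>(5) by (simp add: lipschitz_loops_def f_eq)
  moreover have "homotopic_paths X \<eta> f"
    by (rule homotopic_paths_reparametrize[OF assms(1,2) \<tau>(1-4)]) (rule f_eq)
  then have "homotopic_loops X \<eta> f"
    by (rule homotopic_paths_imp_homotopic_loops)
      (use assms(3) homotopic_paths_imp_pathfinish[of X \<eta> f] \<open>homotopic_paths X \<eta> f\<close> in auto)
  ultimately show ?thesis by (rule that)
qed

text \<open>This takes the place of Arzela-Ascoli: each inequality involves two coordinates only,
  hence is closed in the product topology.\<close>

lemma lipschitz_loops_topology:
  assumes "compact X"
  shows "compact {f::real \<Rightarrow> 'a::metric_space. \<forall>t. f t \<in> X}" "closed (lipschitz_loops X L)"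
proof -
  have "{f::real \<Rightarrow> 'a. \<forall>t. f t \<in> X} = PiE UNIV (\<lambda>_. X)" by (auto simp: PiE_def)
  moreover have "compactin (product_topology (\<lambda>_::real. euclidean) UNIV) (PiE UNIV (\<lambda>_. X))"
    using assms by (simp add: compactin_PiE)
  ultimately show "compact {f::real \<Rightarrow> 'a. \<forall>t. f t \<in> X}"
    by (simp add: euclidean_product_topology)
  have cX: "closed X" using assms by (rule compact_imp_closed)
  have 1: "closed {f::real \<Rightarrow> 'a. f t \<in> X}" for t
    using closed_vimage[OF cX continuous_on_product_coordinates] by (simp add: vimage_def)
  have 2: "closed {f::real \<Rightarrow> 'a. dist (f a) (f b) \<le> c}" for a b c
    by (rule closed_Collect_le) (intro continuous_intros continuous_on_product_coordinates)+
  have "lipschitz_loops X L = (\<Inter>t. {f. f t \<in> X}) \<inter> {f. dist (f 0) (f 1) \<le> 0} \<inter>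
      (\<Inter>a\<in>{0..1}. \<Inter>b\<in>{0..1}. {f. dist (f a) (f b) \<le> L * \<bar>a - b\<bar>})"
    by (auto simp: lipschitz_loops_def)
  also have "closed \<dots>" by (intro closed_Int closed_INT ballI 1 2)
  finally show "closed (lipschitz_loops X L)" .
qed

text \<open>\<open>F\<close> is bounded away from 0 and uniformly continuous. The inequality has the
  form needed to compare winding numbers of nearby loops.\<close>

lemma punctured_map_uniform:
  fixes X :: "'a::metric_space set"
  assumes "compact X" "punctured_map X F"
  obtains d where "0 < d" "\<And>x y. x \<in> X \<Longrightarrow> y \<in> X \<Longrightarrow> dist x y < d \<Longrightarrow> norm (F y - F x) < norm (F x)"
proof (cases "X = {}")
  case True
  show ?thesis by (rule that[of 1]) (use True in auto)
next
  case False
  have F: "continuous_on X F" "0 \<notin> F ` X" using assms(2) by (auto simp: punctured_map_def)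
  have "continuous_on X (\<lambda>x. norm (F x))" by (intro continuous_intros F(1))
  from continuous_attains_inf[OF assms(1) False this]
  obtain z where z: "z \<in> X" "\<And>x. x \<in> X \<Longrightarrow> norm (F z) \<le> norm (F x)" by blast
  have c: "0 < norm (F z)" using z(1) F(2) by auto
  have "uniformly_continuous_on X F" using F(1) assms(1) by (rule compact_uniformly_continuous)
  then obtain d where "d > 0" "\<forall>x\<in>X. \<forall>y\<in>X. dist y x < d \<longrightarrow> dist (F y) (F x) < norm (F z)"
    unfolding uniformly_continuous_on_def using c by blast
  then have "norm (F y - F x) < norm (F x)" if "x \<in> X" "y \<in> X" "dist x y < d" for x y
    using z(2)[OF that(1)] that by (metis dist_commute dist_norm less_le_trans)
  with \<open>d > 0\<close> show ?thesis by (rule that)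
qed

text \<open>On equi-Lipschitz loops pointwise convergence is uniform, so the winding number is locally
  constant in the product topology.\<close>

lemma closed_winding_nonzero:
  fixes X :: "'a::metric_space set"
  assumes "compact X" "punctured_map X F"
  shows "closed {f \<in> lipschitz_loops X L. wind F f \<noteq> 0}"
proof (cases "lipschitz_loops X L = {}")
  case False
  then have L0: "0 \<le> L" using lipschitz_loopsD(5) by blast
  obtain d where d: "0 < d"
    "\<And>x y. x \<in> X \<Longrightarrow> y \<in> X \<Longrightarrow> dist x y < d \<Longrightarrow> norm (F y - F x) < norm (F x)"
    using punctured_map_uniform[OF assms] by blast
  \<comment> \<open>Over a parameter distance below \<open>\<rho>\<close> a loop moves by at most
    \<open>d/3\<close>; two such moves and the gap at a grid point add up to less than
    \<open>d\<close>. The \<open>+ 1\<close> covers \<open>L = 0\<close>.\<close>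
  define \<rho> where "\<rho> = d / (3 * (L + 1))"
  have \<rho>: "0 < \<rho>" "L * \<rho> \<le> d / 3"
    using d(1) L0 by (auto simp: \<rho>_def field_simps)
  obtain T where T: "T \<subseteq> {0..1}" "finite T" "{0..1::real} \<subseteq> (\<Union>s\<in>T. ball s \<rho>)"
    by (rule compactE_image[of "{0..1::real}" "{0..1}" "\<lambda>s. ball s \<rho>"]) (use \<rho>(1) in auto)
  \<comment> \<open>A neighbourhood in the product topology, since it restrains only the finitely
    many coordinates in \<open>T\<close>.\<close>
  define Q where "Q = (\<lambda>f::real \<Rightarrow> 'a. \<Inter>s\<in>T. {g. dist (g s) (f s) < d / 3})"
  have oQ: "open (Q f)" for f
    unfolding Q_def
  proof (rule open_INT[OF T(2)], rule ballI)
    fix s show "open {g. dist (g s) (f s) < d / 3}"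
      by (rule open_Collect_less) (intro continuous_intros continuous_on_product_coordinates)+
  qed
  define B where "B = {f \<in> lipschitz_loops X L. wind F f = 0}"
  have near: "wind F g = wind F f"
    if f: "f \<in> lipschitz_loops X L" and g: "g \<in> lipschitz_loops X L" and gQ: "g \<in> Q f" for f g
  proof (rule winding_number_nearby_loops_eq)
    show "path (F \<circ> f)" "path (F \<circ> g)"
      using punctured_map_path(1)[OF assms(2)] lipschitz_loopsD(1,2) f g by blast+
    show "pathfinish (F \<circ> f) = pathstart (F \<circ> f)" "pathfinish (F \<circ> g) = pathstart (F \<circ> g)"
      using lipschitz_loopsD(3)[OF f] lipschitz_loopsD(3)[OF g] by (auto simp: pathfinish_def pathstart_def)
    fix t :: real assume t: "t \<in> {0..1}"
    with T(3) obtain s where s: "s \<in> T" "dist s t < \<rho>" by (meson UN_E mem_ball subsetD)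
    then have s01: "s \<in> {0..1}" using T(1) by blast
    have lip: "dist (u s) (u t) \<le> d / 3" if "u \<in> lipschitz_loops X L" for u
    proof -
      have "dist (u s) (u t) \<le> L * \<bar>s - t\<bar>" using that s01 t by (simp add: lipschitz_loops_def)
      also have "\<dots> \<le> L * \<rho>" using s(2) L0 by (intro mult_left_mono) (auto simp: dist_real_def)
      finally show ?thesis using \<rho>(2) by linarith
    qed
    have "dist (g s) (f s) < d / 3" using gQ s(1) by (simp add: Q_def)
    moreover have "dist (f t) (g t) \<le> dist (f t) (f s) + dist (f s) (g s) + dist (g s) (g t)"
      using dist_triangle[of "f t" "g t" "f s"] dist_triangle[of "f s" "g t" "g s"] by linarith
    ultimately have "dist (f t) (g t) < d"
      using lip[OF f] lip[OF g] by (simp add: dist_commute)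
    moreover have "f t \<in> X" "g t \<in> X" using f g by (auto simp: lipschitz_loops_def)
    ultimately show "norm ((F \<circ> g) t - (F \<circ> f) t) < norm ((F \<circ> f) t - 0)" using d(2) by simp
  qed
  have selfQ: "f \<in> Q f" for f using d(1) by (simp add: Q_def)
  have "{f \<in> lipschitz_loops X L. wind F f \<noteq> 0} = lipschitz_loops X L \<inter> (\<Inter>f\<in>B. - Q f)"
  proof (intro equalityI subsetI)
    fix g assume "g \<in> {f \<in> lipschitz_loops X L. wind F f \<noteq> 0}"
    then show "g \<in> lipschitz_loops X L \<inter> (\<Inter>f\<in>B. - Q f)"
      using near by (fastforce simp: B_def)
  next
    fix g assume g: "g \<in> lipschitz_loops X L \<inter> (\<Inter>f\<in>B. - Q f)"
    then have "g \<notin> B" using selfQ by blast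
    then show "g \<in> {f \<in> lipschitz_loops X L. wind F f \<noteq> 0}" using g by (simp add: B_def)
  qed
  also have "closed \<dots>"
    using lipschitz_loops_topology(2)[OF assms(1)] oQ by (intro closed_Int closed_INT ballI) auto
  finally show ?thesis .
qed simp

lemma compact_decreasing_Inter_nonempty:
  fixes C :: "nat \<Rightarrow> 'a::topological_space set"
  assumes "compact S" "\<And>n. closed (C n)" "\<And>n. C n \<subseteq> S" "\<And>n. C n \<noteq> {}" "\<And>m n. m \<le> n \<Longrightarrow> C n \<subseteq> C m"
  shows "(\<Inter>n. C n) \<noteq> {}"
proof -
  have "S \<inter> (\<Inter>n\<in>UNIV. C n) \<noteq> {}"
  proof (rule compact_imp_fip_image[OF assms(1)])
    fix I :: "nat set" assume "finite I"
    then obtain k where "\<And>i. i \<in> I \<Longrightarrow> i \<le> k" using finite_nat_set_iff_bounded_le by auto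
    then have "C k \<subseteq> S \<inter> (\<Inter>i\<in>I. C i)" using assms(3,5) by blast
    then show "S \<inter> (\<Inter>i\<in>I. C i) \<noteq> {}" using assms(4)[of k] by blast
  qed (rule assms(2))
  then show ?thesis by blast
qed

text \<open>Nonvanishing of winding numbers is invariant under free homotopy and closed under uniform
  limits. Minimising length subject to such conditions therefore yields a loop that is shortest in
  its own free homotopy class, although a single free homotopy class is not known here to be closed.\<close>

lemma exists_geodesic_loop:
  fixes X :: "'a::metric_space set" and F :: "nat \<Rightarrow> 'a \<Rightarrow> complex"
  assumes X: "compact X" and F: "\<And>n. punctured_map X (F n)"
    and loops: "\<And>N. \<exists>\<eta>. path \<eta> \<and> path_image \<eta> \<subseteq> X \<and> pathfinish \<eta> = pathstart \<eta> \<and> len_le \<eta> M \<and>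
                      (\<forall>n<N. wind (F n) \<eta> \<noteq> 0)"
  obtains \<gamma> where "geodesic_loop X \<gamma>" "\<not> \<gamma> constant_on {0..1}"
    "\<And>n. wind (F n) \<gamma> \<noteq> 0"
proof -
  define E where "E = (\<lambda>L. {f \<in> lipschitz_loops X L. \<forall>n. wind (F n) f \<noteq> 0})"
  let ?S = "{f::real \<Rightarrow> 'a. \<forall>t. f t \<in> X}"
  have subS: "lipschitz_loops X L \<subseteq> ?S" for L by (auto simp: lipschitz_loops_def)
  have closed1: "closed (lipschitz_loops X L \<inter> (\<Inter>n\<in>I. {f \<in> lipschitz_loops X L. wind (F n) f \<noteq> 0}))" for L I
    using lipschitz_loops_topology(2)[OF X] closed_winding_nonzero[OF X F]
    by (intro closed_Int closed_INT ballI) auto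
  have E_eq: "E L = lipschitz_loops X L \<inter> (\<Inter>n\<in>UNIV. {f \<in> lipschitz_loops X L. wind (F n) f \<noteq> 0})" for L
    by (auto simp: E_def)
  have E_closed: "closed (E L)" for L unfolding E_eq by (rule closed1)
  have E_mono: "E L \<subseteq> E L'" if "L \<le> L'" for L L'
    using lipschitz_loops_mono[OF that] by (auto simp: E_def)
  have E_reach: "E (l + \<delta>) \<noteq> {}"
    if \<eta>: "path \<eta>" "path_image \<eta> \<subseteq> X" "pathfinish \<eta> = pathstart \<eta>" "len_le \<eta> l" "0 < \<delta>"
      "\<And>n. wind (F n) \<eta> \<noteq> 0" for \<eta> l \<delta>
  proof -
    obtain f where f: "f \<in> lipschitz_loops X (l + \<delta>)" "homotopic_loops X \<eta> f"
      using homotopic_lipschitz_loop[OF \<eta>(1-5)] by blast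
    then have "f \<in> E (l + \<delta>)"
      using winding_number_homotopic_loops_compose[OF F f(2)] \<eta>(6) by (simp add: E_def)
    then show ?thesis by blast
  qed
  \<comment> \<open>Finitely many conditions at a time, with one Lipschitz bound for all
    \<open>N\<close>; a common element satisfies all of them. The \<open>+ 1\<close> pays for the
    reparametrisation.\<close>
  define C where "C = (\<lambda>N. lipschitz_loops X (M + 1) \<inter>
      (\<Inter>n\<in>{..<N}. {f \<in> lipschitz_loops X (M + 1). wind (F n) f \<noteq> 0}))"
  have "(\<Inter>N. C N) \<noteq> {}"
  proof (rule compact_decreasing_Inter_nonempty[OF lipschitz_loops_topology(1)[OF X]])
    show "closed (C N)" for N unfolding C_def by (rule closed1)
    show "C N \<subseteq> ?S" for N unfolding C_def using subS by blast
    show "C n \<subseteq> C m" if "m \<le> n" for m n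
      unfolding C_def using that by (intro Int_mono INT_anti_mono) auto
    fix N
    obtain \<eta> where \<eta>: "path \<eta>" "path_image \<eta> \<subseteq> X" "pathfinish \<eta> = pathstart \<eta>" "len_le \<eta> M"
      "\<forall>n<N. wind (F n) \<eta> \<noteq> 0" using loops by blast
    obtain f where f: "f \<in> lipschitz_loops X (M + 1)" "homotopic_loops X \<eta> f"
      using homotopic_lipschitz_loop[OF \<eta>(1-4), of 1] by auto
    have "f \<in> C N"
      using winding_number_homotopic_loops_compose[OF F f(2)] \<eta>(5) f(1) by (simp add: C_def)
    then show "C N \<noteq> {}" by blast
  qed
  then obtain f0 where "\<forall>N. f0 \<in> C N" by blast
  then have "f0 \<in> E (M + 1)" unfolding E_def C_def by blast
  define A where "A = {L. E L \<noteq> {}}"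
  have A0: "0 \<le> L" if "L \<in> A" for L
    using that lipschitz_loopsD(5) by (auto simp: A_def E_def)
  have bA: "bdd_below A" using A0 by (meson bdd_belowI)
  have neA: "A \<noteq> {}" using \<open>f0 \<in> E (M + 1)\<close> by (auto simp: A_def)
  define m where "m = Inf A"
  \<comment> \<open>A second use of compactness: the infimum \<open>m\<close> of the admissible
    Lipschitz constants is attained.\<close>
  have "(\<Inter>k. E (m + 1 / (real k + 1))) \<noteq> {}"
  proof (rule compact_decreasing_Inter_nonempty[OF lipschitz_loops_topology(1)[OF X]])
    show "closed (E (m + 1 / (real k + 1)))" for k by (rule E_closed)
    show "E (m + 1 / (real k + 1)) \<subseteq> ?S" for k using subS by (auto simp: E_def)
    show "E (m + 1 / (real n + 1)) \<subseteq> E (m + 1 / (real k + 1))" if "k \<le> n" for k n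
      using that by (intro E_mono add_left_mono divide_left_mono) auto
    fix k :: nat
    have "m < m + 1 / (real k + 1)" by simp
    then obtain L where "L \<in> A" "L < m + 1 / (real k + 1)"
      unfolding m_def using cInf_less_iff[OF neA bA] by blast
    then show "E (m + 1 / (real k + 1)) \<noteq> {}"
      using E_mono[of L "m + 1 / (real k + 1)"] unfolding A_def by auto
  qed
  then obtain \<gamma> where "\<And>k. \<gamma> \<in> E (m + 1 / (real k + 1))" by blast
  then have \<gamma>k: "\<gamma> \<in> lipschitz_loops X (m + 1 / (real k + 1))"
    and wn: "wind (F n) \<gamma> \<noteq> 0" for k n
    by (auto simp: E_def)
  have d\<gamma>: "dist (\<gamma> a) (\<gamma> b) \<le> m * \<bar>a - b\<bar>" if "a \<in> {0..1}" "b \<in> {0..1}" for a b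
  proof (rule LIMSEQ_le_const)
    show "(\<lambda>k. (m + 1 / (real k + 1)) * \<bar>a - b\<bar>) \<longlonglongrightarrow> m * \<bar>a - b\<bar>"
    proof -
      have "(\<lambda>k. 1 / (real k + 1)) \<longlonglongrightarrow> 0" by real_asymp
      from tendsto_mult_right[OF tendsto_add[OF tendsto_const this]]
      show ?thesis by simp
    qed
    show "\<exists>N. \<forall>k\<ge>N. dist (\<gamma> a) (\<gamma> b) \<le> (m + 1 / (real k + 1)) * \<bar>a - b\<bar>"
      using \<gamma>k that by (auto simp: lipschitz_loops_def)
  qed
  then have len: "len_le \<gamma> m" by (rule len_le_lipschitz)
  note \<gamma> = lipschitz_loopsD[OF \<gamma>k[of 0]]
  show ?thesis
  proof (rule that)
    show "geodesic_loop X \<gamma>"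
      unfolding geodesic_loop_def
    proof (intro conjI allI impI)
      show "path \<gamma>" "path_image \<gamma> \<subseteq> X" "pathfinish \<gamma> = pathstart \<gamma>" by (fact \<gamma>)+
      show "rectifiable \<gamma>" using len by (auto simp: rectifiable_iff_len_le)
      fix \<eta> assume h: "homotopic_loops X \<gamma> \<eta>"
      show "path_length \<gamma> \<le> path_length \<eta>"
      proof (cases "rectifiable \<eta>")
        case True
        then have eq: "path_length \<eta> = ennreal (enn2real (path_length \<eta>))"
          by (simp add: rectifiable_def)
        then have l\<eta>: "len_le \<eta> (enn2real (path_length \<eta>))"
          by (intro path_length_imp_len_le) auto
        \<comment> \<open>A loop freely homotopic to \<open>\<gamma>\<close> satisfies the same
          winding conditions, so its length is, up to \<open>e\<close>, an admissible Lipschitz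
          constant.\<close>
        have "m \<le> enn2real (path_length \<eta>)"
        proof (rule field_le_epsilon)
          fix e :: real assume e: "0 < e"
          have "E (enn2real (path_length \<eta>) + e) \<noteq> {}"
          proof (rule E_reach[OF _ _ _ l\<eta> e])
            show "path \<eta>" using homotopic_loops_imp_path[OF h] by simp
            show "path_image \<eta> \<subseteq> X" using homotopic_loops_imp_subset[OF h] by simp
            show "pathfinish \<eta> = pathstart \<eta>" using homotopic_loops_imp_loop[OF h] by simp
            show "wind (F n) \<eta> \<noteq> 0" for n
              using wn winding_number_homotopic_loops_compose[OF F h] by simp
          qed
          then show "m \<le> enn2real (path_length \<eta>) + e"
            unfolding m_def using bA by (intro cInf_lower) (auto simp: A_def)
        qed
        have "path_length \<gamma> \<le> ennreal m" using len by (rule len_le_imp_path_length)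
        also have "\<dots> \<le> path_length \<eta>"
          using \<open>m \<le> enn2real (path_length \<eta>)\<close> by (subst eq) (rule ennreal_leI)
        finally show ?thesis .
      qed (simp add: rectifiable_def not_less top_unique)
    qed
    show "\<not> \<gamma> constant_on {0..1}"
    proof
      assume "\<gamma> constant_on {0..1}"
      then obtain c where c: "\<And>t. t \<in> {0..1} \<Longrightarrow> \<gamma> t = c" unfolding constant_on_def by blast
      have "wind (F 0) \<gamma> = winding_number (\<lambda>_. F 0 c) 0"
        by (rule winding_number_cong) (simp add: c)
      moreover have "F 0 c \<noteq> 0"
        using F[of 0] c[of 0] subsetD[OF \<gamma>(2), of "\<gamma> 0"] by (auto simp: punctured_map_def path_image_def)
      ultimately show False using wn[of 0] by (simp add: winding_number_zero_const)
    qed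
  qed (rule wn)
qed

section \<open>Rectifiable arcs and simple loops\<close>

lemma first_hit:
  fixes p :: "real \<Rightarrow> 'a::topological_space"
  assumes "continuous_on {a..b} p" "closed C" "a \<le> b" "p b \<in> C"
  obtains t where "t \<in> {a..b}" "p t \<in> C" "\<And>s. a \<le> s \<Longrightarrow> s < t \<Longrightarrow> p s \<notin> C"
proof -
  let ?T = "{a..b} \<inter> p -` C"
  have "closedin (top_of_set {a..b}) ?T"
    using assms(1,2) by (rule continuous_closedin_preimage)
  then have "compact ?T" using closedin_compact[OF compact_Icc] by blast
  moreover have "?T \<noteq> {}" using assms by auto
  ultimately obtain t where t: "t \<in> ?T" "\<And>s. s \<in> ?T \<Longrightarrow> t \<le> s"
    using compact_attains_inf[of ?T] by blast
  show ?thesis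
  proof (rule that)
    show "t \<in> {a..b}" "p t \<in> C" using t(1) by auto
    fix s assume "a \<le> s" "s < t"
    then have "s \<in> {a..b}" using t(1) by auto
    then show "p s \<notin> C" using t(2)[of s] \<open>s < t\<close> by auto
  qed
qed

lemma last_hit:
  fixes p :: "real \<Rightarrow> 'a::topological_space"
  assumes "continuous_on {a..b} p" "closed C" "a \<le> b" "p a \<in> C"
  obtains t where "t \<in> {a..b}" "p t \<in> C" "\<And>s. t < s \<Longrightarrow> s \<le> b \<Longrightarrow> p s \<notin> C"
proof -
  have "continuous_on {-b..-a} (\<lambda>t. p (- t))"
    by (rule continuous_on_compose2[OF assms(1)]) (auto intro!: continuous_intros)
  then obtain t where t: "t \<in> {-b..-a}" "p (- t) \<in> C" "\<And>s. -b \<le> s \<Longrightarrow> s < t \<Longrightarrow> p (- s) \<notin> C"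
    using first_hit[of "-b" "-a" "\<lambda>t. p (- t)" C] assms(2-4) by auto
  show ?thesis
  proof (rule that[of "- t"])
    fix s assume "- t < s" "s \<le> b"
    then show "p s \<notin> C" using t(3)[of "- s"] by simp
  qed (use t in auto)
qed

definition arc_le :: "'a::metric_space set \<Rightarrow> real \<Rightarrow> 'a \<Rightarrow> 'a \<Rightarrow> (real \<Rightarrow> 'a) \<Rightarrow> bool" where
  "arc_le S l a b p \<longleftrightarrow> arc p \<and> path_image p \<subseteq> S \<and> pathstart p = a \<and> pathfinish p = b \<and> len_le p l"

text \<open>\<open>l\<close> is only an upper bound for the length, so quantifying over
  \<open>l\<close> ranges over all rectifiable simple loops.\<close>

definition simple_loop_le :: "'a::metric_space set \<Rightarrow> real \<Rightarrow> (real \<Rightarrow> 'a) \<Rightarrow> bool" where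
  "simple_loop_le S l \<gamma> \<longleftrightarrow>
     simple_path \<gamma> \<and> pathfinish \<gamma> = pathstart \<gamma> \<and> path_image \<gamma> \<subseteq> S \<and> len_le \<gamma> l"

lemma arc_le_mono: "arc_le S l a b p \<Longrightarrow> S \<subseteq> S' \<Longrightarrow> l \<le> l' \<Longrightarrow> arc_le S' l' a b p"
  by (auto simp: arc_le_def intro: len_le_mono)

lemma simple_loop_le_mono: "simple_loop_le S l p \<Longrightarrow> S \<subseteq> S' \<Longrightarrow> l \<le> l' \<Longrightarrow> simple_loop_le S' l' p"
  by (auto simp: simple_loop_le_def intro: len_le_mono)

lemma arc_le_reverse: "arc_le S l a b p \<Longrightarrow> arc_le S l b a (reversepath p)"
  by (auto simp: arc_le_def intro: arc_reversepath len_le_reversepath)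

lemma arc_le_image:
  assumes "arc_le S l a b p"
  shows "path_image p \<subseteq> S" "a \<in> path_image p" "b \<in> path_image p" "a \<noteq> b" "compact (path_image p)" "connected (path_image p)"
  using assms arc_distinct_ends[of p]
  by (auto simp: arc_le_def compact_arc_image connected_arc_image)

lemma arc_le_subarc:
  assumes "arc_le S l a b p" "u \<in> {0..1}" "v \<in> {0..1}" "u \<noteq> v"
  shows "arc_le (p ` closed_segment u v) l (p u) (p v) (subarc u v p)"
proof -
  have "inj_on p (closed_segment u v)"
    using assms closed_segment_01 by (meson arc_imp_inj_on arc_le_def inj_on_subset)
  then have "arc (subarc u v p)"
    using assms by (intro arc_subarc) (auto simp: arc_le_def arc_imp_path)
  then show ?thesis
    using assms len_le_subarc[of p l u v] by (simp add: arc_le_def path_image_subarc)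
qed

lemma arc_le_join:
  assumes p: "arc_le S l a b p" and q: "arc_le S' l' b c q" and "path_image p \<inter> path_image q \<subseteq> {b}"
  shows "arc_le (path_image p \<union> path_image q) (l + l') a c (p +++ q)"
proof -
  have e: "pathfinish p = pathstart q" "pathstart q = b" using p q by (auto simp: arc_le_def)
  have "arc (p +++ q)"
    by (rule arc_join) (use assms e in \<open>auto simp: arc_le_def\<close>)
  then show ?thesis
    using p q e len_le_join[of p l q l'] by (simp add: arc_le_def path_image_join)
qed

text \<open>Leaving \<open>p\<close> at its first point on \<open>q\<close> and continuing along
  \<open>q\<close> avoids all self-intersections.\<close>

lemma arc_shortcut:
  assumes p: "arc_le S l a b p" and q: "arc_le S' l' b c q" and "a \<noteq> c"
  obtains r where "arc_le (path_image p \<union> path_image q) (l + l') a c r"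
proof -
  have pp: "arc p" "p 0 = a" "p 1 = b" "len_le p l" and qq: "arc q" "q 0 = b" "q 1 = c" "len_le q l'"
    using p q by (auto simp: arc_le_def pathstart_def pathfinish_def)
  have l0: "0 \<le> l" "0 \<le> l'" using pp(4) qq(4) by (auto intro: len_le_nonneg)
  have cp: "continuous_on {0..1} p" using pp(1) by (simp add: arc_def path_def)
  have "p 1 \<in> path_image q"
    using pp(3) qq(2) pathstart_in_path_image[of q] by (simp add: pathstart_def)
  then obtain t where t: "t \<in> {0..1}" "p t \<in> path_image q" "\<And>s. 0 \<le> s \<Longrightarrow> s < t \<Longrightarrow> p s \<notin> path_image q"
    using first_hit[OF cp closed_arc_image[OF qq(1)]] by auto
  then obtain u where u: "u \<in> {0..1}" "p t = q u" unfolding path_image_def by blast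
  have subp: "p ` closed_segment 0 t \<subseteq> path_image p"
    unfolding path_image_def by (intro image_mono closed_segment_01) (use t(1) in auto)
  have subq: "q ` closed_segment u 1 \<subseteq> path_image q"
    unfolding path_image_def by (intro image_mono closed_segment_01) (use u(1) in auto)
  \<comment> \<open>In the first two cases one of the two pieces degenerates to a point and the
    other one is the arc.\<close>
  consider "t = 0" | "u = 1" | "t \<noteq> 0" "u \<noteq> 1" by blast
  then show ?thesis
  proof cases
    case 1
    then have "u \<noteq> 1" using u(2) assms(3) pp(2) qq(3) by auto
    have "arc_le (q ` closed_segment u 1) l' a c (subarc u 1 q)"
      using arc_le_subarc[OF q u(1) _ \<open>u \<noteq> 1\<close>] 1 u(2) pp(2) qq(3) by simp
    from arc_le_mono[OF this, of "path_image p \<union> path_image q" "l + l'"]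
    show ?thesis using subq l0 by (intro that) auto
  next
    case 2
    then have "0 \<noteq> t" using u(2) assms(3) pp(2) qq(3) by auto
    have "arc_le (p ` closed_segment 0 t) l a c (subarc 0 t p)"
      using arc_le_subarc[OF p _ t(1) \<open>0 \<noteq> t\<close>] 2 u(2) pp(2) qq(3) by simp
    from arc_le_mono[OF this, of "path_image p \<union> path_image q" "l + l'"]
    show ?thesis using subp l0 by (intro that) auto
  next
    case 3
    have P: "arc_le (p ` closed_segment 0 t) l a (p t) (subarc 0 t p)"
      using arc_le_subarc[OF p _ t(1), of 0] 3 pp(2) by simp
    have Q: "arc_le (q ` closed_segment u 1) l' (p t) c (subarc u 1 q)"
      using arc_le_subarc[OF q u(1), of 1] 3 qq(3) u(2) by simp
    have "path_image (subarc 0 t p) \<inter> path_image (subarc u 1 q) \<subseteq> {p t}"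
    proof
      fix z assume z: "z \<in> path_image (subarc 0 t p) \<inter> path_image (subarc u 1 q)"
      then obtain s where s: "s \<in> closed_segment 0 t" "z = p s" by (auto simp: path_image_subarc)
      have "0 \<le> s" "s \<le> t" using s(1) t(1) by (auto simp: closed_segment_eq_real_ivl)
      moreover have "z \<in> path_image q" using z subq by (auto simp: path_image_subarc)
      ultimately have "s = t" using t(3)[of s] s(2) by fastforce
      then show "z \<in> {p t}" using s(2) by simp
    qed
    from arc_le_join[OF P Q this]
    have "arc_le (path_image (subarc 0 t p) \<union> path_image (subarc u 1 q)) (l + l') a c (subarc 0 t p +++ subarc u 1 q)" .
    moreover have "path_image (subarc 0 t p) \<union> path_image (subarc u 1 q) \<subseteq> path_image p \<union> path_image q"
      using subp subq unfolding path_image_subarc by blast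
    ultimately show ?thesis using arc_le_mono[OF _ _ order_refl] by (intro that) blast
  qed
qed

text \<open>The excursion of \<open>p\<close> away from \<open>q\<close> around \<open>m\<close>
  starts at the last hit of \<open>q\<close> before \<open>m\<close> and ends at the first hit after
  it. Its interior misses \<open>q\<close>, so the piece of \<open>q\<close> between its ends closes
  it to a simple loop.\<close>

lemma theta_loop:
  assumes p: "arc_le S l a b p" and q: "arc_le S' l' a b q"
    and m: "m \<in> path_image p" "m \<notin> path_image q"
  obtains \<gamma> where "simple_loop_le (path_image p \<union> path_image q) (l + l') \<gamma>" "m \<in> path_image \<gamma>"
proof -
  have pp: "arc p" "p 0 = a" "p 1 = b" "len_le p l" and qq: "arc q" "q 0 = a" "q 1 = b" "len_le q l'"
    using p q by (auto simp: arc_le_def pathstart_def pathfinish_def)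
  have cp: "continuous_on {0..1} p" using pp(1) by (simp add: arc_def path_def)
  obtain t where t: "t \<in> {0..1}" "m = p t" using m(1) unfolding path_image_def by blast
  have cq: "closed (path_image q)" using qq(1) by (rule closed_arc_image)
  have ends: "p 0 \<in> path_image q" "p 1 \<in> path_image q"
    using pp(2,3) qq(2,3) pathstart_in_path_image[of q] pathfinish_in_path_image[of q]
    by (simp_all add: pathstart_def pathfinish_def)
  obtain s1 where s1: "s1 \<in> {0..t}" "p s1 \<in> path_image q" "\<And>s. s1 < s \<Longrightarrow> s \<le> t \<Longrightarrow> p s \<notin> path_image q"
    by (rule last_hit[of 0 t p, OF _ cq _ ends(1)]) (use t(1) in \<open>auto intro: continuous_on_subset[OF cp]\<close>)
  obtain s2 where s2: "s2 \<in> {t..1}" "p s2 \<in> path_image q" "\<And>s. t \<le> s \<Longrightarrow> s < s2 \<Longrightarrow> p s \<notin> path_image q"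
    by (rule first_hit[of t 1 p, OF _ cq _ ends(2)]) (use t(1) in \<open>auto intro: continuous_on_subset[OF cp]\<close>)
  have lt: "s1 < t" "t < s2"
    using s1(1,2) s2(1,2) m(2) t(2) by (auto simp: less_le)
  have s01: "s1 \<in> {0..1}" "s2 \<in> {0..1}" using s1(1) s2(1) t(1) by auto
  obtain u v where u: "u \<in> {0..1}" "p s1 = q u" and v: "v \<in> {0..1}" "p s2 = q v"
    using s1(2) s2(2) unfolding path_image_def by blast
  have "p s1 \<noteq> p s2"
    using pp(1) s01 lt unfolding arc_def by (metis inj_onD less_trans less_irrefl)
  then have vu: "v \<noteq> u" using u v by auto
  have P: "arc_le (p ` closed_segment s1 s2) l (p s1) (p s2) (subarc s1 s2 p)"
    using arc_le_subarc[OF p s01] lt by simp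
  have Q: "arc_le (q ` closed_segment v u) l' (p s2) (p s1) (subarc v u q)"
    using arc_le_subarc[OF q v(1) u(1) vu] u v by simp
  have subq: "path_image (subarc v u q) \<subseteq> path_image q"
    using path_image_subarc_subset[OF v(1) u(1)] .
  have subp: "path_image (subarc s1 s2 p) \<subseteq> path_image p"
    using path_image_subarc_subset[OF s01] .
  have seg: "closed_segment s1 s2 = {s1..s2}" using lt by (simp add: closed_segment_eq_real_ivl)
  let ?g = "subarc s1 s2 p +++ subarc v u q"
  have "simple_path ?g"
  proof (rule simple_path_join_loop)
    show "path_image (subarc s1 s2 p) \<inter> path_image (subarc v u q) \<subseteq> {pathstart (subarc s1 s2 p), pathstart (subarc v u q)}"
    proof
      fix z assume z: "z \<in> path_image (subarc s1 s2 p) \<inter> path_image (subarc v u q)"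
      then obtain s where s: "s1 \<le> s" "s \<le> s2" "z = p s" by (auto simp: path_image_subarc seg)
      have "p s \<in> path_image q" using z subq s(3) by auto
      then have "s = s1 \<or> s = s2" using s1(3)[of s] s2(3)[of s] s by fastforce
      then show "z \<in> {pathstart (subarc s1 s2 p), pathstart (subarc v u q)}" using s(3) v by auto
    qed
  qed (use P Q u v in \<open>auto simp: arc_le_def\<close>)
  moreover have "path_image ?g = path_image (subarc s1 s2 p) \<union> path_image (subarc v u q)"
    using v by (simp add: path_image_join)
  moreover have "m \<in> path_image (subarc s1 s2 p)"
    using lt t(2) by (auto simp: path_image_subarc seg)
  moreover have "len_le ?g (l + l')"
    using P Q v by (intro len_le_join) (auto simp: arc_le_def)
  ultimately show ?thesis
    using subp subq u v by (intro that[of ?g]) (auto simp: simple_loop_le_def)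
qed

text \<open>Removing an interior parameter leaves two half-open pieces, and both contain the base
  point.\<close>

lemma simple_loop_minus_point_connected:
  assumes "simple_path \<gamma>" "pathfinish \<gamma> = pathstart \<gamma>"
  shows "connected (path_image \<gamma> - {w})"
proof (cases "w \<in> path_image \<gamma>")
  case False
  then show ?thesis using connected_simple_path_image[OF assms(1)] by simp
next
  case True
  then obtain t where t: "t \<in> {0..1}" "w = \<gamma> t" unfolding path_image_def by blast
  have cg: "continuous_on {0..1} \<gamma>" using assms(1) by (simp add: simple_path_def path_def)
  have inj: "s = r \<or> s = 0 \<and> r = 1 \<or> s = 1 \<and> r = 0" if "\<gamma> s = \<gamma> r" "s \<in> {0..1}" "r \<in> {0..1}" for s r
    using assms(1) that by (auto simp: simple_path_def loop_free_def)
  have e: "\<gamma> 0 = \<gamma> 1" using assms(2) by (simp add: pathstart_def pathfinish_def)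
  show ?thesis
  proof (cases "t = 0 \<or> t = 1")
    case True
    then have "path_image \<gamma> - {w} = path_image \<gamma> - {pathstart \<gamma>, pathfinish \<gamma>}"
      using t e by (auto simp: pathstart_def pathfinish_def)
    then show ?thesis using connected_simple_path_endless[OF assms(1)] by simp
  next
    case False
    then have t': "0 < t" "t < 1" using t(1) by auto
    have "path_image \<gamma> - {w} = \<gamma> ` {0..<t} \<union> \<gamma> ` {t<..1}"
    proof (intro equalityI subsetI)
      fix z assume "z \<in> path_image \<gamma> - {w}"
      then obtain s where "s \<in> {0..1}" "z = \<gamma> s" "s \<noteq> t" using t(2) unfolding path_image_def by blast
      then show "z \<in> \<gamma> ` {0..<t} \<union> \<gamma> ` {t<..1}" by (cases "s < t") auto
    next
      fix z assume "z \<in> \<gamma> ` {0..<t} \<union> \<gamma> ` {t<..1}"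
      then obtain s where "s \<in> {0..<t} \<union> {t<..1}" and z: "z = \<gamma> s" by blast
      then have s: "s \<in> {0..1}" "s \<noteq> t" "z = \<gamma> s" using t' by auto
      then have "z \<noteq> w" using inj[of s t] t t' by auto
      then show "z \<in> path_image \<gamma> - {w}" using s unfolding path_image_def by blast
    qed
    moreover have "connected (\<gamma> ` {0..<t})" "connected (\<gamma> ` {t<..1})"
      by (rule connected_continuous_image; use t' in \<open>auto intro: continuous_on_subset[OF cg]\<close>)+
    moreover have "\<gamma> 0 \<in> \<gamma> ` {0..<t}" using t' by (intro imageI) auto
    moreover have "\<gamma> 0 \<in> \<gamma> ` {t<..1}" unfolding e using t' by (intro imageI) auto
    ultimately show ?thesis by (metis IntI connected_Un empty_iff)
  qed
qed

section \<open>Geodesics\<close>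

text \<open>The metric interval. For distinct points of a geodesic space it is the union of all
  geodesics from \<open>p\<close> to \<open>q\<close>, of which there may be many
  (\<open>geodesic_arc_gseg\<close>, \<open>geodesic_arc_through\<close>).\<close>

definition gseg :: "'a::metric_space set \<Rightarrow> 'a \<Rightarrow> 'a \<Rightarrow> 'a set" where
  "gseg X p q = {m \<in> X. dist p m + dist m q = dist p q}"

lemma gsegD: "m \<in> gseg X p q \<Longrightarrow> m \<in> X" "m \<in> gseg X p q \<Longrightarrow> dist p m + dist m q = dist p q"
  by (auto simp: gseg_def)

lemma gseg_commute: "gseg X p q = gseg X q p"
  by (auto simp: gseg_def dist_commute add.commute)

lemma gseg_trans1:
  assumes "m \<in> gseg X p q" "n \<in> gseg X p m"
  shows "n \<in> gseg X p q" "m \<in> gseg X n q"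
proof -
  have "dist p m + dist m q = dist p q" "dist p n + dist n m = dist p m" "n \<in> X" "m \<in> X"
    using assms by (auto simp: gseg_def)
  moreover have "dist p q \<le> dist p n + dist n q" "dist n q \<le> dist n m + dist m q"
    by (rule dist_triangle)+
  ultimately show "n \<in> gseg X p q" "m \<in> gseg X n q" by (auto simp: gseg_def)
qed

lemma len_le_three:
  assumes "len_le r l" "0 \<le> a" "a \<le> b" "b \<le> 1"
  shows "dist (r 0) (r a) + dist (r a) (r b) + dist (r b) (r 1) \<le> l"
proof -
  from assms(1) obtain s :: "real \<Rightarrow> real" where s: "s 0 = 0" "s 1 \<le> l"
    "\<And>a b. 0 \<le> a \<Longrightarrow> a \<le> b \<Longrightarrow> b \<le> 1 \<Longrightarrow> dist (r a) (r b) \<le> s b - s a"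
    by (rule len_leE) blast
  show ?thesis using s(3)[of 0 a] s(3)[of a b] s(3)[of b 1] s(1,2) assms by linarith
qed

lemma geodesic_arc_gseg:
  assumes "arc_le X (dist p q) p q r"
  shows "path_image r \<subseteq> gseg X p q"
proof
  fix z assume z: "z \<in> path_image r"
  then obtain t where t: "t \<in> {0..1}" "z = r t" unfolding path_image_def by blast
  have "z \<in> X" using assms z by (auto simp: arc_le_def)
  moreover have "dist p z + dist z z + dist z q \<le> dist p q"
    using len_le_three[of r "dist p q" t t] assms t by (auto simp: arc_le_def pathstart_def pathfinish_def)
  ultimately show "z \<in> gseg X p q"
    using dist_triangle[of p q z] by (simp add: gseg_def)
qed

text \<open>The length \<open>dist p q\<close> leaves no slack in the triangle inequality, so the
  distance from \<open>p\<close> is an isometric coordinate along the arc.\<close>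

lemma geodesic_arc_dist_eq:
  assumes "arc_le X (dist p q) p q r" "z \<in> path_image r" "z' \<in> path_image r"
  shows "dist z z' = \<bar>dist p z - dist p z'\<bar>"
proof -
  have *: "dist (r a) (r b) = dist p (r b) - dist p (r a)" if ab: "0 \<le> a" "a \<le> b" "b \<le> 1" for a b
  proof -
    have "dist p (r a) + dist (r a) (r b) + dist (r b) q \<le> dist p q"
      using len_le_three[of r "dist p q" a b] assms(1) ab by (auto simp: arc_le_def pathstart_def pathfinish_def)
    moreover have "dist p q \<le> dist p (r b) + dist (r b) q" "dist p (r b) \<le> dist p (r a) + dist (r a) (r b)"
      by (rule dist_triangle)+
    ultimately show ?thesis by linarith
  qed
  obtain a b where ab: "a \<in> {0..1}" "b \<in> {0..1}" "z = r a" "z' = r b"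
    using assms(2,3) unfolding path_image_def by blast
  have sym: "dist (r a) (r b) = dist (r b) (r a)" by (rule dist_commute)
  show ?thesis
  proof (cases "a \<le> b")
    case True
    then show ?thesis using *[of a b] ab zero_le_dist[of "r a" "r b"] by simp
  next
    case False
    then show ?thesis using *[of b a] ab zero_le_dist[of "r b" "r a"] sym by simp
  qed
qed

lemma geodesic_arc_point:
  assumes "arc_le X (dist p q) p q r" "0 \<le> s" "s \<le> dist p q"
  obtains z where "z \<in> path_image r" "dist p z = s"
proof -
  have r: "path r" "r 0 = p" "r 1 = q"
    using assms(1) by (auto simp: arc_le_def arc_imp_path pathstart_def pathfinish_def)
  have "continuous_on {0..1} (\<lambda>t. dist p (r t))"
    using r(1) unfolding path_def by (intro continuous_intros)
  then obtain t where "0 \<le> t" "t \<le> 1" "dist p (r t) = s"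
    using IVT'[of "\<lambda>t. dist p (r t)" 0 s 1] assms r by auto
  then show ?thesis by (intro that[of "r t"]) (auto simp: path_image_def)
qed

lemma geodesic_arc_ordered:
  assumes "arc_le X (dist p q) p q r" "z \<in> path_image r" "z' \<in> path_image r" "dist p z \<le> dist p z'"
  shows "z \<in> gseg X p z'"
proof -
  have "z \<in> X" using assms by (auto simp: arc_le_def)
  then show ?thesis using geodesic_arc_dist_eq[OF assms(1-3)] assms(4) by (simp add: gseg_def)
qed

text \<open>A shortest path may pause and then is not injective. Its points are determined by their
  distance from \<open>p\<close>, so choosing one parameter \<open>\<tau> s\<close> for each
  distance gives a map that is isometric up to scaling; the choice itself need not be
  continuous.\<close>

lemma geodesic_arc_exists:
  assumes "geodesic_space X" "p \<in> X" "q \<in> X" "p \<noteq> q"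
  obtains r where "arc_le X (dist p q) p q r"
proof -
  let ?D = "dist p q"
  have D: "0 < ?D" using assms(4) by simp
  obtain \<gamma> where \<gamma>: "\<gamma> \<in> paths_between X p q" "path_length \<gamma> = ennreal ?D"
    using assms unfolding geodesic_space_def by blast
  then have g: "path \<gamma>" "path_image \<gamma> \<subseteq> X" "\<gamma> 0 = p" "\<gamma> 1 = q"
    by (auto simp: paths_between_def pathstart_def pathfinish_def)
  have "len_le \<gamma> ?D" using \<gamma>(2) by (intro path_length_imp_len_le) auto
  define u where "u = (\<lambda>t. dist p (\<gamma> t))"
  have *: "dist (\<gamma> a) (\<gamma> b) = u b - u a" if ab: "0 \<le> a" "a \<le> b" "b \<le> 1" for a b
  proof -
    have "dist p (\<gamma> a) + dist (\<gamma> a) (\<gamma> b) + dist (\<gamma> b) q \<le> ?D"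
      using len_le_three[OF \<open>len_le \<gamma> ?D\<close> ab] g by simp
    moreover have "?D \<le> dist p (\<gamma> b) + dist (\<gamma> b) q" "dist p (\<gamma> b) \<le> dist p (\<gamma> a) + dist (\<gamma> a) (\<gamma> b)"
      by (rule dist_triangle)+
    ultimately show ?thesis unfolding u_def by linarith
  qed
  have iso: "dist (\<gamma> a) (\<gamma> b) = \<bar>u a - u b\<bar>" if "a \<in> {0..1}" "b \<in> {0..1}" for a b
  proof (cases "a \<le> b")
    case True
    then show ?thesis using *[of a b] that zero_le_dist[of "\<gamma> a" "\<gamma> b"] by simp
  next
    case False
    then show ?thesis
      using *[of b a] that zero_le_dist[of "\<gamma> b" "\<gamma> a"] dist_commute[of "\<gamma> a" "\<gamma> b"] by simp
  qed
  have "continuous_on {0..1} u" unfolding u_def using g(1) by (auto simp: path_def intro!: continuous_intros)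
  then have "\<exists>t\<in>{0..1}. u t = s * ?D" if "s \<in> {0..1}" for s
    using IVT'[of u 0 "s * ?D" 1] that g D by (auto simp: u_def mult_le_cancel_right1)
  then obtain \<tau> where \<tau>: "\<And>s. s \<in> {0..1} \<Longrightarrow> \<tau> s \<in> {0..1}" "\<And>s. s \<in> {0..1} \<Longrightarrow> u (\<tau> s) = s * ?D"
    by metis
  define r where "r = (\<lambda>s. \<gamma> (\<tau> s))"
  have dr: "dist (r a) (r b) = ?D * \<bar>a - b\<bar>" if "a \<in> {0..1}" "b \<in> {0..1}" for a b
  proof -
    have "dist (r a) (r b) = \<bar>a * ?D - b * ?D\<bar>" unfolding r_def using iso \<tau> that by simp
    also have "\<dots> = ?D * \<bar>a - b\<bar>" using D by (simp add: abs_mult mult.commute flip: left_diff_distrib)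
    finally show ?thesis .
  qed
  have "?D-lipschitz_on {0..1} r" using dr by (simp add: lipschitz_on_def dist_real_def)
  then have "path r" unfolding path_def by (rule lipschitz_on_continuous_on)
  moreover have "inj_on r {0..1}"
  proof (rule inj_onI)
    fix a b assume "a \<in> {0..1}" "b \<in> {0..1}" "r a = r b"
    then show "a = b" using dr[of a b] D by simp
  qed
  moreover have "len_le r ?D" using dr by (intro len_le_lipschitz) simp
  moreover have "r ` {0..1} \<subseteq> X" using g(2) \<tau>(1) by (auto simp: r_def path_image_def)
  moreover have "r 0 = p"
    using \<tau>(2)[of 0] by (simp add: r_def u_def)
  moreover have "r 1 = q"
  proof -
    have "dist (r 1) (\<gamma> 1) = 0"
      using iso[of "\<tau> 1" 1] \<tau>[of 1] g unfolding r_def by (simp add: u_def)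
    then show ?thesis using g by simp
  qed
  ultimately show ?thesis
    by (intro that[of r]) (simp add: arc_le_def arc_def path_image_def pathstart_def pathfinish_def)
qed

text \<open>Geodesics from \<open>p\<close> to \<open>m\<close> and from \<open>m\<close> to
  \<open>q\<close> are concatenated; a second common point would give a shortcut.\<close>

lemma geodesic_arc_through:
  assumes "geodesic_space X" "m \<in> gseg X p q" "p \<in> X" "q \<in> X" "p \<noteq> q"
  obtains r where "arc_le X (dist p q) p q r" "m \<in> path_image r"
proof -
  have m: "m \<in> X" "dist p m + dist m q = dist p q" using assms(2) by (auto simp: gseg_def)
  consider "m = p" | "m = q" | "m \<noteq> p" "m \<noteq> q" by blast
  then show ?thesis
  proof cases
    case 3
    obtain r1 where r1: "arc_le X (dist p m) p m r1"
      using geodesic_arc_exists[OF assms(1,3) m(1)] 3 by metis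
    obtain r2 where r2: "arc_le X (dist m q) m q r2"
      using geodesic_arc_exists[OF assms(1) m(1) assms(4)] 3 by metis
    have "path_image r1 \<inter> path_image r2 \<subseteq> {m}"
    proof
      fix z assume z: "z \<in> path_image r1 \<inter> path_image r2"
      then have "z \<in> gseg X p m" "z \<in> gseg X m q"
        using geodesic_arc_gseg[OF r1] geodesic_arc_gseg[OF r2] by auto
      then have "dist p z + dist z m = dist p m" "dist m z + dist z q = dist m q"
        by (auto simp: gseg_def)
      moreover have "dist p q \<le> dist p z + dist z q" by (rule dist_triangle)
      ultimately have "dist z m = 0"
        using m(2) zero_le_dist[of z m] dist_commute[of m z] by linarith
      then show "z \<in> {m}" by simp
    qed
    from arc_le_join[OF r1 r2 this]
    have j: "arc_le (path_image r1 \<union> path_image r2) (dist p m + dist m q) p q (r1 +++ r2)" .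
    have s: "path_image r1 \<union> path_image r2 \<subseteq> X" using r1 r2 by (auto simp: arc_le_def)
    have "arc_le X (dist p q) p q (r1 +++ r2)" using arc_le_mono[OF j s] m(2) by simp
    moreover have "m \<in> path_image (r1 +++ r2)"
      using arc_le_image(3)[OF r1] r1 r2 by (subst path_image_join) (auto simp: arc_le_def)
    ultimately show ?thesis by (rule that)
  next
    case 1
    obtain r where r: "arc_le X (dist p q) p q r" using geodesic_arc_exists[OF assms(1,3,4,5)] .
    show ?thesis using that[OF r] arc_le_image(2)[OF r] 1 by simp
  next
    case 2
    obtain r where r: "arc_le X (dist p q) p q r" using geodesic_arc_exists[OF assms(1,3,4,5)] .
    show ?thesis using that[OF r] arc_le_image(3)[OF r] 2 by simp
  qed
qed

lemma geodesic_point: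
  assumes "geodesic_space X" "p \<in> X" "q \<in> X" "0 \<le> s" "s \<le> dist p q"
  obtains z where "z \<in> gseg X p q" "dist p z = s"
proof (cases "p = q")
  case True
  then show ?thesis using assms that[of p] by (auto simp: gseg_def)
next
  case False
  obtain r where "arc_le X (dist p q) p q r" using geodesic_arc_exists[OF assms(1-3) False] .
  moreover from geodesic_arc_point[OF this assms(4,5)] obtain z where "z \<in> path_image r" "dist p z = s" .
  ultimately show ?thesis using that[of z] geodesic_arc_gseg[of X p q r] by blast
qed

section \<open>Deformations along geodesics\<close>

text \<open>The closed graph theorem for a compact range: a subsequence of values staying away from
  \<open>f a\<close> would have a limit point in \<open>T\<close>, which the graph condition
  identifies as \<open>f a\<close>.\<close>

lemma continuous_on_compact_graph:
  fixes f :: "'a::metric_space \<Rightarrow> 'b::metric_space"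
  assumes "compact T" "f \<in> S \<rightarrow> T"
    and graph: "\<And>u x y. (\<And>n. u n \<in> S) \<Longrightarrow> x \<in> S \<Longrightarrow> u \<longlonglongrightarrow> x \<Longrightarrow> y \<in> T \<Longrightarrow> (\<lambda>n. f (u n)) \<longlonglongrightarrow> y \<Longrightarrow> y = f x"
  shows "continuous_on S f"
  unfolding continuous_on_sequentially
proof (intro allI ballI impI)
  fix u a assume a: "a \<in> S" and u: "(\<forall>n. u n \<in> S) \<and> u \<longlonglongrightarrow> a"
  show "(f \<circ> u) \<longlonglongrightarrow> f a"
  proof (rule ccontr)
    assume "\<not> (f \<circ> u) \<longlonglongrightarrow> f a"
    then obtain e where e: "e > 0" "\<And>N. \<exists>n\<ge>N. e \<le> dist (f (u n)) (f a)"
      unfolding lim_sequentially by (force simp: not_less)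
    then have "infinite {n. e \<le> dist (f (u n)) (f a)}"
      unfolding infinite_nat_iff_unbounded_le by auto
    then obtain r :: "nat \<Rightarrow> nat" where r: "strict_mono r" "\<And>n. e \<le> dist (f (u (r n))) (f a)"
      using infinite_enumerate by blast
    have "\<forall>n. f (u (r n)) \<in> T" using assms(2) u by auto
    then obtain y s where s: "y \<in> T" "strict_mono (s :: nat \<Rightarrow> nat)" "((\<lambda>n. f (u (r n))) \<circ> s) \<longlonglongrightarrow> y"
      using assms(1) unfolding compact_def by meson
    have lim: "(\<lambda>n. f (u (r (s n)))) \<longlonglongrightarrow> y" using s(3) by (simp add: o_def)
    have "(u \<circ> r) \<longlonglongrightarrow> a" using u r(1) by (intro LIMSEQ_subseq_LIMSEQ) auto
    then have "((u \<circ> r) \<circ> s) \<longlonglongrightarrow> a" using s(2) by (rule LIMSEQ_subseq_LIMSEQ)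
    then have "y = f a"
      using u a s(1) lim by (intro graph[of "\<lambda>n. u (r (s n))"]) (auto simp: o_def)
    then have "\<exists>N. \<forall>n\<ge>N. dist (f (u (r (s n)))) (f a) < e"
      using lim e(1) unfolding lim_sequentially by blast
    then show False using r(2) by (meson not_less order_refl)
  qed
qed

lemma nearest_point_exists:
  fixes K :: "'a::metric_space set"
  assumes "compact K" "K \<noteq> {}"
  obtains k where "k \<in> K" "dist x k = infdist x K"
proof -
  have "continuous_on K (\<lambda>k. dist x k)" by (intro continuous_intros)
  from continuous_attains_inf[OF assms this]
  obtain k where k: "k \<in> K" "\<forall>y\<in>K. dist x k \<le> dist x y" by blast
  then have "dist x k \<le> infdist x K"
    using assms(2) by (simp add: infdist_def cINF_greatest)
  then show ?thesis using k(1) infdist_le[OF k(1), of x] by (intro that) auto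
qed

text \<open>The deformation moves each point along its geodesic to \<open>K\<close>. It is continuous because its graph
  is closed and its range is compact.\<close>

lemma geodesic_deformation:
  fixes X :: "'a::metric_space set"
  assumes X: "compact X" "geodesic_space X" and K: "compact K" "K \<subseteq> X" "K \<noteq> {}"
    and uniq: "\<And>x k k' y y'. x \<in> X \<Longrightarrow> k \<in> K \<Longrightarrow> k' \<in> K \<Longrightarrow> dist x k = infdist x K \<Longrightarrow> dist x k' = infdist x K \<Longrightarrow>
       y \<in> gseg X x k \<Longrightarrow> y' \<in> gseg X x k' \<Longrightarrow> dist x y = dist x y' \<Longrightarrow> y = y'"
  obtains H :: "real \<times> 'a \<Rightarrow> 'a" where "continuous_on ({0..1} \<times> X) H" "H \<in> {0..1} \<times> X \<rightarrow> X"
    "\<And>x. x \<in> X \<Longrightarrow> H (0, x) = x" "\<And>x. x \<in> X \<Longrightarrow> H (1, x) \<in> K"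
    "\<And>x. x \<in> X \<Longrightarrow> dist x (H (1, x)) = infdist x K" "\<And>t k. t \<in> {0..1} \<Longrightarrow> k \<in> K \<Longrightarrow> H (t, k) = k"
proof -
  \<comment> \<open>\<open>y\<close> divides a geodesic from \<open>x\<close> to a nearest point
    \<open>k\<close> in the proportion \<open>t : 1 - t\<close>. Written as equations between
    distances, the relation passes to limits.\<close>
  define R where "R = (\<lambda>t x y k. dist x k = infdist x K \<and> dist x y = t * infdist x K \<and> dist y k = (1 - t) * infdist x K)"
  define P where "P = (\<lambda>t x y. y \<in> X \<and> (\<exists>k\<in>K. R t x y k))"
  have Rb: "y \<in> gseg X x k" if "R t x y k" "y \<in> X" for t x y k
    using that by (simp add: R_def gseg_def algebra_simps)
  have ex: "\<exists>y. P t x y" if tx: "t \<in> {0..1}" "x \<in> X" for t x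
  proof -
    obtain k where k: "k \<in> K" "dist x k = infdist x K" using nearest_point_exists[OF K(1,3)] .
    have i0: "0 \<le> infdist x K" by (rule infdist_nonneg)
    have "t * infdist x K \<le> 1 * infdist x K" using i0 tx(1) by (intro mult_right_mono) auto
    then obtain y where y: "y \<in> gseg X x k" "dist x y = t * infdist x K"
      using geodesic_point[OF X(2) tx(2), of k "t * infdist x K"] k K(2) i0 tx(1) by auto
    then have "R t x y k" using k(2) by (simp add: R_def gseg_def algebra_simps)
    then show ?thesis using y(1) k(1) by (auto simp: P_def gseg_def)
  qed
  have un: "y = y'" if xy: "x \<in> X" "P t x y" "P t x y'" for t x y y'
  proof -
    obtain k k' where k: "k \<in> K" "R t x y k" "y \<in> X" and k': "k' \<in> K" "R t x y' k'" "y' \<in> X"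
      using xy(2,3) by (auto simp: P_def)
    show ?thesis
      by (rule uniq[OF xy(1) k(1) k'(1) _ _ Rb[OF k(2,3)] Rb[OF k'(2,3)]])
         (use k(2) k'(2) in \<open>auto simp: R_def\<close>)
  qed
  define H where "H = (\<lambda>(t, x). SOME y. P t x y)"
  have HP: "P t x (H (t, x))" if "t \<in> {0..1}" "x \<in> X" for t x
    using someI_ex[OF ex[OF that]] by (simp add: H_def)
  have H_eq: "H (t, x) = y" if "t \<in> {0..1}" "x \<in> X" "P t x y" for t x y
    using un[OF that(2) HP[OF that(1,2)] that(3)] .
  have HX: "H \<in> {0..1} \<times> X \<rightarrow> X" using HP by (auto simp: P_def)
  show ?thesis
  proof (rule that)
    show "H \<in> {0..1} \<times> X \<rightarrow> X" by (fact HX)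
    show "continuous_on ({0..1} \<times> X) H"
    proof (rule continuous_on_compact_graph[OF X(1) HX])
      fix u p y assume u: "\<And>n. u n \<in> {0..1} \<times> X" and p: "p \<in> {0..1} \<times> X" and lim: "u \<longlonglongrightarrow> p"
        and y: "y \<in> X" and Hlim: "(\<lambda>n. H (u n)) \<longlonglongrightarrow> y"
      have "\<forall>n. \<exists>k\<in>K. R (fst (u n)) (snd (u n)) (H (u n)) k"
      proof
        fix n
        have "fst (u n) \<in> {0..1}" "snd (u n) \<in> X" using u[of n] by auto
        from HP[OF this] show "\<exists>k\<in>K. R (fst (u n)) (snd (u n)) (H (u n)) k"
          by (auto simp: P_def)
      qed
      then obtain k where k: "\<And>n. k n \<in> K" "\<And>n. R (fst (u n)) (snd (u n)) (H (u n)) (k n)" by metis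
      \<comment> \<open>The accompanying nearest points need not converge, but a subsequence does,
        and its limit is again a nearest point.\<close>
      obtain l r where r: "l \<in> K" "strict_mono (r :: nat \<Rightarrow> nat)" "(k \<circ> r) \<longlonglongrightarrow> l"
        using K(1) k(1) unfolding compact_def by meson
      have lu: "(\<lambda>n. u (r n)) \<longlonglongrightarrow> p" using LIMSEQ_subseq_LIMSEQ[OF lim r(2)] by (simp add: o_def)
      have lH: "(\<lambda>n. H (u (r n))) \<longlonglongrightarrow> y" using LIMSEQ_subseq_LIMSEQ[OF Hlim r(2)] by (simp add: o_def)
      have lk: "(\<lambda>n. k (r n)) \<longlonglongrightarrow> l" using r(3) by (simp add: o_def)
      have lt: "(\<lambda>n. fst (u (r n))) \<longlonglongrightarrow> fst p" and lx: "(\<lambda>n. snd (u (r n))) \<longlonglongrightarrow> snd p"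
        using lu by (auto intro: tendsto_fst tendsto_snd)
      have li: "(\<lambda>n. infdist (snd (u (r n))) K) \<longlonglongrightarrow> infdist (snd p) K"
        by (intro tendsto_intros lx)
      have "dist (snd p) l = infdist (snd p) K"
      proof (rule LIMSEQ_unique)
        show "(\<lambda>n. dist (snd (u (r n))) (k (r n))) \<longlonglongrightarrow> dist (snd p) l" by (intro tendsto_intros lx lk)
        show "(\<lambda>n. dist (snd (u (r n))) (k (r n))) \<longlonglongrightarrow> infdist (snd p) K"
          using k(2) li by (simp add: R_def)
      qed
      moreover have "dist (snd p) y = fst p * infdist (snd p) K"
      proof (rule LIMSEQ_unique)
        show "(\<lambda>n. dist (snd (u (r n))) (H (u (r n)))) \<longlonglongrightarrow> dist (snd p) y" by (intro tendsto_intros lx lH)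
        show "(\<lambda>n. dist (snd (u (r n))) (H (u (r n)))) \<longlonglongrightarrow> fst p * infdist (snd p) K"
          using k(2) tendsto_mult[OF lt li] by (simp add: R_def)
      qed
      moreover have "dist y l = (1 - fst p) * infdist (snd p) K"
      proof (rule LIMSEQ_unique)
        show "(\<lambda>n. dist (H (u (r n))) (k (r n))) \<longlonglongrightarrow> dist y l" by (intro tendsto_intros lk lH)
        show "(\<lambda>n. dist (H (u (r n))) (k (r n))) \<longlonglongrightarrow> (1 - fst p) * infdist (snd p) K"
          using k(2) tendsto_mult[OF tendsto_diff[OF tendsto_const[of 1] lt] li] by (simp add: R_def)
      qed
      ultimately have "P (fst p) (snd p) y" using y r(1) by (auto simp: P_def R_def)
      then show "y = H p" using H_eq[of "fst p" "snd p" y] p by auto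
    qed
    show "H (0, x) = x" if "x \<in> X" for x
    proof (rule H_eq)
      obtain k where "k \<in> K" "dist x k = infdist x K" using nearest_point_exists[OF K(1,3)] .
      then show "P 0 x x" using that by (auto simp: P_def R_def)
    qed (use that in auto)
    show 1: "H (1, x) \<in> K" "dist x (H (1, x)) = infdist x K" if "x \<in> X" for x
      using HP[of 1 x] that by (auto simp: P_def R_def)
    show "H (t, k) = k" if "t \<in> {0..1}" "k \<in> K" for t k
    proof (rule H_eq)
      have "infdist k K = 0" using that(2) by simp
      then show "P t k k" using that K(2) by (auto simp: P_def R_def)
    qed (use that K(2) in auto)
  qed
qed

section \<open>Dendritic branches and the core\<close>

lemma connected_subset_clopen:
  assumes "connected S" "S \<subseteq> X" "openin (top_of_set X) W" "closed (insert w W)" "w \<notin> S" "S \<inter> W \<noteq> {}"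
  shows "S \<subseteq> W"
proof -
  obtain T where "open T" "W = X \<inter> T" using assms(3) unfolding openin_open by blast
  moreover from this have "S \<inter> W = S \<inter> T" using assms(2) by blast
  ultimately have "openin (top_of_set S) (S \<inter> W)" by (simp add: openin_open_Int)
  moreover have "closedin (top_of_set S) (S \<inter> insert w W)"
    using assms(4) by (simp add: closedin_closed_Int)
  moreover have "S \<inter> insert w W = S \<inter> W" using assms(5) by blast
  ultimately have "S \<inter> W = {} \<or> S \<inter> W = S"
    using assms(1) unfolding connected_clopen by simp
  then show ?thesis using assms(6) by blast
qed

text \<open>Openness of \<open>W\<close> and closedness of \<open>W \<union> {w}\<close> say that \<open>W\<close> is clopen in \<open>X - {w}\<close>.\<close>

definition branch :: "'a::metric_space set \<Rightarrow> 'a \<Rightarrow> 'a set \<Rightarrow> bool" where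
  "branch X w W \<longleftrightarrow> w \<in> X \<and> w \<notin> W \<and> openin (top_of_set X) W \<and> closed (insert w W) \<and>
     (\<forall>l \<gamma>. \<not> simple_loop_le (insert w W) l \<gamma>)"

definition core :: "'a::metric_space set \<Rightarrow> 'a set" where
  "core X = X - \<Union>{W. \<exists>w. branch X w W}"

lemma core_subset: "core X \<subseteq> X"
  by (auto simp: core_def)

lemma not_in_coreE:
  assumes "x \<in> X" "x \<notin> core X"
  obtains w W where "branch X w W" "x \<in> W"
  using assms by (auto simp: core_def)

lemma branch_disjoint_core: "branch X w W \<Longrightarrow> z \<in> W \<Longrightarrow> z \<notin> core X"
  by (auto simp: core_def)

lemma branch_subset: "branch X w W \<Longrightarrow> W \<subseteq> X"
  unfolding branch_def by (metis openin_imp_subset)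

lemma compact_core:
  assumes "compact X"
  shows "compact (core X)"
proof -
  have "openin (top_of_set X) (\<Union>{W. \<exists>w. branch X w W})"
    by (rule openin_Union) (auto simp: branch_def)
  then have "closed (core X)" unfolding core_def by (rule closed_diff_openin[OF assms])
  then show ?thesis using compact_Int_closed[OF assms] core_subset by (metis inf.absorb2)
qed

lemma connected_meets_root:
  assumes "branch X w W" "connected C" "C \<subseteq> X" "z \<in> C" "z \<in> W" "k \<in> C" "k \<notin> W"
  shows "w \<in> C"
proof (rule ccontr)
  assume "w \<notin> C"
  then have "C \<subseteq> W" using assms by (intro connected_subset_clopen[of C X W w]) (auto simp: branch_def)
  then show False using assms by blast
qed

text \<open>A loop minus the root of a branch is still connected. If it met the branch, it would lie
  inside it, and the loop would lie in the branch together with its root, which is excluded.\<close>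

lemma simple_loop_in_core:
  assumes "simple_loop_le X l \<gamma>"
  shows "path_image \<gamma> \<subseteq> core X"
proof
  fix x assume x: "x \<in> path_image \<gamma>"
  have gX: "path_image \<gamma> \<subseteq> X" using assms by (simp add: simple_loop_le_def)
  show "x \<in> core X"
  proof (rule ccontr)
    assume "x \<notin> core X"
    then obtain w W where W: "branch X w W" "x \<in> W" using not_in_coreE x gX by blast
    have "connected (path_image \<gamma> - {w})"
      using assms by (intro simple_loop_minus_point_connected) (auto simp: simple_loop_le_def)
    then have "path_image \<gamma> - {w} \<subseteq> W"
      using W x gX by (intro connected_subset_clopen[of _ X W w]) (auto simp: branch_def)
    then have "simple_loop_le (insert w W) l \<gamma>" using assms by (auto simp: simple_loop_le_def)
    then show False using W(1) by (auto simp: branch_def)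
  qed
qed

section \<open>Uniqueness of geodesics to the core\<close>

lemma gseg_trans2:
  assumes "z \<in> gseg X p q" "w \<in> gseg X z q"
  shows "w \<in> gseg X p q" "z \<in> gseg X p w"
  using gseg_trans1[of z X q p w] assms by (auto simp: gseg_commute)

lemma compact_gseg:
  assumes "compact X"
  shows "compact (gseg X p q)"
proof -
  have "closed {m. dist p m + dist m q = dist p q}"
    by (intro closed_Collect_eq continuous_intros)
  then have "compact (X \<inter> {m. dist p m + dist m q = dist p q})"
    using assms by (rule compact_Int_closed[rotated])
  then show ?thesis by (simp add: gseg_def Int_def)
qed

lemma geodesic_arc_unique_point:
  assumes "arc_le X (dist p q) p q r" "z \<in> path_image r" "z' \<in> path_image r" "dist p z = dist p z'"
  shows "z = z'"
  using geodesic_arc_dist_eq[OF assms(1-3)] assms(4) by simp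

text \<open>On a geodesic through \<open>y'\<close> the distance from \<open>p\<close> determines
  the point, so this geodesic misses \<open>y\<close>, and \<open>theta_loop\<close>
  applies.\<close>

lemma geodesic_bigon_loop:
  assumes "geodesic_space X" "p \<in> X" "q \<in> X" "y \<in> gseg X p q" "y' \<in> gseg X p q"
    "dist p y = dist p y'" "y \<noteq> y'"
  obtains \<gamma> where "simple_loop_le X (2 * dist p q) \<gamma>" "y \<in> path_image \<gamma>"
proof -
  have "p \<noteq> q"
  proof
    assume "p = q"
    then have "dist p y = 0" "dist p y' = 0" using assms(4,5) by (auto simp: gseg_def dist_commute)
    then show False using assms(7) by simp
  qed
  obtain r where r: "arc_le X (dist p q) p q r" "y \<in> path_image r"
    using geodesic_arc_through[OF assms(1,4,2,3) \<open>p \<noteq> q\<close>] .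
  obtain r' where r': "arc_le X (dist p q) p q r'" "y' \<in> path_image r'"
    using geodesic_arc_through[OF assms(1,5,2,3) \<open>p \<noteq> q\<close>] .
  have "y \<notin> path_image r'" using geodesic_arc_unique_point[OF r'(1) _ r'(2) assms(6)] assms(7) by blast
  from theta_loop[OF r(1) r'(1) r(2) this] obtain \<gamma> where
    "simple_loop_le (path_image r \<union> path_image r') (dist p q + dist p q) \<gamma>" "y \<in> path_image \<gamma>" .
  then show ?thesis
    using r(1) r'(1) by (intro that[of \<gamma>]) (auto simp: arc_le_def elim!: simple_loop_le_mono)
qed

text \<open>At a last common point of two geodesics to the core both run through the root of a branch
  containing that point, so either they meet again or they bound a simple loop outside the core.\<close>

lemma geodesic_to_core_unique:
  assumes X: "compact X" "geodesic_space X" and x: "x \<in> X" and k: "k \<in> core X" "k' \<in> core X"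
    and d: "dist x k = infdist x (core X)" "dist x k' = infdist x (core X)"
    and y: "y \<in> gseg X x k" "y' \<in> gseg X x k'" "dist x y = dist x y'"
  shows "y = y'"
proof (rule ccontr)
  assume ne: "y \<noteq> y'"
  have kX: "k \<in> X" "k' \<in> X" using k core_subset by blast+
  \<comment> \<open>Common points of geodesics to \<open>y\<close> and to \<open>y'\<close>; a
    farthest one, \<open>z\<close>, is where they part.\<close>
  let ?Z = "gseg X x y \<inter> gseg X x y'"
  have "compact ?Z" using compact_gseg[OF X(1)] by (intro compact_Int) auto
  moreover have "x \<in> ?Z" using x by (simp add: gseg_def)
  moreover have "continuous_on ?Z (\<lambda>z. dist x z)" by (intro continuous_intros)
  ultimately obtain z where z: "z \<in> ?Z" "\<And>v. v \<in> ?Z \<Longrightarrow> dist x v \<le> dist x z"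
    using continuous_attains_sup[of ?Z "\<lambda>z. dist x z"] by blast
  have zX: "z \<in> X" using z(1) by (auto simp: gseg_def)
  have dz: "dist x z + dist z y = dist x y" "dist x z + dist z y' = dist x y'" using z(1) by (auto simp: gseg_def)
  have zy: "dist z y = dist z y'" using dz y(3) by simp
  have "0 < dist z y"
  proof (rule ccontr)
    assume "\<not> 0 < dist z y"
    then have "dist z y = 0" "dist z y' = 0" using zy by auto
    then show False using ne by simp
  qed
  have yk: "dist x y + dist y k = dist x k" "dist x y' + dist y' k' = dist x k'"
    using y(1,2) by (auto simp: gseg_def)
  have out: "v \<notin> core X" if "dist x v < dist x k" for v
    using infdist_le[of v "core X" x] that d(1) by auto
  have "z \<notin> core X"
    using out[of z] dz(1) \<open>0 < dist z y\<close> yk(1) zero_le_dist[of y k] by linarith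
  then obtain w W where W: "branch X w W" "z \<in> W" using not_in_coreE zX by blast
  have kW: "k \<notin> W" "k' \<notin> W" using branch_disjoint_core[OF W(1)] k by blast+
  have wz: "w \<noteq> z" using W by (auto simp: branch_def)
  \<comment> \<open>A geodesic from \<open>z\<close> that leaves \<open>W\<close> passes through the
    root; a point \<open>v\<close> on it comes after \<open>w\<close> or before it.\<close>
  have root: "(w \<in> gseg X z v \<and> w \<in> gseg X z a) \<or> (v \<in> gseg X z w \<and> dist z v < dist z w)"
    and root2: "w \<in> gseg X z a"
    if a: "a \<in> X" "a \<notin> W" "v \<in> gseg X z a" for a v
  proof -
    have "z \<noteq> a" using W(2) a(2) by blast
    obtain r where r: "arc_le X (dist z a) z a r" "v \<in> path_image r"
      using geodesic_arc_through[OF X(2) a(3) zX a(1) \<open>z \<noteq> a\<close>] .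
    have w: "w \<in> path_image r"
      using connected_meets_root[OF W(1) arc_le_image(6,1)[OF r(1)] arc_le_image(2)[OF r(1)] W(2) arc_le_image(3)[OF r(1)] a(2)] .
    show "w \<in> gseg X z a" using w geodesic_arc_gseg[OF r(1)] by blast
    then show "(w \<in> gseg X z v \<and> w \<in> gseg X z a) \<or> (v \<in> gseg X z w \<and> dist z v < dist z w)"
      using geodesic_arc_ordered[OF r(1) w r(2)] geodesic_arc_ordered[OF r(1) r(2) w] by linarith
  qed
  have zyk: "y \<in> gseg X z k" "y' \<in> gseg X z k'"
    using gseg_trans1(2)[OF y(1)] gseg_trans1(2)[OF y(2)] z(1) by auto
  show False
  proof (cases "dist z w \<le> dist z y")
    \<comment> \<open>The root would be a common point farther from \<open>x\<close> than
      \<open>z\<close>.\<close>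
    case True
    have "w \<in> gseg X z y" "w \<in> gseg X z y'"
      using root[OF kX(1) kW(1) zyk(1)] root[OF kX(2) kW(2) zyk(2)] True zy by auto
    then have "w \<in> ?Z" "z \<in> gseg X x w" using gseg_trans2[of z X x y w] gseg_trans2[of z X x y' w] z(1) by auto
    then have "dist x z + dist z w \<le> dist x z" using z(2)[of w] by (simp add: gseg_def)
    then show False using wz by simp
  next
    \<comment> \<open>Here \<open>y\<close> and \<open>y'\<close> both lie between \<open>z\<close>
      and \<open>w\<close> and span a bigon. Its loop puts \<open>y\<close> into the core, closer to
      \<open>x\<close> than the nearest point \<open>k\<close>.\<close>
    case False
    have "y \<in> gseg X z w" "y' \<in> gseg X z w"
    proof -
      have "\<not> w \<in> gseg X z y" "\<not> w \<in> gseg X z y'"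
        using False zy zero_le_dist[of w y] zero_le_dist[of w y'] unfolding gseg_def by fastforce+
      then show "y \<in> gseg X z w" "y' \<in> gseg X z w"
        using root[OF kX(1) kW(1) zyk(1)] root[OF kX(2) kW(2) zyk(2)] by auto
    qed
    then obtain \<gamma> where \<gamma>: "simple_loop_le X (2 * dist z w) \<gamma>" "y \<in> path_image \<gamma>"
      using geodesic_bigon_loop[OF X(2) zX _ _ _ zy ne] W(1) by (auto simp: branch_def)
    then have "y \<in> core X" using simple_loop_in_core by blast
    moreover have "dist x y < dist x k"
    proof -
      have "dist z w + dist w k = dist z k" using root2[OF kX(1) kW(1) zyk(1)] by (simp add: gseg_def)
      moreover have "dist z y + dist y k = dist z k" using zyk(1) by (simp add: gseg_def)
      ultimately show ?thesis using False dz(1) yk(1) zero_le_dist[of w k] by linarith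
    qed
    ultimately show False using out by blast
  qed
qed

section \<open>From deformations to homotopies\<close>

lemma homotopic_with_of_deformation:
  fixes X :: "'a::topological_space set"
  assumes H: "continuous_on ({0..1} \<times> X) H" "H \<in> {0..1} \<times> X \<rightarrow> X"
    "\<And>x. x \<in> X \<Longrightarrow> H (0::real, x) = x" and A: "A \<subseteq> X" "\<And>t a. t \<in> {0..1} \<Longrightarrow> a \<in> A \<Longrightarrow> H (t, a) = a"
    and g: "\<And>x. x \<in> X \<Longrightarrow> g x = H (1, x)"
  shows "homotopic_with_canon (\<lambda>h. \<forall>a\<in>A. h a = a) X X id g"
proof -
  have P: "(\<forall>a\<in>A. h a = a) \<longleftrightarrow> (\<forall>a\<in>A. k a = a)" if "\<And>x. x \<in> topspace (top_of_set X) \<Longrightarrow> h x = k x" for h k :: "'a \<Rightarrow> 'a"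
    using that A(1) by (metis subsetD topspace_euclidean_subtopology)
  show ?thesis
  proof (rule iffD2[OF homotopic_with[where P = "\<lambda>h. \<forall>a\<in>A. h a = a"]], erule P, intro exI[of _ H] conjI ballI)
    show "continuous_map (prod_topology (top_of_set {0..1}) (top_of_set X)) (top_of_set X) H"
      using H(1,2) by (simp add: continuous_map_subtopology_eu)
  qed (use H(3) A(2) g in auto)
qed

lemma contractible_of_deformation:
  fixes X :: "'a::topological_space set"
  assumes "continuous_on ({0..1} \<times> X) H" "H \<in> {0..1} \<times> X \<rightarrow> X"
    "\<And>x. x \<in> X \<Longrightarrow> H (0::real, x) = x" "\<And>x. x \<in> X \<Longrightarrow> H (1, x) = c"
  shows "contractible X"
proof -
  have "homotopic_with_canon (\<lambda>h. \<forall>a\<in>{}. h a = a) X X id (\<lambda>_. c)"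
    by (rule homotopic_with_of_deformation[OF assms(1-3)]) (use assms(4) in auto)
  then show ?thesis unfolding contractible_def by (auto simp: id_def)
qed

text \<open>For a one-point target, a failure of the uniqueness required by
  \<open>geodesic_deformation\<close> is a bigon and hence yields a simple loop.\<close>

lemma contractible_without_loops:
  fixes X :: "'a::metric_space set"
  assumes X: "compact X" "geodesic_space X" and none: "\<And>l \<gamma>. \<not> simple_loop_le X l \<gamma>"
  shows "contractible X"
proof (cases "X = {}")
  case False
  then obtain c where c: "c \<in> X" by blast
  obtain H :: "real \<times> 'a \<Rightarrow> 'a" where H: "continuous_on ({0..1} \<times> X) H" "H \<in> {0..1} \<times> X \<rightarrow> X"
    "\<And>x. x \<in> X \<Longrightarrow> H (0, x) = x" "\<And>x. x \<in> X \<Longrightarrow> H (1, x) \<in> {c}"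
  proof (rule geodesic_deformation[OF X, of "{c}"])
    fix x k k' y y'
    assume *: "x \<in> X" "k \<in> {c}" "k' \<in> {c}" "y \<in> gseg X x k" "y' \<in> gseg X x k'" "dist x y = dist x y'"
    show "y = y'"
    proof (rule ccontr)
      assume "y \<noteq> y'"
      then show False
        using geodesic_bigon_loop[OF X(2) *(1) c, of y y'] *(2-6) none by auto
    qed
  qed (use c in auto)
  show ?thesis by (rule contractible_of_deformation[OF H(1-3)]) (use H(4) in auto)
qed simp

section \<open>The retraction onto the core\<close>

locale core_deformation =
  fixes X :: "'a::metric_space set" and H :: "real \<times> 'a \<Rightarrow> 'a"
  assumes compact_X: "compact X" and geodesic_X: "geodesic_space X" and core_nonempty: "core X \<noteq> {}"
    and H_cont: "continuous_on ({0..1} \<times> X) H" and H_im: "H \<in> {0..1} \<times> X \<rightarrow> X"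
    and H_0: "\<And>x. x \<in> X \<Longrightarrow> H (0, x) = x" and H_1: "\<And>x. x \<in> X \<Longrightarrow> H (1, x) \<in> core X"
    and H_dist: "\<And>x. x \<in> X \<Longrightarrow> dist x (H (1, x)) = infdist x (core X)"
    and H_core: "\<And>t k. t \<in> {0..1} \<Longrightarrow> k \<in> core X \<Longrightarrow> H (t, k) = k"
begin

definition retr :: "'a \<Rightarrow> 'a" where "retr x = H (1, x)"

lemma retr_cont: "continuous_on X retr"
  unfolding retr_def
  by (rule continuous_on_compose2[OF H_cont]) (auto intro!: continuous_intros)

lemma retr_core: "x \<in> X \<Longrightarrow> retr x \<in> core X"
  and retr_dist: "x \<in> X \<Longrightarrow> dist x (retr x) = infdist x (core X)"
  and retr_fix: "k \<in> core X \<Longrightarrow> retr k = k"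
  using H_1 H_dist H_core by (auto simp: retr_def)

lemma retr_in: "x \<in> X \<Longrightarrow> retr x \<in> X"
  using retr_core core_subset by blast

lemma deformation_retracts_onto_core: "deformation_retracts_onto X (core X)"
  unfolding deformation_retracts_onto_def
proof (intro exI conjI)
  show "retraction X (core X) retr"
    unfolding retraction_def using core_subset retr_cont retr_core retr_fix by auto
  show "homotopic_with_canon (\<lambda>h. \<forall>a\<in>core X. h a = a) X X id retr"
    using H_cont H_im H_0 core_subset H_core by (intro homotopic_with_of_deformation) (auto simp: retr_def)
qed

section \<open>Distances under the retraction\<close>

lemma nearest_unique:
  assumes "x \<in> X" "k \<in> core X" "dist x k = infdist x (core X)"
  shows "k = retr x"
proof -
  have "k \<in> X" using assms(2) core_subset by blast
  show ?thesis
  proof (rule geodesic_to_core_unique[OF compact_X geodesic_X assms(1,2) retr_core[OF assms(1)] assms(3) retr_dist[OF assms(1)]])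
    show "k \<in> gseg X x k" "retr x \<in> gseg X x (retr x)"
      using \<open>k \<in> X\<close> retr_in[OF assms(1)] by (auto simp: gseg_def)
    show "dist x k = dist x (retr x)" using assms(3) retr_dist[OF assms(1)] by simp
  qed
qed

text \<open>A geodesic from \<open>z\<close> to \<open>retr z\<close> leaves the branch through
  \<open>w\<close>, so \<open>retr z\<close> is a point of the core nearest to \<open>w\<close> as
  well. Hence \<open>retr\<close> is locally constant outside the core.\<close>

lemma retr_branch:
  assumes W: "branch X w W" and z: "z \<in> W"
  shows "retr z = retr w"
proof (rule nearest_unique)
  have zX: "z \<in> X" using branch_subset[OF W] z by blast
  show wX: "w \<in> X" using W by (simp add: branch_def)
  show kc: "retr z \<in> core X" using zX by (rule retr_core)
  then have kW: "retr z \<notin> W" using branch_disjoint_core[OF W] by blast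
  then have ne: "z \<noteq> retr z" using z by metis
  obtain r where r: "arc_le X (dist z (retr z)) z (retr z) r"
    using geodesic_arc_exists[OF geodesic_X zX retr_in[OF zX] ne] .
  have "w \<in> path_image r"
    using connected_meets_root[OF W arc_le_image(6,1)[OF r] arc_le_image(2)[OF r] z arc_le_image(3)[OF r] kW] .
  then have "dist z w + dist w (retr z) = dist z (retr z)"
    using geodesic_arc_gseg[OF r] by (auto simp: gseg_def)
  moreover have "infdist z (core X) \<le> infdist w (core X) + dist z w" by (rule infdist_triangle)
  moreover have "infdist w (core X) \<le> dist w (retr z)" using kc by (rule infdist_le)
  ultimately show "dist w (retr z) = infdist w (core X)" using retr_dist[OF zX] by linarith
qed

text \<open>The fibre over \<open>retr x\<close> in \<open>C\<close> is closed by continuity. A core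
  point in it would be \<open>retr x\<close> itself, which \<open>C\<close> omits; so each point of
  the fibre lies in a branch, and the fibre is open.\<close>

lemma retr_const_on_connected:
  assumes C: "connected C" "C \<subseteq> X" and x: "x \<in> C" "retr x \<notin> C" and y: "y \<in> C"
  shows "retr y = retr x"
proof -
  let ?A = "{v \<in> C. retr v = retr x}"
  have cC: "continuous_on C retr" using retr_cont C(2) by (rule continuous_on_subset)
  have "closedin (top_of_set C) ?A"
    using continuous_closedin_preimage_constant[OF cC, of "retr x"] by simp
  moreover have "openin (top_of_set C) ?A"
  proof (subst openin_subopen, intro ballI)
    fix v assume v: "v \<in> ?A"
    then have "v \<notin> core X" using x(2) retr_fix[of v] by auto
    then obtain w W where W: "branch X w W" "v \<in> W" using not_in_coreE v C(2) by blast
    obtain T where T: "open T" "W = X \<inter> T" using W(1) unfolding branch_def openin_open by blast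
    show "\<exists>T. openin (top_of_set C) T \<and> v \<in> T \<and> T \<subseteq> ?A"
    proof (intro exI conjI)
      show "openin (top_of_set C) (C \<inter> T)" using T(1) by (rule openin_open_Int)
      show "v \<in> C \<inter> T" using v W(2) T(2) by blast
      show "C \<inter> T \<subseteq> ?A"
      proof
        fix u assume u: "u \<in> C \<inter> T"
        then have "u \<in> W" using T(2) C(2) by blast
        then have "retr u = retr v" using retr_branch[OF W(1)] W(2) by metis
        then show "u \<in> ?A" using u v by simp
      qed
    qed
  qed
  ultimately have "?A = {} \<or> ?A = C" using C(1) unfolding connected_clopen by blast
  then show ?thesis using x(1) y by blast
qed

text \<open>On a geodesic from \<open>x\<close> to \<open>y\<close> missing \<open>retr x\<close>
  the retraction would be constant.\<close>

lemma retr_between: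
  assumes x: "x \<in> X" and y: "y \<in> X" and ne: "retr x \<noteq> retr y"
  shows "retr x \<in> gseg X x y"
proof -
  have "x \<noteq> y" using ne by blast
  obtain r where r: "arc_le X (dist x y) x y r" using geodesic_arc_exists[OF geodesic_X x y \<open>x \<noteq> y\<close>] .
  have "retr x \<in> path_image r"
    using retr_const_on_connected[OF arc_le_image(6,1)[OF r] arc_le_image(2)[OF r] _ arc_le_image(3)[OF r]] ne by metis
  then show ?thesis using geodesic_arc_gseg[OF r] by blast
qed

text \<open>If the images differ, \<open>dist x y\<close> is the sum of a descent to
  \<open>retr x\<close>, the distance of the images and a climb to \<open>y\<close>. If they agree,
  the claim is that the distance to the core is 1-Lipschitz. The second summand on the left is the
  saving that shortens loops.\<close>

lemma dist_retr:
  assumes x: "x \<in> X" and y: "y \<in> X"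
  shows "dist (retr x) (retr y) + \<bar>infdist x (core X) - infdist y (core X)\<bar> \<le> dist x y"
proof (cases "retr x = retr y")
  case True
  have "infdist x (core X) \<le> infdist y (core X) + dist x y" "infdist y (core X) \<le> infdist x (core X) + dist y x"
    by (rule infdist_triangle)+
  then show ?thesis using True by (simp add: dist_commute)
next
  case False
  have "retr (retr x) = retr x" using retr_fix[OF retr_core[OF x]] .
  then have "retr y \<in> gseg X y (retr x)"
    using retr_between[OF y retr_in[OF x]] False by auto
  then have "dist y (retr y) + dist (retr y) (retr x) = dist y (retr x)" by (simp add: gseg_def)
  moreover have "dist x (retr x) + dist (retr x) y = dist x y"
    using retr_between[OF x y False] by (simp add: gseg_def)
  ultimately show ?thesis
    using retr_dist[OF x] retr_dist[OF y] infdist_nonneg[of x "core X"] infdist_nonneg[of y "core X"]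
    by (simp add: dist_commute)
qed

lemma homotopic_loops_retr:
  assumes "path \<gamma>" "path_image \<gamma> \<subseteq> X" "pathfinish \<gamma> = pathstart \<gamma>"
  shows "homotopic_loops X \<gamma> (retr \<circ> \<gamma>)"
  unfolding homotopic_loops
proof (intro exI conjI ballI)
  have g: "\<gamma> s \<in> X" if "s \<in> {0..1}" for s using that assms(2) by (auto simp: path_image_def)
  let ?h = "\<lambda>p. H (fst p, \<gamma> (snd p))"
  have "continuous_on ({0..1} \<times> {0..1}) (\<lambda>p. \<gamma> (snd p))"
    by (rule continuous_on_compose2[of "{0..1}" \<gamma>]) (use assms(1) in \<open>auto simp: path_def intro!: continuous_intros\<close>)
  then show "continuous_on ({0..1} \<times> {0..1}) ?h"
    by (intro continuous_on_compose2[OF H_cont]) (use g in \<open>auto intro!: continuous_intros\<close>)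
  show "?h \<in> {0..1} \<times> {0..1} \<rightarrow> X" using H_im g by (auto simp: Pi_iff)
  show "?h (0, s) = \<gamma> s" if "s \<in> {0..1}" for s using H_0 g that by simp
  show "?h (1, s) = (retr \<circ> \<gamma>) s" if "s \<in> {0..1}" for s by (simp add: retr_def)
  show "pathfinish (?h \<circ> Pair t) = pathstart (?h \<circ> Pair t)" if "t \<in> {0..1}" for t
    using assms(3) by (simp add: pathfinish_def pathstart_def)
qed

text \<open>If the distance to the core varies along the loop, retracting saves length. If it is a
  positive constant, the loop misses the core, so it retracts to one point, and minimality makes it
  constant.\<close>

lemma geodesic_loop_in_core:
  assumes \<gamma>: "geodesic_loop X \<gamma>" and nc: "\<not> \<gamma> constant_on {0..1}"
  shows "path_image \<gamma> \<subseteq> core X"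
proof (rule ccontr)
  assume "\<not> path_image \<gamma> \<subseteq> core X"
  then obtain t0 where t0: "t0 \<in> {0..1}" "\<gamma> t0 \<notin> core X" unfolding path_image_def by blast
  have p: "path \<gamma>" "path_image \<gamma> \<subseteq> X" "pathfinish \<gamma> = pathstart \<gamma>" "rectifiable \<gamma>"
    and min: "\<And>\<eta>. homotopic_loops X \<gamma> \<eta> \<Longrightarrow> path_length \<gamma> \<le> path_length \<eta>"
    using \<gamma> by (auto simp: geodesic_loop_def)
  have gX: "\<gamma> t \<in> X" if "t \<in> {0..1}" for t using that p(2) by (auto simp: path_image_def)
  define l where "l = enn2real (path_length \<gamma>)"
  have len_eq: "path_length \<gamma> = ennreal l" using p(4) by (simp add: l_def rectifiable_def)
  have shorter: "l \<le> l'" if "len_le (retr \<circ> \<gamma>) l'" for l'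
  proof -
    have "ennreal l \<le> ennreal l'"
      using min[OF homotopic_loops_retr[OF p(1-3)]] len_le_imp_path_length[OF that] len_eq by simp
    then show ?thesis using len_le_nonneg[OF that] by (simp add: ennreal_le_iff)
  qed
  have "len_le \<gamma> l" using len_eq by (intro path_length_imp_len_le) (auto simp: l_def)
  then obtain s :: "real \<Rightarrow> real" where s: "s 0 = 0" "s 1 \<le> l"
    "\<And>a b. 0 \<le> a \<Longrightarrow> a \<le> b \<Longrightarrow> b \<le> 1 \<Longrightarrow> dist (\<gamma> a) (\<gamma> b) \<le> s b - s a"
    by (rule len_leE) blast
  define \<phi> where "\<phi> = (\<lambda>t. infdist (\<gamma> t) (core X))"
  have dr: "dist (retr (\<gamma> a)) (retr (\<gamma> b)) + \<bar>\<phi> a - \<phi> b\<bar> \<le> s b - s a"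
    if "0 \<le> a" "a \<le> b" "b \<le> 1" for a b
    using dist_retr[OF gX gX, of a b] s(3)[OF that] that by (simp add: \<phi>_def)
  show False
  proof (cases "\<exists>t1\<in>{0..1}. \<phi> t1 \<noteq> \<phi> 0")
    case True
    then obtain t1 where t1: "t1 \<in> {0..1}" "\<phi> t1 \<noteq> \<phi> 0" by blast
    define \<delta> where "\<delta> = \<bar>\<phi> t1 - \<phi> 0\<bar>"
    \<comment> \<open>The signed change of height up to \<open>t1\<close>, frozen afterwards. After
      its subtraction \<open>s\<close> still dominates the retracted loop, with total increase
      smaller by \<open>\<delta>\<close>.\<close>
    define \<psi> where "\<psi> = (\<lambda>t. sgn (\<phi> t1 - \<phi> 0) * (\<phi> (min t t1) - \<phi> 0))"
    have \<psi>: "\<psi> 0 = 0" "\<psi> 1 = \<delta>"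
      using t1 by (auto simp: \<psi>_def \<delta>_def min_def sgn_if)
    have \<psi>d: "\<psi> b - \<psi> a \<le> \<bar>\<phi> a - \<phi> b\<bar>" if "a \<le> t1" "b \<le> t1" for a b
      using that by (auto simp: \<psi>_def min_def sgn_if)
    have "len_le (retr \<circ> \<gamma>) (l - \<delta>)"
    proof (rule len_leI[of "\<lambda>t. s t - \<psi> t"])
      show "s 0 - \<psi> 0 = 0" "s 1 - \<psi> 1 \<le> l - \<delta>" using s \<psi> by auto
      fix a b :: real assume ab: "0 \<le> a" "a \<le> b" "b \<le> 1"
      consider "b \<le> t1" | "t1 \<le> a" | "a \<le> t1" "t1 \<le> b" by linarith
      then have "dist (retr (\<gamma> a)) (retr (\<gamma> b)) \<le> (s b - \<psi> b) - (s a - \<psi> a)"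
      proof cases
        case 1
        then show ?thesis using dr[OF ab] \<psi>d[of a b] ab by linarith
      next
        case 2
        then have "min a t1 = t1" "min b t1 = t1" using ab by auto
        then have "\<psi> a = \<psi> b" by (simp add: \<psi>_def)
        then show ?thesis using dr[OF ab] by linarith
      next
        case 3
        have "\<psi> b = \<psi> t1" using 3 by (simp add: \<psi>_def min_def)
        then show ?thesis
          using dr[of a t1] dr[of t1 b] \<psi>d[of a t1] 3 ab dist_triangle[of "retr (\<gamma> a)" "retr (\<gamma> b)" "retr (\<gamma> t1)"]
          by linarith
      qed
      then show "dist ((retr \<circ> \<gamma>) a) ((retr \<circ> \<gamma>) b) \<le> s b - \<psi> b - (s a - \<psi> a)" by simp
    qed
    then show False using shorter[of "l - \<delta>"] t1(2) by (simp add: \<delta>_def)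
  next
    case False
    then have const: "\<phi> t = \<phi> t0" if "t \<in> {0..1}" for t using that t0(1) by metis
    have \<phi>pos: "0 < \<phi> t0"
      unfolding \<phi>_def using t0(2) compact_imp_closed[OF compact_core[OF compact_X]] core_nonempty
      by (simp add: infdist_pos_not_in_closed)
    have off: "\<gamma> t \<notin> core X" if "t \<in> {0..1}" for t
      using const[OF that] \<phi>pos by (auto simp: \<phi>_def)
    have "retr (\<gamma> t) = retr (\<gamma> t0)" if "t \<in> {0..1}" for t
    proof (rule retr_const_on_connected[OF connected_path_image[OF p(1)] p(2)])
      show "retr (\<gamma> t0) \<notin> path_image \<gamma>"
      proof
        assume "retr (\<gamma> t0) \<in> path_image \<gamma>"
        then obtain u where "u \<in> {0..1}" "retr (\<gamma> t0) = \<gamma> u" unfolding path_image_def by blast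
        then show False using off[of u] retr_core[OF gX[OF t0(1)]] by simp
      qed
    qed (use t0(1) that in \<open>auto simp: path_image_def\<close>)
    then have "len_le (retr \<circ> \<gamma>) 0" by (intro len_leI[of "\<lambda>_. 0"]) auto
    then have "l \<le> 0" by (rule shorter)
    then have "dist (\<gamma> t) (\<gamma> t0) \<le> 0" if "t \<in> {0..1}" for t
      using len_le_dist[OF \<open>len_le \<gamma> l\<close> that t0(1)] \<open>l \<le> 0\<close> by linarith
    then show False using nc unfolding constant_on_def by auto
  qed
qed

lemma pi1_hull_subset_core: "pi1_hull X \<subseteq> core X"
  unfolding pi1_hull_def using geodesic_loop_in_core by blast

end

lemma core_deformation_exists:
  fixes X :: "'a::metric_space set"
  assumes "compact X" "geodesic_space X" "core X \<noteq> {}"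
  obtains H where "core_deformation X H"
proof -
  note * = that
  show ?thesis
  proof (rule geodesic_deformation[OF assms(1,2) compact_core[OF assms(1)] core_subset assms(3)])
    show "y = y'" if "x \<in> X" "k \<in> core X" "k' \<in> core X" "dist x k = infdist x (core X)"
      "dist x k' = infdist x (core X)" "y \<in> gseg X x k" "y' \<in> gseg X x k'" "dist x y = dist x y'"
      for x k k' y y'
      by (rule geodesic_to_core_unique[OF assms(1,2) that])
    show thesis if "continuous_on ({0..1} \<times> X) H" "H \<in> {0..1} \<times> X \<rightarrow> X"
      "\<And>x. x \<in> X \<Longrightarrow> H (0, x) = x" "\<And>x. x \<in> X \<Longrightarrow> H (1, x) \<in> core X"
      "\<And>x. x \<in> X \<Longrightarrow> dist x (H (1, x)) = infdist x (core X)"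
      "\<And>t k. t \<in> {0..1} \<Longrightarrow> k \<in> core X \<Longrightarrow> H (t, k) = k" for H :: "real \<times> 'a \<Rightarrow> 'a"
      by (rule *[of H], rule core_deformation.intro) (fact assms that)+
  qed
qed

section \<open>Fundamental groups of strong deformation retracts\<close>

text \<open>The retraction induces the inverse. Since the homotopy fixes \<open>a\<close> at all
  times, it deforms loops at \<open>a\<close> relative to their endpoints, without a change of base
  point.\<close>

lemma pi1_map_id_iso:
  assumes "deformation_retracts_onto X A" "a \<in> A"
  shows "pi1_map X id \<in> iso (pi1 A a) (pi1 X a)"
proof -
  obtain r where r: "retraction X A r" and hom: "homotopic_with_canon (\<lambda>h. \<forall>a\<in>A. h a = a) X X id r"
    using assms(1) by (auto simp: deformation_retracts_onto_def)
  have AX: "A \<subseteq> X" and rc: "continuous_on X r" and rA: "r \<in> X \<rightarrow> A" and rf: "\<And>x. x \<in> A \<Longrightarrow> r x = x"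
    using r by (auto simp: retraction_def)
  have sub: "p \<in> paths_between X a a" if "p \<in> paths_between A a a" for p
    using that AX by (auto simp: paths_between_def)
  have map: "pi1_map X id (path_class A p) = path_class X p" if "p \<in> paths_between A a a" for p
    using pi1_map_path_class[OF that, of id X] AX by (simp add: image_subset_iff_funcset[symmetric])
  have rp: "r \<circ> p \<in> paths_between A a a" and hp: "homotopic_paths X p (r \<circ> p)" if p: "p \<in> paths_between X a a" for p
  proof -
    have pp: "path p" "path_image p \<subseteq> X" "p 0 = a" "p 1 = a"
      using p by (auto simp: paths_between_def pathstart_def pathfinish_def)
    have pX: "p s \<in> X" if "s \<in> {0..1}" for s using that pp(2) by (auto simp: path_image_def)
    show "r \<circ> p \<in> paths_between A a a"
      using pp rA rf[OF assms(2)] path_continuous_image[OF pp(1) continuous_on_subset[OF rc pp(2)]]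
      by (auto simp: paths_between_def pathstart_def pathfinish_def path_image_def)
    obtain h where h: "continuous_map (prod_topology (top_of_set {0..1::real}) (top_of_set X)) (top_of_set X) h"
      "\<And>x. h (0, x) = x" "\<And>x. h (1, x) = r x" "\<And>t b. t \<in> {0..1} \<Longrightarrow> b \<in> A \<Longrightarrow> h (t, b) = b"
      using hom unfolding homotopic_with_def by auto
    have hc: "continuous_on ({0..1} \<times> X) h" and hi: "h \<in> {0..1} \<times> X \<rightarrow> X"
      using h(1) by (simp_all add: continuous_map_subtopology_eu)
    show "homotopic_paths X p (r \<circ> p)"
      unfolding homotopic_paths
    proof (intro exI conjI ballI)
      let ?h = "\<lambda>q. h (fst q, p (snd q))"
      have "continuous_on ({0..1} \<times> {0..1}) (\<lambda>q. p (snd q))"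
        by (rule continuous_on_compose2[of "{0..1}" p]) (use pp(1) in \<open>auto simp: path_def intro!: continuous_intros\<close>)
      then show "continuous_on ({0..1} \<times> {0..1}) ?h"
        by (intro continuous_on_compose2[OF hc]) (use pX in \<open>auto intro!: continuous_intros\<close>)
      show "?h \<in> {0..1} \<times> {0..1} \<rightarrow> X" using hi pX by (auto simp: Pi_iff)
      show "?h (0, s) = p s" "?h (1, s) = (r \<circ> p) s" for s using h by auto
      show "pathstart (?h \<circ> Pair t) = pathstart p" "pathfinish (?h \<circ> Pair t) = pathfinish p" if "t \<in> {0..1}" for t
        using h(4)[OF that assms(2)] pp by (auto simp: pathstart_def pathfinish_def)
    qed
  qed
  have "pi1_map X id \<in> hom (pi1 A a) (pi1 X a)"
  proof (rule homI)
    fix P assume "P \<in> carrier (pi1 A a)"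
    then show "pi1_map X id P \<in> carrier (pi1 X a)" using map sub by (auto simp: carrier_pi1)
  next
    fix P Q assume "P \<in> carrier (pi1 A a)" "Q \<in> carrier (pi1 A a)"
    then obtain p q where *: "p \<in> paths_between A a a" "P = path_class A p" "q \<in> paths_between A a a" "Q = path_class A q"
      by (auto simp: carrier_pi1)
    then show "pi1_map X id (P \<otimes>\<^bsub>pi1 A a\<^esub> Q) = pi1_map X id P \<otimes>\<^bsub>pi1 X a\<^esub> pi1_map X id Q"
      by (simp add: mult_path_class map sub paths_between_join)
  qed
  moreover have "bij_betw (pi1_map X id) (carrier (pi1 A a)) (carrier (pi1 X a))"
    unfolding bij_betw_def
  proof
    show "inj_on (pi1_map X id) (carrier (pi1 A a))"
    proof (rule inj_onI)
      fix P Q assume "P \<in> carrier (pi1 A a)" "Q \<in> carrier (pi1 A a)" and eq: "pi1_map X id P = pi1_map X id Q"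
      then obtain p q where *: "p \<in> paths_between A a a" "P = path_class A p" "q \<in> paths_between A a a" "Q = path_class A q"
        by (auto simp: carrier_pi1)
      have "path_class X p = path_class X q" using eq * map by simp
      moreover have "q \<in> path_class X q" using sub[OF *(3)] by (simp add: path_class_def paths_between_def)
      ultimately have "homotopic_paths X p q" by (metis mem_Collect_eq path_class_def)
      then have "homotopic_paths A (r \<circ> p) (r \<circ> q)"
        using rc rA by (rule homotopic_paths_continuous_image)
      moreover have "homotopic_paths A p (r \<circ> p)" if "p \<in> paths_between A a a" for p
      proof (rule homotopic_paths_eq)
        fix t :: real assume "t \<in> {0..1}"
        then have "p t \<in> A" using that by (auto simp: paths_between_def path_image_def)
        then show "p t = (r \<circ> p) t" using rf by simp
      qed (use that in \<open>auto simp: paths_between_def\<close>)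
      ultimately have "homotopic_paths A p q"
        using *(1,3) by (meson homotopic_paths_sym homotopic_paths_trans)
      then show "P = Q" using *(2,4) path_class_eq by blast
    qed
    show "pi1_map X id ` carrier (pi1 A a) = carrier (pi1 X a)"
    proof (intro equalityI subsetI)
      fix Q assume "Q \<in> pi1_map X id ` carrier (pi1 A a)"
      then show "Q \<in> carrier (pi1 X a)" using map sub by (auto simp: carrier_pi1)
    next
      fix Q assume "Q \<in> carrier (pi1 X a)"
      then obtain p where p: "p \<in> paths_between X a a" "Q = path_class X p" by (auto simp: carrier_pi1)
      have "Q = pi1_map X id (path_class A (r \<circ> p))"
        using map[OF rp[OF p(1)]] path_class_eq[OF hp[OF p(1)]] p(2) by simp
      then show "Q \<in> pi1_map X id ` carrier (pi1 A a)" using rp[OF p(1)] by (auto simp: carrier_pi1)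
    qed
  qed
  ultimately show ?thesis by (simp add: iso_def)
qed

section \<open>Points on geodesic loops\<close>

lemma winding_nonzero_meets:
  assumes "punctured_map X F" "\<And>z. z \<in> X - U \<Longrightarrow> dist (F z) 1 < 1"
    "path \<eta>" "path_image \<eta> \<subseteq> X" "pathfinish \<eta> = pathstart \<eta>" "wind F \<eta> \<noteq> 0"
  shows "path_image \<eta> \<inter> U \<noteq> {}"
proof
  assume "path_image \<eta> \<inter> U = {}"
  then have "dist (F z) 1 < 1" if "z \<in> path_image \<eta>" for z
    using that assms(4) by (intro assms(2)) blast
  then show False using winding_number_near_1[OF assms(1,3,4,5)] assms(6) by blast
qed

lemma in_closed_if_meets_balls:
  fixes x :: "'a::metric_space"
  assumes "closed C" "\<And>e. 0 < e \<Longrightarrow> C \<inter> ball x e \<noteq> {}"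
  shows "x \<in> C"
proof -
  have "x \<in> closure C"
    unfolding closure_approachable using assms(2) by (metis Int_emptyI dist_commute mem_ball)
  then show ?thesis using assms(1) by simp
qed

lemma in_pi1_hullI: "geodesic_loop X \<gamma> \<Longrightarrow> \<not> \<gamma> constant_on {0..1} \<Longrightarrow> x \<in> path_image \<gamma> \<Longrightarrow> x \<in> pi1_hull X"
  unfolding pi1_hull_def by blast

lemma geodesic_loopD:
  assumes "geodesic_loop X \<gamma>"
  shows "path \<gamma>" "path_image \<gamma> \<subseteq> X" "pathfinish \<gamma> = pathstart \<gamma>" "closed (path_image \<gamma>)" "connected (path_image \<gamma>)"
  using assms by (auto simp: geodesic_loop_def closed_path_image connected_path_image)

lemma simple_loop_leD:
  assumes "simple_loop_le S l \<gamma>"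
  shows "simple_path \<gamma>" "path \<gamma>" "path_image \<gamma> \<subseteq> S" "pathfinish \<gamma> = pathstart \<gamma>" "len_le \<gamma> l"
    "path_image \<gamma> \<noteq> {}" "compact (path_image \<gamma>)" "connected (path_image \<gamma>)"
  using assms
  by (auto simp: simple_loop_le_def simple_path_imp_path compact_simple_path_image connected_simple_path_image)

lemma loop_detector:
  fixes X :: "'a::metric_space set"
  assumes "compact X" "covering_dim_le (top_of_set X) 1" "simple_loop_le X l \<gamma>"
    "openin (top_of_set X) U" "U \<inter> path_image \<gamma> \<noteq> {}"
  obtains F where "punctured_map X F" "\<And>x. x \<in> X - U \<Longrightarrow> dist (F x) 1 < 1"
    "wind F \<gamma> = 1"
  using simple_loop_detector[OF assms(1,2) simple_loop_leD(1,4,3)[OF assms(3)] assms(4,5)] by blast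

text \<open>\<open>\<gamma>\<close> itself has winding number 1 for detectors concentrated on balls
  shrinking to \<open>x\<close>. The minimiser meets all these balls, and its image is
  closed.\<close>

lemma simple_loop_in_hull:
  fixes X :: "'a::metric_space set"
  assumes X: "compact X" "covering_dim_le (top_of_set X) 1"
    and \<gamma>: "simple_loop_le X l \<gamma>" and x: "x \<in> path_image \<gamma>"
  shows "x \<in> pi1_hull X"
proof -
  define U where "U = (\<lambda>n::nat. X \<inter> ball x (1 / (real n + 1)))"
  have xU: "x \<in> U n" for n using x simple_loop_leD(3)[OF \<gamma>] by (auto simp: U_def)
  have "\<forall>n. \<exists>F. punctured_map X F \<and> (\<forall>z\<in>X - U n. dist (F z) 1 < 1) \<and> wind F \<gamma> = 1"
  proof
    fix n
    have "openin (top_of_set X) (U n)" unfolding U_def by (rule openin_open_Int) simp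
    moreover have "U n \<inter> path_image \<gamma> \<noteq> {}" using xU x by blast
    ultimately show "\<exists>F. punctured_map X F \<and> (\<forall>z\<in>X - U n. dist (F z) 1 < 1) \<and> wind F \<gamma> = 1"
      using loop_detector[OF X \<gamma>] by metis
  qed
  then obtain F where F: "\<And>n. punctured_map X (F n)" "\<And>n z. z \<in> X - U n \<Longrightarrow> dist (F n z) 1 < 1"
    "\<And>n. wind (F n) \<gamma> = 1"
    by metis
  obtain g where g: "geodesic_loop X g" "\<not> g constant_on {0..1}" "\<And>n. wind (F n) g \<noteq> 0"
  proof (rule exists_geodesic_loop[OF X(1) F(1), of l])
    show "\<exists>\<eta>. path \<eta> \<and> path_image \<eta> \<subseteq> X \<and> pathfinish \<eta> = pathstart \<eta> \<and> len_le \<eta> l \<and>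
          (\<forall>n<N. wind (F n) \<eta> \<noteq> 0)" for N
      using simple_loop_leD[OF \<gamma>] F(3) by (intro exI[of _ \<gamma>]) auto
  qed (rule that)
  have "x \<in> path_image g"
  proof (rule in_closed_if_meets_balls)
    show "closed (path_image g)" by (rule geodesic_loopD(4)[OF g(1)])
    fix e :: real assume "0 < e"
    then obtain n :: nat where "1 / (real n + 1) < e"
      using nat_approx_posE by (metis Suc_eq_plus1 of_nat_1 of_nat_add)
    then have "U n \<subseteq> ball x e" by (auto simp: U_def)
    moreover have "path_image g \<inter> U n \<noteq> {}"
      by (rule winding_nonzero_meets[OF F(1) F(2) geodesic_loopD(1-3)[OF g(1)] g(3)])
    ultimately show "path_image g \<inter> ball x e \<noteq> {}" by blast
  qed
  then show ?thesis using in_pi1_hullI[OF g(1,2)] by blast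
qed

text \<open>The tail is run through in both directions and cancels in every winding number. Basing
  the loop at \<open>x\<close> makes lassos composable.\<close>

lemma lasso_exists:
  fixes X :: "'a::metric_space set"
  assumes "geodesic_space X" "x \<in> X" "simple_loop_le X l \<gamma>"
  obtains \<eta> where "path \<eta>" "path_image \<eta> \<subseteq> X" "pathstart \<eta> = x" "pathfinish \<eta> = x"
    "len_le \<eta> (2 * dist x (pathstart \<gamma>) + l)"
    "\<And>F. punctured_map X F \<Longrightarrow> wind F \<eta> = wind F \<gamma>"
proof (cases "x = pathstart \<gamma>")
  case True
  then show ?thesis using that[of \<gamma>] simple_loop_leD[OF assms(3)] by simp
next
  case False
  note g = simple_loop_leD[OF assms(3)]
  have yX: "pathstart \<gamma> \<in> X" using g(3) by auto
  obtain \<sigma> where "arc_le X (dist x (pathstart \<gamma>)) x (pathstart \<gamma>) \<sigma>"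
    using geodesic_arc_exists[OF assms(1,2) yX False] .
  then have s: "path \<sigma>" "path_image \<sigma> \<subseteq> X" "pathstart \<sigma> = x" "pathfinish \<sigma> = pathstart \<gamma>"
    "len_le \<sigma> (dist x (pathstart \<gamma>))"
    by (auto simp: arc_le_def arc_imp_path)
  let ?\<rho> = "\<gamma> +++ reversepath \<sigma>"
  let ?\<eta> = "\<sigma> +++ ?\<rho>"
  have \<rho>: "path ?\<rho>" "path_image ?\<rho> \<subseteq> X" "pathstart ?\<rho> = pathstart \<gamma>" "pathfinish ?\<rho> = x"
    using g s by (auto simp: path_image_join)
  have "len_le ?\<eta> (dist x (pathstart \<gamma>) + (l + dist x (pathstart \<gamma>)))"
    using g s by (intro len_le_join len_le_reversepath) auto
  then have len: "len_le ?\<eta> (2 * dist x (pathstart \<gamma>) + l)" by (rule len_le_mono) simp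
  show ?thesis
  proof (rule that[of ?\<eta>])
    show "path ?\<eta>" "pathstart ?\<eta> = x" "pathfinish ?\<eta> = x" using s \<rho> by auto
    show "path_image ?\<eta> \<subseteq> X" using s \<rho> by (simp add: path_image_join)
    show "wind F ?\<eta> = wind F \<gamma>" if F: "punctured_map X F" for F
    proof -
      have "wind F ?\<eta> = wind F \<sigma> + wind F ?\<rho>"
        by (rule winding_number_join_compose[OF F]) (use s \<rho> in auto)
      also have "wind F ?\<rho> = wind F \<gamma> + wind F (reversepath \<sigma>)"
        by (rule winding_number_join_compose[OF F]) (use s g in auto)
      also have "wind F (reversepath \<sigma>) = - wind F \<sigma>"
        by (rule winding_number_reversepath_compose[OF F s(1,2)])
      also have "wind F \<sigma> + (wind F \<gamma> + - wind F \<sigma>)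
          = wind F \<gamma>"
        by (simp only: add.left_commute add.right_inverse add_0_right)
      finally show ?thesis .
    qed
  qed (rule len)
qed

text \<open>Winding numbers add under composition, so one loop satisfies many detectors at once if
  each of them sees only its own factor.\<close>

lemma lasso_product_exists:
  fixes X :: "'a::metric_space set" and \<gamma> :: "nat \<Rightarrow> real \<Rightarrow> 'a"
  assumes X: "geodesic_space X" and x: "x \<in> X" and loops: "\<And>n. simple_loop_le X (l n) (\<gamma> n)"
  shows "\<exists>\<eta>. path \<eta> \<and> path_image \<eta> \<subseteq> X \<and> pathstart \<eta> = x \<and> pathfinish \<eta> = x \<and>
    len_le \<eta> (\<Sum>n<N. 2 * dist x (pathstart (\<gamma> n)) + l n) \<and>
    (\<forall>F. punctured_map X F \<longrightarrow> wind F \<eta> = (\<Sum>n<N. wind F (\<gamma> n)))"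
proof (induction N)
  case 0
  have "wind F (\<lambda>_. x) = 0" if "punctured_map X F" for F
  proof -
    have "F x \<noteq> 0" using that x by (force simp: punctured_map_def)
    then show ?thesis by (simp add: o_def winding_number_zero_const)
  qed
  then show ?case
    using x by (intro exI[of _ "\<lambda>_. x"])
      (auto simp: path_def path_image_def pathstart_def pathfinish_def len_le_const)
next
  case (Suc N)
  then obtain \<eta> where \<eta>: "path \<eta>" "path_image \<eta> \<subseteq> X" "pathstart \<eta> = x" "pathfinish \<eta> = x"
    "len_le \<eta> (\<Sum>n<N. 2 * dist x (pathstart (\<gamma> n)) + l n)"
    "\<And>F. punctured_map X F \<Longrightarrow> wind F \<eta> = (\<Sum>n<N. wind F (\<gamma> n))"
    by blast
  obtain \<theta> where \<theta>: "path \<theta>" "path_image \<theta> \<subseteq> X" "pathstart \<theta> = x" "pathfinish \<theta> = x"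
    "len_le \<theta> (2 * dist x (pathstart (\<gamma> N)) + l N)"
    "\<And>F. punctured_map X F \<Longrightarrow> wind F \<theta> = wind F (\<gamma> N)"
    using lasso_exists[OF X x loops[of N]] by blast
  show ?case
  proof (intro exI[of _ "\<eta> +++ \<theta>"] conjI allI impI)
    show "len_le (\<eta> +++ \<theta>) (\<Sum>n<Suc N. 2 * dist x (pathstart (\<gamma> n)) + l n)"
      using len_le_join[OF \<eta>(5) \<theta>(5)] \<eta>(4) \<theta>(3) by simp
    show "wind F (\<eta> +++ \<theta>) = (\<Sum>n<Suc N. wind F (\<gamma> n))"
      if F: "punctured_map X F" for F
      using winding_number_join_compose[OF F \<eta>(1,2) \<theta>(1,2)] \<eta>(4,6) \<theta>(3,6) F by simp
  qed (use \<eta> \<theta> in \<open>auto simp: path_image_join\<close>)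
qed

text \<open>Each detector sees only the loop on its own side, so the product of the two lassos has
  winding number 1 for both. The minimiser is connected and enters both sides, hence contains
  \<open>x\<close>.\<close>

lemma separating_point_in_hull:
  fixes X :: "'a::metric_space set"
  assumes X: "compact X" "covering_dim_le (top_of_set X) 1" "geodesic_space X" and x: "x \<in> X"
    and V: "openin (top_of_set X) V" "closed (insert x V)" "x \<notin> V"
    and \<gamma>1: "simple_loop_le X l1 \<gamma>1" "path_image \<gamma>1 \<subseteq> V"
    and \<gamma>2: "simple_loop_le X l2 \<gamma>2" "path_image \<gamma>2 \<subseteq> X - insert x V"
  shows "x \<in> pi1_hull X"
proof -
  let ?V' = "X - insert x V"
  have VX: "V \<subseteq> X" using V(1) by (rule openin_imp_subset)
  have V': "openin (top_of_set X) ?V'" using V(2) by (simp add: openin_diff closed_subset VX x)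
  obtain F1 where F1: "punctured_map X F1" "\<And>z. z \<in> X - V \<Longrightarrow> dist (F1 z) 1 < 1" "wind F1 \<gamma>1 = 1"
    using loop_detector[OF X(1,2) \<gamma>1(1) V(1)] simple_loop_leD(6)[OF \<gamma>1(1)] \<gamma>1(2) by blast
  obtain F2 where F2: "punctured_map X F2" "\<And>z. z \<in> X - ?V' \<Longrightarrow> dist (F2 z) 1 < 1" "wind F2 \<gamma>2 = 1"
    using loop_detector[OF X(1,2) \<gamma>2(1) V'] simple_loop_leD(6)[OF \<gamma>2(1)] \<gamma>2(2) by blast
  have z1: "wind F1 \<gamma>2 = 0"
    by (rule winding_number_near_1[OF F1(1) simple_loop_leD(2,3,4)[OF \<gamma>2(1)] F1(2)]) (use \<gamma>2(2) in blast)
  have z2: "wind F2 \<gamma>1 = 0"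
    by (rule winding_number_near_1[OF F2(1) simple_loop_leD(2,3,4)[OF \<gamma>1(1)] F2(2)]) (use \<gamma>1(2) VX in blast)
  \<comment> \<open>\<open>exists_geodesic_loop\<close> takes a sequence of maps; this one is
    constant from index 1 on.\<close>
  define F where "F = (\<lambda>n::nat. if n = 0 then F1 else F2)"
  have F: "punctured_map X (F n)" for n using F1(1) F2(1) by (simp add: F_def)
  define \<gamma> where "\<gamma> = (\<lambda>n::nat. if n = 0 then \<gamma>1 else \<gamma>2)"
  define l where "l = (\<lambda>n::nat. if n = 0 then l1 else l2)"
  have "simple_loop_le X (l n) (\<gamma> n)" for n using \<gamma>1(1) \<gamma>2(1) by (simp add: \<gamma>_def l_def)
  then obtain \<eta> M where \<eta>: "path \<eta>" "path_image \<eta> \<subseteq> X" "pathstart \<eta> = x" "pathfinish \<eta> = x" "len_le \<eta> M"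
    "\<And>F. punctured_map X F \<Longrightarrow> wind F \<eta> = (\<Sum>n<2. wind F (\<gamma> n))"
    using lasso_product_exists[OF X(3) x, of l \<gamma> 2] by metis
  have wn: "wind (F n) \<eta> = 1" for n
    using \<eta>(6)[OF F, of n] F1(3) F2(3) z1 z2
    by (auto simp: F_def \<gamma>_def numeral_2_eq_2)
  obtain g where g: "geodesic_loop X g" "\<not> g constant_on {0..1}" "\<And>n. wind (F n) g \<noteq> 0"
  proof (rule exists_geodesic_loop[OF X(1) F, of M])
    show "\<exists>\<eta>. path \<eta> \<and> path_image \<eta> \<subseteq> X \<and> pathfinish \<eta> = pathstart \<eta> \<and> len_le \<eta> M \<and>
          (\<forall>n<N. wind (F n) \<eta> \<noteq> 0)" for N
      using \<eta>(1-5) wn by (intro exI[of _ \<eta>]) auto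
  qed (rule that)
  note gl = geodesic_loopD[OF g(1)]
  have "path_image g \<inter> V \<noteq> {}"
    by (rule winding_nonzero_meets[OF F1(1,2) gl(1-3)]) (use g(3)[of 0] in \<open>auto simp: F_def\<close>)
  moreover have "path_image g \<inter> ?V' \<noteq> {}"
    by (rule winding_nonzero_meets[OF F2(1,2) gl(1-3)]) (use g(3)[of 1] in \<open>auto simp: F_def\<close>)
  ultimately have "x \<in> path_image g"
    using connected_subset_clopen[OF gl(5,2) V(1,2)] by blast
  then show ?thesis using in_pi1_hullI[OF g(1,2)] by blast
qed

text \<open>Infinitely many short loops in disjoint annuli around \<open>x\<close> are detected simultaneously by
  finite products of lassos of uniformly bounded length.\<close>

lemma limit_of_loops_in_hull:
  fixes X :: "'a::metric_space set"
  assumes X: "compact X" "covering_dim_le (top_of_set X) 1" "geodesic_space X" and x: "x \<in> X"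
    and off: "\<And>l \<gamma>. simple_loop_le X l \<gamma> \<Longrightarrow> x \<notin> path_image \<gamma>"
    and short: "\<And>\<delta>. 0 < \<delta> \<Longrightarrow> \<exists>\<gamma>. simple_loop_le (X \<inter> ball x \<delta>) \<delta> \<gamma>"
  shows "x \<in> pi1_hull X"
proof -
  \<comment> \<open>The loop misses \<open>x\<close>, so a smaller ball of radius
    \<open>\<delta>'\<close> misses the loop; iteration gives disjoint annuli. Halving makes the
    lasso lengths summable.\<close>
  have "\<exists>\<gamma> \<delta>'. simple_loop_le (X \<inter> ball x \<delta>) \<delta> \<gamma> \<and> 0 < \<delta>' \<and> \<delta>' \<le> \<delta> / 2 \<and> (\<forall>z\<in>path_image \<gamma>. \<delta>' < dist x z)"
    if \<delta>: "0 < \<delta>" for \<delta> :: real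
  proof -
    obtain \<gamma> where \<gamma>: "simple_loop_le (X \<inter> ball x \<delta>) \<delta> \<gamma>" using short[OF \<delta>] by blast
    then have "simple_loop_le X \<delta> \<gamma>" by (rule simple_loop_le_mono) auto
    then have "x \<notin> path_image \<gamma>" by (rule off)
    then have pos: "0 < infdist x (path_image \<gamma>)"
      using simple_loop_leD(6,7)[OF \<gamma>] by (intro infdist_pos_not_in_closed compact_imp_closed) auto
    have "min (\<delta> / 2) (infdist x (path_image \<gamma>) / 2) < dist x z" if "z \<in> path_image \<gamma>" for z
      using infdist_le[OF that, of x] pos by linarith
    then show ?thesis
      using \<gamma> \<delta> pos by (intro exI[of _ \<gamma>] exI[of _ "min (\<delta> / 2) (infdist x (path_image \<gamma>) / 2)"]) auto
  qed
  then obtain G :: "real \<Rightarrow> real \<Rightarrow> 'a" and D :: "real \<Rightarrow> real" where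
    GD: "\<And>\<delta>. 0 < \<delta> \<Longrightarrow> simple_loop_le (X \<inter> ball x \<delta>) \<delta> (G \<delta>)" "\<And>\<delta>. 0 < \<delta> \<Longrightarrow> 0 < D \<delta>"
      "\<And>\<delta>. 0 < \<delta> \<Longrightarrow> D \<delta> \<le> \<delta> / 2" "\<And>\<delta> z. 0 < \<delta> \<Longrightarrow> z \<in> path_image (G \<delta>) \<Longrightarrow> D \<delta> < dist x z"
    by metis
  define d where "d = (\<lambda>n. (D ^^ n) 1)"
  have d_Suc: "d (Suc n) = D (d n)" for n by (simp add: d_def)
  have d_pos: "0 < d n" for n
    by (induction n) (simp_all add: d_Suc GD(2), simp add: d_def)
  have d_half: "d (Suc n) \<le> d n / 2" for n using GD(3)[OF d_pos] by (simp add: d_Suc)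
  have d_pow: "d n \<le> (1 / 2) ^ n" for n
  proof (induction n)
    case (Suc n) then show ?case using d_half[of n] by simp
  qed (simp add: d_def)
  have d_le: "d n \<le> d m" if "m \<le> n" for m n
    using that by (rule lift_Suc_antimono_le[rotated]) (use d_half d_pos in \<open>smt (verit) field_sum_of_halves\<close>)
  define \<gamma> where "\<gamma> = (\<lambda>n. G (d n))"
  define U where "U = (\<lambda>n. {z \<in> X. d (Suc n) < dist x z \<and> dist x z < d n})"
  have \<gamma>: "simple_loop_le X (d n) (\<gamma> n)" for n
    using GD(1)[OF d_pos] unfolding \<gamma>_def by (rule simple_loop_le_mono) auto
  have \<gamma>U: "path_image (\<gamma> n) \<subseteq> U n" for n
    using simple_loop_leD(3)[OF GD(1)[OF d_pos[of n]]] GD(4)[OF d_pos[of n]] by (auto simp: \<gamma>_def U_def d_Suc)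
  have U_open: "openin (top_of_set X) (U n)" for n
  proof -
    have "U n = X \<inter> ({z. d (Suc n) < dist x z} \<inter> {z. dist x z < d n})" by (auto simp: U_def)
    moreover have "open ({z. d (Suc n) < dist x z} \<inter> {z. dist x z < d n})"
      by (intro open_Int open_Collect_less continuous_intros)
    ultimately show ?thesis by (simp add: openin_open_Int)
  qed
  have U_disj: "U m \<inter> U n = {}" if "m \<noteq> n" for m n
  proof -
    have *: "U m \<inter> U n = {}" if "m < n" for m n
    proof -
      have "d n \<le> d (Suc m)" using that by (intro d_le) simp
      then show ?thesis unfolding U_def by auto
    qed
    show ?thesis using *[of m n] *[of n m] that by (metis Int_commute linorder_neqE_nat)
  qed
  have "\<forall>n. \<exists>F. punctured_map X F \<and> (\<forall>z\<in>X - U n. dist (F z) 1 < 1) \<and> wind F (\<gamma> n) = 1"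
  proof
    fix n
    have "U n \<inter> path_image (\<gamma> n) \<noteq> {}" using \<gamma>U[of n] simple_loop_leD(6)[OF \<gamma>[of n]] by blast
    then show "\<exists>F. punctured_map X F \<and> (\<forall>z\<in>X - U n. dist (F z) 1 < 1) \<and> wind F (\<gamma> n) = 1"
      using loop_detector[OF X(1,2) \<gamma>[of n] U_open[of n]] by metis
  qed
  then obtain F where F: "\<And>n. punctured_map X (F n)" "\<And>n z. z \<in> X - U n \<Longrightarrow> dist (F n z) 1 < 1"
    "\<And>n. wind (F n) (\<gamma> n) = 1"
    by metis
  have wn: "wind (F n) (\<gamma> m) = (if m = n then 1 else 0)" for m n
  proof (cases "m = n")
    case False
    have "path_image (\<gamma> m) \<subseteq> X - U n"
      using \<gamma>U[of m] U_disj[OF False] simple_loop_leD(3)[OF \<gamma>[of m]] by blast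
    then have "wind (F n) (\<gamma> m) = 0"
      by (intro winding_number_near_1[OF F(1) simple_loop_leD(2,3,4)[OF \<gamma>] F(2)]) blast
    then show ?thesis using False by simp
  qed (use F(3) in simp)
  \<comment> \<open>Tail and loop number \<open>n\<close> together cost at most
    \<open>3 * (1/2)^n\<close>, and these sum to at most 6.\<close>
  have sum_le: "(\<Sum>n<N. 2 * dist x (pathstart (\<gamma> n)) + d n) \<le> 6" for N
  proof -
    have "2 * dist x (pathstart (\<gamma> n)) + d n \<le> 3 * (1 / 2) ^ n" for n
    proof -
      have "pathstart (\<gamma> n) \<in> U n" using \<gamma>U[of n] by auto
      then show ?thesis using d_pow[of n] by (simp add: U_def)
    qed
    then have "(\<Sum>n<N. 2 * dist x (pathstart (\<gamma> n)) + d n) \<le> (\<Sum>n<N. 3 * (1 / 2) ^ n)"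
      by (intro sum_mono)
    also have "\<dots> = 3 * (\<Sum>n<N. (1 / 2) ^ n)" by (simp add: sum_distrib_left)
    also have "\<dots> = 3 * (((1 / 2) ^ N - 1) / (1 / 2 - 1))" by (subst geometric_sum) simp_all
    also have "\<dots> = 6 * (1 - (1 / 2) ^ N)" by (simp add: field_simps)
    also have "\<dots> \<le> 6" by simp
    finally show ?thesis .
  qed
  obtain g where g: "geodesic_loop X g" "\<not> g constant_on {0..1}" "\<And>n. wind (F n) g \<noteq> 0"
  proof (rule exists_geodesic_loop[OF X(1) F(1), of 6])
    fix N
    obtain \<eta> where \<eta>: "path \<eta>" "path_image \<eta> \<subseteq> X" "pathstart \<eta> = x" "pathfinish \<eta> = x"
      "len_le \<eta> (\<Sum>n<N. 2 * dist x (pathstart (\<gamma> n)) + d n)"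
      "\<And>F. punctured_map X F \<Longrightarrow> wind F \<eta> = (\<Sum>n<N. wind F (\<gamma> n))"
      using lasso_product_exists[OF X(3) x, of d \<gamma> N] \<gamma> by blast
    have "wind (F n) \<eta> = 1" if "n < N" for n
      using \<eta>(6)[OF F(1), of n] that by (simp add: wn)
    then show "\<exists>\<eta>. path \<eta> \<and> path_image \<eta> \<subseteq> X \<and> pathfinish \<eta> = pathstart \<eta> \<and> len_le \<eta> 6 \<and>
          (\<forall>n<N. wind (F n) \<eta> \<noteq> 0)"
      using \<eta>(1-4) len_le_mono[OF \<eta>(5) sum_le] by (intro exI[of _ \<eta>]) auto
  qed (rule that)
  have "x \<in> path_image g"
  proof (rule in_closed_if_meets_balls)
    show "closed (path_image g)" by (rule geodesic_loopD(4)[OF g(1)])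
    fix e :: real assume "0 < e"
    then obtain n :: nat where "(1 / 2) ^ n < e"
      using real_arch_pow_inv[of e "1/2"] by auto
    then have "U n \<subseteq> ball x e" using d_pow[of n] by (auto simp: U_def)
    moreover have "path_image g \<inter> U n \<noteq> {}"
      by (rule winding_nonzero_meets[OF F(1) F(2) geodesic_loopD(1-3)[OF g(1)] g(3)])
    ultimately show "path_image g \<inter> ball x e \<noteq> {}" by blast
  qed
  then show ?thesis using in_pi1_hullI[OF g(1,2)] by blast
qed

section \<open>Points without short loops nearby\<close>

text \<open>The relation of lying in one rectifiable-arc component of \<open>S\<close>. Equality is
  a separate case because arcs have distinct endpoints.\<close>

definition joined :: "'a::metric_space set \<Rightarrow> 'a \<Rightarrow> 'a \<Rightarrow> bool" where
  "joined S a b \<longleftrightarrow> a = b \<or> (\<exists>l p. arc_le S l a b p)"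

lemma joined_sym: "joined S a b \<Longrightarrow> joined S b a"
  unfolding joined_def using arc_le_reverse by blast

lemma joined_trans:
  assumes "joined S a b" "joined S b c"
  shows "joined S a c"
proof (cases "a = b \<or> b = c \<or> a = c")
  case False
  then obtain l p l' q where pq: "arc_le S l a b p" "arc_le S l' b c q"
    using assms by (auto simp: joined_def)
  obtain r where "arc_le (path_image p \<union> path_image q) (l + l') a c r"
    using arc_shortcut[OF pq] False by blast
  then have "arc_le S (l + l') a c r"
    by (rule arc_le_mono) (use arc_le_image(1)[OF pq(1)] arc_le_image(1)[OF pq(2)] in auto)
  then show ?thesis by (auto simp: joined_def)
qed (use assms in \<open>auto simp: joined_def\<close>)

lemma joined_geodesic:
  assumes "geodesic_space X" "y \<in> X" "y' \<in> X" "x \<notin> gseg X y y'"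
  shows "joined (X - {x}) y y'"
proof (cases "y = y'")
  case False
  obtain r where r: "arc_le X (dist y y') y y' r" using geodesic_arc_exists[OF assms(1-3) False] .
  have "path_image r \<subseteq> X - {x}" using geodesic_arc_gseg[OF r] assms(4) by (auto simp: gseg_def)
  then have "arc_le (X - {x}) (dist y y') y y' r" using r by (simp add: arc_le_def)
  then show ?thesis by (auto simp: joined_def)
qed (simp add: joined_def)

section \<open>Components of the complement of a point\<close>

lemma openin_metric_iff:
  fixes X :: "'a::metric_space set"
  shows "openin (top_of_set X) W \<longleftrightarrow> W \<subseteq> X \<and> (\<forall>y\<in>W. \<exists>e>0. \<forall>y'\<in>X. dist y y' < e \<longrightarrow> y' \<in> W)"
  unfolding openin_euclidean_subtopology_iff by (simp add: dist_commute)

lemma closed_of_openin_complement: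
  fixes X :: "'a::metric_space set"
  assumes "compact X" "S \<subseteq> X" "openin (top_of_set X) (X - S)"
  shows "closed S"
  using closed_diff_openin[OF assms(1,3)] assms(2) by (simp add: double_diff)

text \<open>A geodesic from \<open>y\<close> shorter than \<open>dist y x\<close> cannot reach
  \<open>x\<close>. So each component contains a ball about each of its points, and so does the
  union of the other components.\<close>

lemma joined_component_clopen:
  fixes X :: "'a::metric_space set" and x c :: 'a
  assumes X: "compact X" "geodesic_space X" "x \<in> X"
  defines "V \<equiv> {y \<in> X - {x}. joined (X - {x}) c y}"
  shows "openin (top_of_set X) V" "closed (insert x V)"
proof -
  have near: "joined (X - {x}) y y'" if "y \<in> X" "y' \<in> X" "dist y y' < dist y x" for y y'
  proof (rule joined_geodesic[OF X(2) that(1,2)])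
    show "x \<notin> gseg X y y'"
      using that(3) zero_le_dist[of x y'] unfolding gseg_def by fastforce
  qed
  have ne: "y' \<noteq> x" if "dist y y' < dist y x" for y y' using that by auto
  show "openin (top_of_set X) V"
    unfolding openin_metric_iff
  proof (intro conjI ballI)
    fix y assume y: "y \<in> V"
    show "\<exists>e>0. \<forall>y'\<in>X. dist y y' < e \<longrightarrow> y' \<in> V"
    proof (intro exI[of _ "dist y x"] conjI ballI impI)
      show "0 < dist y x" using y by (simp add: V_def)
      fix y' assume "y' \<in> X" "dist y y' < dist y x"
      then show "y' \<in> V" using y near[of y y'] ne[of y y'] joined_trans by (auto simp: V_def)
    qed
  qed (auto simp: V_def)
  show "closed (insert x V)"
  proof (rule closed_of_openin_complement[OF X(1)])
    show "insert x V \<subseteq> X" using X(3) by (auto simp: V_def)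
    show "openin (top_of_set X) (X - insert x V)"
      unfolding openin_metric_iff
    proof (intro conjI ballI)
      fix y assume y: "y \<in> X - insert x V"
      show "\<exists>e>0. \<forall>y'\<in>X. dist y y' < e \<longrightarrow> y' \<in> X - insert x V"
      proof (intro exI[of _ "dist y x"] conjI ballI impI)
        show "0 < dist y x" using y by simp
        fix y' assume y': "y' \<in> X" "dist y y' < dist y x"
        have "y' \<notin> V"
        proof
          assume "y' \<in> V"
          then have "joined (X - {x}) c y'" by (simp add: V_def)
          moreover have "joined (X - {x}) y' y" using near[of y y'] y y' joined_sym by blast
          ultimately have "joined (X - {x}) c y" by (rule joined_trans)
          then show False using y by (auto simp: V_def)
        qed
        then show "y' \<in> X - insert x V" using y' ne[of y y'] by simp
      qed
    qed auto
  qed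
qed

text \<open>The triangles and bigons of \<open>tripod\<close> and \<open>unique_point\<close> have a
  vertex at \<open>x\<close> and perimeter at most \<open>3 * \<epsilon>\<close>, so the bound
  \<open>4 * \<epsilon>\<close> excludes the loops they would produce.\<close>

locale no_short_loops =
  fixes X :: "'a::metric_space set" and x :: 'a and \<epsilon> :: real
  assumes compact_X: "compact X" and geodesic_X: "geodesic_space X" and x_in: "x \<in> X" and eps: "0 < \<epsilon>"
    and no_short: "\<And>l \<gamma>. simple_loop_le X l \<gamma> \<Longrightarrow> l \<le> 4 * \<epsilon> \<Longrightarrow> path_image \<gamma> \<inter> cball x \<epsilon> = {}"
begin

text \<open>Near \<open>x\<close> geodesics from \<open>x\<close> branch as in a tree. Otherwise the
  detour from \<open>x\<close> over \<open>y'\<close> to \<open>y\<close> avoids \<open>m\<close>,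
  on its second leg because of \<open>near\<close>, and together with a geodesic through
  \<open>m\<close> it contains a short loop through \<open>m\<close>.\<close>

lemma tripod:
  assumes y: "y \<in> X" "dist x y \<le> \<epsilon>" and y': "y' \<in> X" "dist x y' \<le> \<epsilon>"
    and m: "m \<in> gseg X x y" and near: "dist y y' < dist m y"
  shows "m \<in> gseg X x y'"
proof (rule ccontr)
  assume out: "m \<notin> gseg X x y'"
  have dm: "dist x m + dist m y = dist x y" using m by (simp add: gseg_def)
  have "m \<noteq> x" using out y'(1) x_in by (auto simp: gseg_def)
  have "x \<noteq> y'"
  proof
    assume "x = y'"
    then have "dist y y' = dist x y" by (simp add: dist_commute)
    then show False using near dm zero_le_dist[of x m] by linarith
  qed
  have "y \<noteq> y'" using m out by blast
  have "0 < dist x y" using dm near zero_le_dist[of y y'] zero_le_dist[of x m] by linarith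
  then have "x \<noteq> y" by auto
  obtain r where r: "arc_le X (dist x y) x y r" "m \<in> path_image r"
    using geodesic_arc_through[OF geodesic_X m x_in y(1) \<open>x \<noteq> y\<close>] .
  obtain q where q: "arc_le X (dist x y') x y' q"
    using geodesic_arc_exists[OF geodesic_X x_in y'(1) \<open>x \<noteq> y'\<close>] .
  obtain p where p: "arc_le X (dist y' y) y' y p"
    using geodesic_arc_exists[OF geodesic_X y'(1) y(1)] \<open>y \<noteq> y'\<close> by metis
  obtain s where s: "arc_le (path_image q \<union> path_image p) (dist x y' + dist y' y) x y s"
    using arc_shortcut[OF q p \<open>x \<noteq> y\<close>] .
  have "m \<notin> path_image q" using geodesic_arc_gseg[OF q] out by blast
  moreover have "m \<notin> path_image p"
  proof
    assume "m \<in> path_image p"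
    then have "dist y' m + dist m y = dist y' y" using geodesic_arc_gseg[OF p] by (auto simp: gseg_def)
    then show False using near zero_le_dist[of y' m] dist_commute[of y y'] by linarith
  qed
  ultimately have "m \<notin> path_image s" using arc_le_image(1)[OF s] by blast
  then obtain \<gamma> where \<gamma>: "simple_loop_le (path_image r \<union> path_image s) (dist x y + (dist x y' + dist y' y)) \<gamma>" "m \<in> path_image \<gamma>"
    using theta_loop[OF r(1) s r(2)] by blast
  have "path_image r \<union> path_image s \<subseteq> X"
    using arc_le_image(1)[OF s] arc_le_image(1)[OF q] arc_le_image(1)[OF p] arc_le_image(1)[OF r(1)] by blast
  moreover have "dist x y + (dist x y' + dist y' y) \<le> 4 * \<epsilon>"
    using y(2) y'(2) near dm eps zero_le_dist[of x m] dist_commute[of y y'] by linarith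
  ultimately have "path_image \<gamma> \<inter> cball x \<epsilon> = {}"
    using no_short[OF simple_loop_le_mono[OF \<gamma>(1) _ order_refl]] by blast
  moreover have "dist x m \<le> \<epsilon>" using dm y(2) zero_le_dist[of m y] by linarith
  ultimately show False using \<gamma>(2) by auto
qed

lemma unique_point:
  assumes y: "y \<in> X" "dist x y \<le> \<epsilon>" and m: "m \<in> gseg X x y" "m' \<in> gseg X x y" "dist x m = dist x m'"
  shows "m = m'"
proof (rule ccontr)
  assume "m \<noteq> m'"
  then obtain \<gamma> where "simple_loop_le X (2 * dist x y) \<gamma>" "m \<in> path_image \<gamma>"
    using geodesic_bigon_loop[OF geodesic_X x_in y(1) m] by blast
  moreover have "dist x m \<le> \<epsilon>" using gsegD(2)[OF m(1)] y(2) zero_le_dist[of m y] by linarith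
  ultimately show False using no_short[of "2 * dist x y" \<gamma>] y(2) eps by auto
qed

text \<open>A point \<open>m\<close> slightly closer to \<open>x\<close> than the farthest point of a loop would disconnect the loop.\<close>

lemma no_loop_in_ball:
  assumes \<gamma>: "simple_loop_le X l \<gamma>" and ball: "path_image \<gamma> \<subseteq> ball x \<epsilon>"
  shows False
proof -
  let ?C = "path_image \<gamma>"
  note g = simple_loop_leD[OF \<gamma>]
  have "continuous_on ?C (\<lambda>z. dist x z)" by (intro continuous_intros)
  then obtain c where c: "c \<in> ?C" "\<And>z. z \<in> ?C \<Longrightarrow> dist x z \<le> dist x c"
    using continuous_attains_sup[OF g(7,6)] by blast
  have "loop_free \<gamma>" using g(1) by (simp add: simple_path_def)
  from this[unfolded loop_free_def, rule_format, of 0 "1/2"] have "\<gamma> 0 \<noteq> \<gamma> (1/2)" by auto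
  moreover have "\<gamma> 0 \<in> ?C" "\<gamma> (1/2) \<in> ?C" by (auto simp: path_image_def)
  ultimately obtain c' where c': "c' \<in> ?C" "c' \<noteq> c" by metis
  have inX: "z \<in> X" "dist x z < \<epsilon>" if "z \<in> ?C" for z using that g(3) ball by auto
  have "c \<notin> gseg X x c'"
  proof
    assume "c \<in> gseg X x c'"
    from gsegD(2)[OF this] have "dist c c' \<le> 0" using c(2)[OF c'(1)] by linarith
    then show False using c'(2) by simp
  qed
  moreover have "closed (gseg X x c')" using compact_gseg[OF compact_X] by (rule compact_imp_closed)
  \<comment> \<open>Points close enough to \<open>c\<close> do not lie on geodesics from
    \<open>x\<close> to \<open>c'\<close>, so \<open>m\<close> can be placed on the way to
    \<open>c\<close> but not on the way to \<open>c'\<close>.\<close>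
  ultimately obtain e where e: "e > 0" "ball c e \<inter> gseg X x c' = {}"
    by (metis ComplI disjoint_eq_subset_Compl open_Compl open_contains_ball)
  have "x \<noteq> c" using c(2)[OF c'(1)] c'(2) by auto
  define s where "s = min (e / 2) (dist x c / 2)"
  have s: "0 < s" "s < e" "s \<le> dist x c" using e(1) \<open>x \<noteq> c\<close> by (auto simp: s_def min_def)
  obtain m where m: "m \<in> gseg X x c" "dist x m = dist x c - s"
    using geodesic_point[OF geodesic_X x_in inX(1)[OF c(1)], of "dist x c - s"] s by auto
  have dmc: "dist m c = s" using m by (simp add: gseg_def)
  have "m \<notin> gseg X x c'" using e(2) dmc s(2) by (auto simp: dist_commute)
  moreover have "c' \<in> gseg X x c'" using inX(1)[OF c'(1)] by (simp add: gseg_def)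
  ultimately have "m \<noteq> c'" by blast
  have "m \<noteq> c" using dmc s(1) by auto
  let ?S = "?C - {m}"
  \<comment> \<open>By \<open>tripod\<close> the points behind \<open>m\<close> form a clopen part
    of the loop minus \<open>m\<close>; it contains \<open>c\<close> but not
    \<open>c'\<close>.\<close>
  let ?A = "{y \<in> ?S. m \<in> gseg X x y}"
  have conn: "connected ?S" using g(1,4) by (rule simple_loop_minus_point_connected)
  have step: "m \<in> gseg X x y'"
    if "y \<in> ?C" "y' \<in> ?C" "m \<in> gseg X x y" "dist y y' < dist m y" for y y'
    using tripod[of y y' m] inX[OF that(1)] inX[OF that(2)] that(3,4) by simp
  have "openin (top_of_set ?S) ?A"
    unfolding openin_metric_iff
  proof (intro conjI ballI)
    fix y assume "y \<in> ?A"
    then show "\<exists>e>0. \<forall>y'\<in>?S. dist y y' < e \<longrightarrow> y' \<in> ?A"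
      by (intro exI[of _ "dist m y"]) (auto intro: step)
  qed auto
  moreover have "openin (top_of_set ?S) (?S - ?A)"
    unfolding openin_metric_iff
  proof (intro conjI ballI)
    fix y assume y: "y \<in> ?S - ?A"
    show "\<exists>e>0. \<forall>y'\<in>?S. dist y y' < e \<longrightarrow> y' \<in> ?S - ?A"
    \<comment> \<open>Half the distance allows \<open>tripod\<close> to be applied with
      \<open>y\<close> and \<open>y'\<close> exchanged.\<close>
    proof (intro exI[of _ "dist m y / 2"] conjI ballI impI)
      show "0 < dist m y / 2" using y by auto
      fix y' assume y': "y' \<in> ?S" "dist y y' < dist m y / 2"
      have "m \<notin> gseg X x y'"
      proof
        assume "m \<in> gseg X x y'"
        moreover have "dist y' y < dist m y'"
          using y'(2) dist_triangle[of m y y'] dist_commute[of y y'] by linarith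
        ultimately show False using step[of y' y] y y' by auto
      qed
      then show "y' \<in> ?S - ?A" using y'(1) by blast
    qed
  qed auto
  ultimately have "?A = {} \<or> ?A = ?S"
    using conn unfolding connected_clopen by (auto simp: closedin_def)
  moreover have "c \<in> ?A" using c(1) m(1) \<open>m \<noteq> c\<close> by auto
  moreover have "c' \<in> ?S" "c' \<notin> ?A" using c'(1) \<open>m \<noteq> c'\<close> \<open>m \<notin> gseg X x c'\<close> by auto
  ultimately show False by blast
qed

text \<open>If all loops lie on one side \<open>V\<close> of \<open>x\<close>, then all geodesics from \<open>x\<close> to points of \<open>V\<close> at distance
  \<open>\<epsilon>\<close> start with a common segment: only finitely many of them have to be compared, and any two
  share a segment because no loop passes through \<open>x\<close>. The end of that segment is the root of
  a branch.\<close>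

lemma branch_exists:
  fixes c :: 'a
  defines "V \<equiv> {y \<in> X - {x}. joined (X - {x}) c y}"
  assumes off: "\<And>l \<gamma>. simple_loop_le X l \<gamma> \<Longrightarrow> x \<notin> path_image \<gamma>"
    and inV: "\<And>l \<gamma>. simple_loop_le X l \<gamma> \<Longrightarrow> path_image \<gamma> \<subseteq> V"
    and \<gamma>0: "simple_loop_le X l0 \<gamma>0"
  obtains w W where "branch X w W" "x \<in> W"
proof -
  have V: "openin (top_of_set X) V" "closed (insert x V)"
    unfolding V_def using joined_component_clopen[OF compact_X geodesic_X x_in] by blast+
  have VX: "V \<subseteq> X" and xV: "x \<notin> V" by (auto simp: V_def)
  \<comment> \<open>Going back from \<open>y\<close> towards \<open>x\<close> does not leave
    \<open>V\<close> before \<open>x\<close> is reached.\<close>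
  have V_back: "z \<in> V" if z: "z \<in> gseg X x y" "z \<noteq> x" and y: "y \<in> V" for z y
  proof -
    have zX: "z \<in> X" using z(1) by (simp add: gseg_def)
    have "x \<notin> gseg X y z"
    proof
      assume "x \<in> gseg X y z"
      then have "dist y x + dist x z = dist y z" by (simp add: gseg_def)
      moreover have "dist x z + dist z y = dist x y" using z(1) by (simp add: gseg_def)
      ultimately have "dist x z = 0" using dist_commute[of y x] dist_commute[of y z] zero_le_dist[of x z] by linarith
      then show False using z(2) by simp
    qed
    then have "joined (X - {x}) y z" using joined_geodesic[OF geodesic_X _ zX] y VX by blast
    then show ?thesis using y z(2) zX joined_trans by (auto simp: V_def)
  qed
  \<comment> \<open>\<open>\<gamma>0\<close> does not fit into the ball, so \<open>V\<close> has
    points at distance exactly \<open>\<epsilon>\<close> from \<open>x\<close>.\<close>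
  obtain c' where c'0: "c' \<in> path_image \<gamma>0" "c' \<notin> ball x \<epsilon>"
    using no_loop_in_ball[OF \<gamma>0] by blast
  then have c': "c' \<in> path_image \<gamma>0" "\<epsilon> \<le> dist x c'" by simp_all
  have c'V: "c' \<in> V" using inV[OF \<gamma>0] c'(1) by blast
  obtain e1 where e1: "e1 \<in> gseg X x c'" "dist x e1 = \<epsilon>"
    using geodesic_point[OF geodesic_X x_in, of c' \<epsilon>] c'V VX c'(2) eps by auto
  have e1V: "e1 \<in> V" using V_back[OF e1(1) _ c'V] e1(2) eps by auto
  \<comment> \<open>The sphere of radius \<open>\<epsilon>\<close> in \<open>V\<close>: inserting
    \<open>x\<close>, which is not on the sphere, makes the first factor closed.\<close>
  define S where "S = insert x V \<inter> {e. dist x e = \<epsilon>}"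
  have "compact S"
  proof -
    have "compact (insert x V)"
      using V(2) compact_X VX x_in by (metis compact_Int_closed inf.absorb2 insert_subset)
    moreover have "closed {e. dist x e = \<epsilon>}" by (intro closed_Collect_eq continuous_intros)
    ultimately show ?thesis unfolding S_def by (rule compact_Int_closed)
  qed
  have SV: "e \<in> V" "dist x e = \<epsilon>" if "e \<in> S" for e using that eps by (auto simp: S_def)
  \<comment> \<open>If geodesics to \<open>e1\<close> and to \<open>e\<close> parted at
    \<open>x\<close>, an arc joining their ends off \<open>x\<close> would close them to a simple
    loop through \<open>x\<close>.\<close>
  have share: "\<exists>m. m \<noteq> x \<and> m \<in> gseg X x e1 \<and> m \<in> gseg X x e" if e: "e \<in> S" for e
  proof (cases "e = e1")
    case True
    then show ?thesis using e1V xV VX by (intro exI[of _ e1]) (auto simp: gseg_def)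
  next
    case False
    have eV: "e \<in> V" and eX: "e \<in> X" and e1X: "e1 \<in> X" using SV[OF e] e1V VX by auto
    have nx: "x \<noteq> e" "x \<noteq> e1" using eV e1V xV by auto
    have "joined (X - {x}) e1 e"
      using eV e1V joined_trans[OF joined_sym] unfolding V_def by blast
    then obtain l p where p: "arc_le (X - {x}) l e1 e p" using False by (auto simp: joined_def)
    obtain P where P: "arc_le X (dist x e1) x e1 P" using geodesic_arc_exists[OF geodesic_X x_in e1X nx(2)] .
    obtain Q where Q: "arc_le X (dist x e) x e Q" using geodesic_arc_exists[OF geodesic_X x_in eX nx(1)] .
    show ?thesis
    proof (rule ccontr)
      assume none: "\<nexists>m. m \<noteq> x \<and> m \<in> gseg X x e1 \<and> m \<in> gseg X x e"
      have disj: "path_image (reversepath P) \<inter> path_image Q \<subseteq> {x}"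
        using none geodesic_arc_gseg[OF P] geodesic_arc_gseg[OF Q] by auto
      let ?R = "reversepath P +++ Q"
      have R: "arc_le (path_image (reversepath P) \<union> path_image Q) (dist x e1 + dist x e) e1 e ?R"
        by (rule arc_le_join[OF arc_le_reverse[OF P] Q disj])
      have "x \<in> path_image ?R"
        using arc_le_image(2)[OF Q] P Q by (subst path_image_join) (auto simp: arc_le_def)
      moreover have "x \<notin> path_image p" using arc_le_image(1)[OF p] by blast
      ultimately obtain \<gamma> where \<gamma>: "simple_loop_le (path_image ?R \<union> path_image p) (dist x e1 + dist x e + l) \<gamma>" "x \<in> path_image \<gamma>"
        using theta_loop[OF R p] by blast
      have "path_image ?R \<union> path_image p \<subseteq> X"
        using arc_le_image(1)[OF R] arc_le_image(1)[OF p] arc_le_image(1)[OF P] arc_le_image(1)[OF Q] by auto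
      then show False using off[OF simple_loop_le_mono[OF \<gamma>(1) _ order_refl]] \<gamma>(2) by blast
    qed
  qed
  then obtain M where M: "\<And>e. e \<in> S \<Longrightarrow> M e \<noteq> x" "\<And>e. e \<in> S \<Longrightarrow> M e \<in> gseg X x e1"
    "\<And>e. e \<in> S \<Longrightarrow> M e \<in> gseg X x e"
    by metis
  obtain T where T: "T \<subseteq> S" "finite T" "S \<subseteq> (\<Union>t\<in>T. ball t (\<epsilon>/2))"
    by (rule compactE_image[OF \<open>compact S\<close>, of S "\<lambda>t. ball t (\<epsilon>/2)"]) (use eps in auto)
  \<comment> \<open>A lower bound for the finitely many shared segments. The cap
    \<open>\<epsilon>/4\<close> makes \<open>dist w t\<close> at least
    \<open>3/4 * \<epsilon>\<close>, which exceeds the mesh \<open>\<epsilon>/2\<close> of the net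
    \<open>T\<close> when \<open>tripod\<close> is applied in \<open>wS\<close>.\<close>
  define s where "s = Min (insert (\<epsilon>/4) ((\<lambda>t. dist x (M t)) ` T))"
  have s: "s \<le> \<epsilon>/4" "\<And>t. t \<in> T \<Longrightarrow> s \<le> dist x (M t)"
    unfolding s_def using T(2) by (intro Min_le; simp)+
  have s0: "0 < s"
    unfolding s_def using T(2) eps M(1) T(1) by (subst Min_gr_iff) (auto simp: subset_iff)
  have e1X: "e1 \<in> X" using e1V VX by blast
  obtain w where w: "w \<in> gseg X x e1" "dist x w = s"
    using geodesic_point[OF geodesic_X x_in e1X, of s] s(1) s0 e1(2) eps by auto
  have wX: "w \<in> X" using w(1) by (simp add: gseg_def)
  have "w \<noteq> x" using w(2) s0 by auto
  have wV: "w \<in> V" by (rule V_back[OF w(1) \<open>w \<noteq> x\<close> e1V])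
  \<comment> \<open>By uniqueness of points on geodesics from \<open>x\<close>, the point at
    distance \<open>s\<close> on the shared segment is \<open>w\<close>.\<close>
  have wT: "w \<in> gseg X x t" if t: "t \<in> T" for t
  proof -
    have tS: "t \<in> S" using t T(1) by blast
    have "M t \<in> X" using M(2)[OF tS] by (simp add: gseg_def)
    then obtain z where z: "z \<in> gseg X x (M t)" "dist x z = s"
      using geodesic_point[OF geodesic_X x_in, of "M t" s] s(2)[OF t] s0 by auto
    have "z \<in> gseg X x e1" using gseg_trans1(1)[OF M(2)[OF tS] z(1)] .
    then have "z = w" using unique_point[OF e1X _ _ w(1)] e1(2) z(2) w(2) by simp
    then show ?thesis using gseg_trans1(1)[OF M(3)[OF tS] z(1)] by simp
  qed
  have wS: "w \<in> gseg X x e" if e: "e \<in> S" for e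
  proof -
    obtain t where t: "t \<in> T" "dist t e < \<epsilon>/2" using T(3) e by (meson UN_E mem_ball subsetD)
    have tS: "t \<in> S" using t(1) T(1) by blast
    have "dist w t = \<epsilon> - s" using wT[OF t(1)] SV(2)[OF tS] w(2) by (simp add: gseg_def)
    then have "dist t e < dist w t" using t(2) s(1) eps by linarith
    then show ?thesis
      using tripod[of t e w] wT[OF t(1)] SV[OF tS] SV[OF e] VX by auto
  qed
  \<comment> \<open>What remains of \<open>X\<close> after cutting at \<open>w\<close> and dropping
    the part beyond it: the complement of \<open>V\<close>, which contains \<open>x\<close>, and the
    points of \<open>V\<close> in the ball that are not reached through \<open>w\<close>.\<close>
  define W where "W = (X - V) \<union> {y \<in> V. dist x y < \<epsilon> \<and> w \<notin> gseg X x y}"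
  have W_iff: "y \<in> W \<longleftrightarrow> y \<in> X \<and> (y \<in> V \<longrightarrow> dist x y < \<epsilon> \<and> w \<notin> gseg X x y)" for y
    using VX by (auto simp: W_def)
  have W_iff': "y \<in> X - insert w W \<longleftrightarrow> y \<in> V \<and> y \<noteq> w \<and> (dist x y < \<epsilon> \<longrightarrow> w \<in> gseg X x y)" for y
    using VX by (auto simp: W_iff)
  have "branch X w W"
    unfolding branch_def
  proof (intro conjI allI)
    show "w \<in> X" by (fact wX)
    have "w \<in> gseg X x w" using wX by (simp add: gseg_def)
    then show "w \<notin> W" using wV by (simp add: W_iff)
    show "openin (top_of_set X) W"
      unfolding openin_metric_iff
    proof (intro conjI ballI)
      show "W \<subseteq> X" by (auto simp: W_iff)
      fix y assume y: "y \<in> W"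
      consider "y = x" | "y \<notin> V" "y \<noteq> x" | "y \<in> V" by blast
      then show "\<exists>e>0. \<forall>y'\<in>X. dist y y' < e \<longrightarrow> y' \<in> W"
      proof cases
        case 1
        \<comment> \<open>A geodesic from \<open>x\<close> shorter than \<open>s\<close> cannot
          contain \<open>w\<close>.\<close>
        have "w \<notin> gseg X x y'" if "dist x y' < s" for y'
          using that w(2) zero_le_dist[of w y'] gsegD(2)[of w X x y'] by linarith
        then show ?thesis using 1 s0 s(1) eps by (intro exI[of _ s]) (auto simp: W_iff)
      next
        case 2
        have "openin (top_of_set X) (X - insert x V)"
          using V(2) VX x_in by (simp add: openin_diff closed_subset)
        then obtain e where "e > 0" "\<forall>y'\<in>X. dist y y' < e \<longrightarrow> y' \<in> X - insert x V"
          using 2 y unfolding openin_metric_iff W_iff by blast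
        then show ?thesis by (intro exI[of _ e]) (auto simp: W_iff)
      next
        case 3
        then have d: "dist x y < \<epsilon>" "w \<notin> gseg X x y" and yX: "y \<in> X" using y by (auto simp: W_iff)
        have "y \<noteq> w" using d(2) wX by (auto simp: gseg_def)
        show ?thesis
        proof (intro exI[of _ "min (\<epsilon> - dist x y) (dist w y / 2)"] conjI ballI impI)
          show "0 < min (\<epsilon> - dist x y) (dist w y / 2)" using d(1) \<open>y \<noteq> w\<close> by simp
          fix y' assume y': "y' \<in> X" "dist y y' < min (\<epsilon> - dist x y) (dist w y / 2)"
          have d': "dist x y' < \<epsilon>" using y'(2) dist_triangle[of x y' y] by linarith
          have "dist y' y < dist w y'"
            using y'(2) dist_triangle[of w y y'] dist_commute[of y y'] by linarith
          then have "w \<notin> gseg X x y'"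
            using tripod[of y' y w] d d' y'(1) yX by auto
          then show "y' \<in> W" using y'(1) d' by (simp add: W_iff)
        qed
      qed
    qed
    show "closed (insert w W)"
    proof (rule closed_of_openin_complement[OF compact_X])
      show "insert w W \<subseteq> X" using wX by (auto simp: W_iff)
      show "openin (top_of_set X) (X - insert w W)"
        unfolding openin_metric_iff
      proof (intro conjI ballI)
        fix y assume "y \<in> X - insert w W"
        then have y: "y \<in> V" "y \<noteq> w" "dist x y < \<epsilon> \<Longrightarrow> w \<in> gseg X x y" unfolding W_iff' by auto
        have yX: "y \<in> X" using y(1) VX by blast
        obtain e where e: "e > 0" "\<And>y'. y' \<in> X \<Longrightarrow> dist y y' < e \<Longrightarrow> y' \<in> V"
          using V(1) y(1) unfolding openin_metric_iff by blast
        show "\<exists>e>0. \<forall>y'\<in>X. dist y y' < e \<longrightarrow> y' \<in> X - insert w W"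
        proof (cases "dist x y \<le> \<epsilon>")
          case True
          \<comment> \<open>On the sphere itself this is \<open>wS\<close>: every geodesic that
            leaves the ball inside \<open>V\<close> has to pass \<open>w\<close>.\<close>
          then have wy: "w \<in> gseg X x y"
            using y(1,3) wS[of y] by (cases "dist x y = \<epsilon>") (auto simp: S_def)
          show ?thesis
          proof (intro exI[of _ "min e (dist w y)"] conjI ballI impI)
            show "0 < min e (dist w y)" using e(1) y(2) by simp
            fix y' assume y': "y' \<in> X" "dist y y' < min e (dist w y)"
            have "y' \<noteq> w" using y'(2) by (auto simp: dist_commute)
            moreover have "w \<in> gseg X x y'" if "dist x y' < \<epsilon>"
              using tripod[of y y' w] True yX y' that wy by simp
            ultimately show "y' \<in> X - insert w W" using e(2)[of y'] y' unfolding W_iff' by simp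
          qed
        next
          case False
          show ?thesis
          proof (intro exI[of _ "min e (dist x y - \<epsilon>)"] conjI ballI impI)
            show "0 < min e (dist x y - \<epsilon>)" using e(1) False by simp
            fix y' assume y': "y' \<in> X" "dist y y' < min e (dist x y - \<epsilon>)"
            have d': "\<epsilon> < dist x y'" using y'(2) dist_triangle[of x y y'] dist_commute[of y y'] by linarith
            then have "y' \<noteq> w" using w(2) s(1) eps by auto
            then show "y' \<in> X - insert w W" using e(2)[of y'] y' d' unfolding W_iff' by simp
          qed
        qed
      qed auto
    qed
    fix l \<gamma>
    show "\<not> simple_loop_le (insert w W) l \<gamma>"
    proof
      assume \<gamma>: "simple_loop_le (insert w W) l \<gamma>"
      have \<gamma>X: "simple_loop_le X l \<gamma>"
        using \<gamma> by (rule simple_loop_le_mono) (use wX in \<open>auto simp: W_iff\<close>)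
      \<comment> \<open>All loops lie in \<open>V\<close>, and the part of \<open>insert w W\<close>
        in \<open>V\<close> lies in the ball.\<close>
      have "path_image \<gamma> \<subseteq> insert w W \<inter> V" using simple_loop_leD(3)[OF \<gamma>] inV[OF \<gamma>X] by blast
      also have "\<dots> \<subseteq> ball x \<epsilon>" using w(2) s(1) eps by (auto simp: W_iff)
      finally show False using no_loop_in_ball[OF \<gamma>X] by blast
    qed
  qed
  moreover have "x \<in> W" using x_in xV by (simp add: W_iff)
  ultimately show ?thesis by (rule that)
qed

end

section \<open>The core lies in the hull\<close>

lemma core_subset_hull:
  fixes X :: "'a::metric_space set"
  assumes X: "compact X" "covering_dim_le (top_of_set X) 1" "geodesic_space X"
    and \<gamma>0: "simple_loop_le X l0 \<gamma>0"
  shows "core X \<subseteq> pi1_hull X"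
proof
  fix x assume x: "x \<in> core X"
  then have xX: "x \<in> X" using core_subset by blast
  show "x \<in> pi1_hull X"
  proof (rule ccontr)
    assume nh: "x \<notin> pi1_hull X"
    have off: "x \<notin> path_image \<gamma>" if "simple_loop_le X l \<gamma>" for l \<gamma>
      using simple_loop_in_hull[OF X(1,2) that] nh by blast
    \<comment> \<open>The side of \<open>x\<close> that contains the given loop; a simple loop
      elsewhere would make \<open>x\<close> a separating point.\<close>
    define V where "V = {y \<in> X - {x}. joined (X - {x}) (pathstart \<gamma>0) y}"
    have V: "openin (top_of_set X) V" "closed (insert x V)" "x \<notin> V"
      unfolding V_def using joined_component_clopen[OF X(1,3) xX] by blast+
    have "pathstart \<gamma>0 \<in> V"
      using off[OF \<gamma>0] simple_loop_leD(3)[OF \<gamma>0] by (auto simp: V_def joined_def)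
    then have "path_image \<gamma>0 \<inter> V \<noteq> {}" by blast
    then have \<gamma>0V: "path_image \<gamma>0 \<subseteq> V"
      using connected_subset_clopen[OF simple_loop_leD(8,3)[OF \<gamma>0] V(1,2) off[OF \<gamma>0]] by blast
    have inV: "path_image \<gamma> \<subseteq> V" if \<gamma>: "simple_loop_le X l \<gamma>" for l \<gamma>
    proof (rule ccontr)
      assume "\<not> path_image \<gamma> \<subseteq> V"
      then have "path_image \<gamma> \<inter> V = {}"
        using connected_subset_clopen[OF simple_loop_leD(8,3)[OF \<gamma>] V(1,2) off[OF \<gamma>]] by blast
      then have "path_image \<gamma> \<subseteq> X - insert x V" using simple_loop_leD(3)[OF \<gamma>] off[OF \<gamma>] by blast
      then show False using separating_point_in_hull[OF X xX V \<gamma>0 \<gamma>0V \<gamma>] nh by blast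
    qed
    \<comment> \<open>Otherwise arbitrarily short loops come arbitrarily close to \<open>x\<close>,
      and \<open>limit_of_loops_in_hull\<close> applies.\<close>
    obtain \<epsilon> where \<epsilon>: "0 < \<epsilon>"
      "\<And>l \<gamma>. simple_loop_le X l \<gamma> \<Longrightarrow> l \<le> 4 * \<epsilon> \<Longrightarrow> path_image \<gamma> \<inter> cball x \<epsilon> = {}"
    proof (rule ccontr)
      assume "\<not> thesis"
      then have bad: "\<exists>l \<gamma>. simple_loop_le X l \<gamma> \<and> l \<le> 4 * \<epsilon> \<and> path_image \<gamma> \<inter> cball x \<epsilon> \<noteq> {}" if "0 < \<epsilon>" for \<epsilon>
        using that \<open>\<And>\<epsilon>. 0 < \<epsilon> \<Longrightarrow> (\<And>l \<gamma>. simple_loop_le X l \<gamma> \<Longrightarrow> l \<le> 4 * \<epsilon> \<Longrightarrow> path_image \<gamma> \<inter> cball x \<epsilon> = {}) \<Longrightarrow> thesis\<close>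
        by blast
      have "\<exists>\<gamma>. simple_loop_le (X \<inter> ball x \<delta>) \<delta> \<gamma>" if \<delta>: "0 < \<delta>" for \<delta>
      proof -
        \<comment> \<open>A distance of \<open>\<delta>/6\<close> plus a length of
          \<open>4 * (\<delta>/6)\<close> stays below \<open>\<delta>\<close>.\<close>
        obtain l \<gamma> where \<gamma>: "simple_loop_le X l \<gamma>" "l \<le> 4 * (\<delta>/6)" "path_image \<gamma> \<inter> cball x (\<delta>/6) \<noteq> {}"
          using bad[of "\<delta>/6"] \<delta> by auto
        then obtain z where "z \<in> path_image \<gamma>" "dist x z \<le> \<delta>/6" by force
        then obtain a where a: "a \<in> {0..1}" "dist x (\<gamma> a) \<le> \<delta>/6" unfolding path_image_def by blast
        have "dist x (\<gamma> b) < \<delta>" if "b \<in> {0..1}" for b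
          using len_le_dist[OF simple_loop_leD(5)[OF \<gamma>(1)] a(1) that] a(2) \<gamma>(2) \<delta>
            dist_triangle[of x "\<gamma> b" "\<gamma> a"] by linarith
        then have "path_image \<gamma> \<subseteq> X \<inter> ball x \<delta>"
          using simple_loop_leD(3)[OF \<gamma>(1)] by (auto simp: path_image_def)
        moreover have "l \<le> \<delta>" using \<gamma>(2) \<delta> by simp
        ultimately have "simple_loop_le (X \<inter> ball x \<delta>) \<delta> \<gamma>"
          using \<gamma>(1) len_le_mono[of \<gamma> l \<delta>] by (simp add: simple_loop_le_def)
        then show ?thesis by blast
      qed
      then have "x \<in> pi1_hull X"
        using off by (intro limit_of_loops_in_hull[OF X xX]) blast+
      then show False using nh by blast
    qed
    interpret no_short_loops X x \<epsilon>
      by unfold_locales (use X xX \<epsilon> in auto)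
    obtain w W where "branch X w W" "x \<in> W"
    proof (rule branch_exists[of "pathstart \<gamma>0"])
      show "x \<notin> path_image \<gamma>" if "simple_loop_le X l \<gamma>" for l \<gamma> using off[OF that] .
      show "path_image \<gamma> \<subseteq> {y \<in> X - {x}. joined (X - {x}) (pathstart \<gamma>0) y}" if "simple_loop_le X l \<gamma>" for l \<gamma>
        using inV[OF that] by (simp add: V_def)
      show "simple_loop_le X l0 \<gamma>0" by (fact \<gamma>0)
    qed (rule that)
    then show False using branch_disjoint_core x by blast
  qed
qed

theorem corollary3p11:
  fixes X :: "'a::metric_space set"
  assumes "compact X"
    and "has_covering_dim (top_of_set X) 1"
    and "geodesic_space X"
    and "\<not> contractible X"
  shows "pi1_hull X \<noteq> {}
    \<and> deformation_retracts_onto X (pi1_hull X)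
    \<and> (\<forall>a\<in>pi1_hull X. pi1_map X id \<in> iso (pi1 (pi1_hull X) a) (pi1 X a))"
proof -
  have dim: "covering_dim_le (top_of_set X) 1" using assms(2) by (simp add: has_covering_dim_def)
  obtain l \<gamma> where \<gamma>: "simple_loop_le X l \<gamma>"
    using contractible_without_loops[OF assms(1,3)] assms(4) by blast
  then have ne: "core X \<noteq> {}" using simple_loop_in_core[OF \<gamma>] simple_loop_leD(6)[OF \<gamma>] by blast
  obtain H where "core_deformation X H" using core_deformation_exists[OF assms(1,3) ne] .
  then interpret core_deformation X H .
  have "core X = pi1_hull X"
    using pi1_hull_subset_core core_subset_hull[OF assms(1) dim assms(3) \<gamma>] by blast
  then show ?thesis
    using ne deformation_retracts_onto_core pi1_map_id_iso[OF deformation_retracts_onto_core] by simp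
qed

end
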